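(* Let $(\Gamma,\mu)$ be a weighted graph as in the context. Assume that the doubling property $(D)$, the on-diagonal upper estimate $(DUE)$ and the condition $\Delta(\alpha)$ for some $\alpha>0$ hold. Let $1<p<+\infty$. Then there exists $C_p>0$ such that, for all $f\in L^p(\Gamma)$, $$\|g(f)\|_p\le C_p\|f\|_p,$$ where $g(f)(x)=\left(\sum_{l\ge1}l\,|(I-P)P^lf(x)|^2\right)^{1/2}$ for all $x\in\Gamma$.
   Context: Setting. $\Gamma$ is an infinite set and $\mu_{xy}=\mu_{yx}\ge 0$ is a symmetric weight on $\Gamma\times\Gamma$. Write $x\sim y$ iff $\mu_{xy}>0$. A path of length $M$ joining $x$ to $y$ is a sequence $x_0=x,\dots,x_M=y$ with $x_i\sim x_{i+1}$ for all $0\le i\le M-1$. $\Gamma$ is assumed connected (any two points are joined by a path), and $d(x,y)$ is the shortest length of a path joining $x$ to $y$. For $r\ge0$, $B(x,r)=\{y\in\Gamma:\ d(x,y)\le r\}$. $\Gamma$ is assumed locally uniformly finite: there is an integer $N_0\ge1$ with $\sharp B(x,1)\le N_0$ for all $x\in\Gamma$. Set $m(x)=\sum_{y\sim x}\mu_{xy}$, assumed $>0$ for all $x$; $m(A)=\sum_{x\in A}m(x)$; $V(x,r)=m(B(x,r))$. For $1\le p<\infty$, $\|f\|_p=(\sum_{x\in\Gamma}|f(x)|^pm(x))^{1/p}$, and $L^p(\Gamma)$ is the corresponding space. Let $p(x,y)=\mu_{xy}/m(x)$ and $Pf(x)=\sum_{y}p(x,y)f(y)$. The iterates of $p$ are $p_0(x,y)=\delta(x,y)$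 (equal to $1$ if $x=y$ and $0$ otherwise) and $p_{k+1}(x,y)=\sum_{z\in\Gamma}p(x,z)p_k(z,y)$. Conditions. $(D)$: there is $C>0$ with $V(x,2r)\le CV(x,r)$ for all $x\in\Gamma$, $r>0$. $\Delta(\alpha)$: for all $x,y\in\Gamma$, ($x\sim y\Leftrightarrow \mu_{xy}\ge\alpha m(x)$), and $x\sim x$ for all $x$. $(DUE)$: there is $C>0$ with $p_k(x,x)\le \frac{Cm(x)}{V(x,\sqrt k)}$ for all $x\in\Gamma$ and all integers $k\ge1$. *)

theory Defs
  imports "HOL-Analysis.Analysis"
begin

definition adj :: "('a \<Rightarrow> 'a \<Rightarrow> real) \<Rightarrow> 'a \<Rightarrow> 'a \<Rightarrow> bool" where
  "adj \<mu> x y \<longleftrightarrow> \<mu> x y > 0"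

definition joined_by_path :: "('a \<Rightarrow> 'a \<Rightarrow> real) \<Rightarrow> nat \<Rightarrow> 'a \<Rightarrow> 'a \<Rightarrow> bool" where
  "joined_by_path \<mu> M x y \<longleftrightarrow>
     (\<exists>\<gamma> :: nat \<Rightarrow> 'a. \<gamma> 0 = x \<and> \<gamma> M = y \<and> (\<forall>i<M. adj \<mu> (\<gamma> i) (\<gamma> (Suc i))))"

definition graph_dist :: "('a \<Rightarrow> 'a \<Rightarrow> real) \<Rightarrow> 'a \<Rightarrow> 'a \<Rightarrow> nat" where
  "graph_dist \<mu> x y = (LEAST M. joined_by_path \<mu> M x y)"

definition graph_ball :: "('a \<Rightarrow> 'a \<Rightarrow> real) \<Rightarrow> 'a \<Rightarrow> real \<Rightarrow> 'a set" where
  "graph_ball \<mu> x r = {y. real (graph_dist \<mu> x y) \<le> r}"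

definition vertex_measure :: "('a \<Rightarrow> 'a \<Rightarrow> real) \<Rightarrow> 'a \<Rightarrow> real" where
  "vertex_measure \<mu> x = (\<Sum>y | adj \<mu> x y. \<mu> x y)"

text \<open>The vertex set is the whole type \<open>'a\<close>. Local uniform finiteness makes every
  neighbourhood and every ball finite, so the finite sums in \<open>vertex_measure\<close> and
  \<open>volume\<close> never take their default value.\<close>

locale weighted_graph =
  fixes \<mu> :: "'a \<Rightarrow> 'a \<Rightarrow> real"
  assumes infinite_vertices: "infinite (UNIV :: 'a set)"
    and weight_nonneg: "\<mu> x y \<ge> 0"
    and weight_sym: "\<mu> x y = \<mu> y x"
    and connected: "\<exists>M. joined_by_path \<mu> M x y"
    and locally_uniformly_finite:
      "\<exists>N0\<ge>1. \<forall>x. finite (graph_ball \<mu> x 1) \<and> card (graph_ball \<mu> x 1) \<le> N0"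
    and vertex_measure_pos: "vertex_measure \<mu> x > 0"

definition volume :: "('a \<Rightarrow> 'a \<Rightarrow> real) \<Rightarrow> 'a \<Rightarrow> real \<Rightarrow> real" where
  "volume \<mu> x r = (\<Sum>y\<in>graph_ball \<mu> x r. vertex_measure \<mu> y)"

definition transition :: "('a \<Rightarrow> 'a \<Rightarrow> real) \<Rightarrow> 'a \<Rightarrow> 'a \<Rightarrow> real" where
  "transition \<mu> x y = \<mu> x y / vertex_measure \<mu> x"

primrec transition_iter :: "('a \<Rightarrow> 'a \<Rightarrow> real) \<Rightarrow> nat \<Rightarrow> 'a \<Rightarrow> 'a \<Rightarrow> real" where
  "transition_iter \<mu> 0 x y = (if x = y then 1 else 0)"
| "transition_iter \<mu> (Suc k) x y =
     (\<Sum>\<^sub>\<infinity>z. transition \<mu> x z * transition_iter \<mu> k z y)"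

definition markov_op ::
  "('a \<Rightarrow> 'a \<Rightarrow> real) \<Rightarrow> ('a \<Rightarrow> complex) \<Rightarrow> 'a \<Rightarrow> complex" where
  "markov_op \<mu> f x = (\<Sum>\<^sub>\<infinity>y. of_real (transition \<mu> x y) * f y)"

definition in_Lp ::
  "('a \<Rightarrow> 'a \<Rightarrow> real) \<Rightarrow> real \<Rightarrow> ('a \<Rightarrow> 'b::real_normed_vector) \<Rightarrow> bool" where
  "in_Lp \<mu> p f \<longleftrightarrow> (\<lambda>x. norm (f x) powr p * vertex_measure \<mu> x) summable_on UNIV"

definition Lp_norm ::
  "('a \<Rightarrow> 'a \<Rightarrow> real) \<Rightarrow> real \<Rightarrow> ('a \<Rightarrow> 'b::real_normed_vector) \<Rightarrow> real" where
  "Lp_norm \<mu> p f = (\<Sum>\<^sub>\<infinity>x. norm (f x) powr p * vertex_measure \<mu> x) powr (1 / p)"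

definition doubling :: "('a \<Rightarrow> 'a \<Rightarrow> real) \<Rightarrow> bool" where
  "doubling \<mu> \<longleftrightarrow> (\<exists>C>0. \<forall>x. \<forall>r>0. volume \<mu> x (2 * r) \<le> C * volume \<mu> x r)"

definition Delta_cond :: "('a \<Rightarrow> 'a \<Rightarrow> real) \<Rightarrow> real \<Rightarrow> bool" where
  "Delta_cond \<mu> \<alpha> \<longleftrightarrow>
     (\<forall>x y. adj \<mu> x y \<longleftrightarrow> \<mu> x y \<ge> \<alpha> * vertex_measure \<mu> x) \<and> (\<forall>x. adj \<mu> x x)"

definition DUE :: "('a \<Rightarrow> 'a \<Rightarrow> real) \<Rightarrow> bool" where
  "DUE \<mu> \<longleftrightarrow> (\<exists>C>0. \<forall>x. \<forall>k\<ge>1.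
     transition_iter \<mu> k x x \<le> C * vertex_measure \<mu> x / volume \<mu> x (sqrt (real k)))"

definition g_term ::
  "('a \<Rightarrow> 'a \<Rightarrow> real) \<Rightarrow> ('a \<Rightarrow> complex) \<Rightarrow> 'a \<Rightarrow> nat \<Rightarrow> real" where
  "g_term \<mu> f x l =
     real l * (cmod ((markov_op \<mu> ^^ l) f x - markov_op \<mu> ((markov_op \<mu> ^^ l) f) x))\<^sup>2"

text \<open>The real-valued \<open>infsum\<close> is \<open>0\<close> on a divergent series, so a bound on
  \<open>g_function\<close> is meaningful only together with summability of \<open>g_term \<mu> f x\<close>
  over \<open>{1..}\<close>.\<close>

definition g_function ::
  "('a \<Rightarrow> 'a \<Rightarrow> real) \<Rightarrow> ('a \<Rightarrow> complex) \<Rightarrow> 'a \<Rightarrow> real" where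
  "g_function \<mu> f x = sqrt (\<Sum>\<^sub>\<infinity>l\<in>{1..}. g_term \<mu> f x l)"

end

theory Submission
  imports Defs
begin

text \<open>Write \<open>u\<^sub>l = P\<^sup>l f\<close> and \<open>v\<^sub>l = u\<^sub>l - u\<^sub>l\<^sub>+\<^sub>1\<close>. Since \<open>P\<close> has finite range, it suffices to
  bound finite truncations for finitely supported real \<open>f\<close>. The diagonal estimate self-improves, by a weighted
  Caccioppoli argument, to off-diagonal decay of the heat kernel, so the nontangential maximal
  function of \<open>u\<close> is dominated by a multiple \<open>H\<close> of the Hardy--Littlewood maximal function. Two
  energy inequalities, both resting on the laziness of the walk, give
  \<open>\<Sum> (l + 1) \<eta>\<^sub>l\<^sup>4 v\<^sub>l\<^sup>2 \<lesssim> \<Sum> \<eta>\<^sub>0\<^sup>2 f\<^sup>2\<close> up to an error living in the layer where the space-time cutoff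
  \<open>\<eta>\<close> varies, and there \<open>H\<close> controls \<open>u\<close>.

  For \<open>p < 2\<close> take cutoffs supported in the sawtooth region over \<open>{H \<le> c}\<close>; integrating over \<open>c\<close>
  bounds the sum of \<open>g(f)\<^sup>2 H\<^bsup>p - 2\<^esup>\<close> by that of \<open>H\<^sup>p\<close>. For \<open>p > 2\<close> test \<open>g(f)\<^sup>2\<close> against a weight
  \<open>w\<close>: half of the semigroup can be moved onto \<open>w\<close>, whose averages exceed a level \<open>c\<close> only in the
  tent over \<open>{M w > c}\<close>, and cutoffs supported in these tents yield the bound \<open>\<Sum> M w H\<^sup>2\<close>. All
  integrals over levels are replaced by sums over powers of two.\<close>

section \<open>Weighted graphs and the Markov operator\<close>

text \<open>The heat kernel enters only through the pointwise bound of u by H; the factor l in front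
  of v_l^2 comes from energies. Without cutoffs the mechanism is short. In one step of the walk the
  squared L2 norm drops by at least a multiple of the Dirichlet energy, so the energies are summable
  in time. The energy itself drops by at least a multiple of the squared norm of v_l; weighting this
  drop by l + 1 and summing by parts leads back to the sum of the energies. In discrete time such
  drops are guaranteed because the loop at each vertex keeps the spectrum of P away from -1. The
  obstacle is p different from 2. Localising makes differences fall on the cutoff, and each leaves
  an error in u instead of v_l; hence the pointwise bound on parabolic neighbourhoods. A cutoff
  depending on d(x, F) / sqrt l has space differences of order 1 / sqrt l and time differences of
  order 1 / l, confined to l of order d(x, F)^2, so that the errors add up to a constant at each
  vertex. Every sum runs over a finite set \<open>Y\<close>, which makes all exchanges of summation
  free; the constants depend neither on \<open>Y\<close> nor on the truncation
  \<open>L\<close>.\<close>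

lemma joined_by_path_eq_relpowp: "joined_by_path \<mu> M x y \<longleftrightarrow> (adj \<mu> ^^ M) x y"
  by (simp add: joined_by_path_def relpowp_fun_conv)

context weighted_graph
begin

abbreviation m :: "'a \<Rightarrow> real" where "m \<equiv> vertex_measure \<mu>"
abbreviation d :: "'a \<Rightarrow> 'a \<Rightarrow> nat" where "d \<equiv> graph_dist \<mu>"
abbreviation B :: "'a \<Rightarrow> real \<Rightarrow> 'a set" where "B \<equiv> graph_ball \<mu>"
abbreviation V :: "'a \<Rightarrow> real \<Rightarrow> real" where "V \<equiv> volume \<mu>"

abbreviation edge_sum :: "'a set \<Rightarrow> ('a \<Rightarrow> 'a \<Rightarrow> real) \<Rightarrow> real" where
  "edge_sum Y h \<equiv> \<Sum>x\<in>Y. \<Sum>y\<in>Y. \<mu> x y * h x y"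

lemma adj_sym: "adj \<mu> x y \<longleftrightarrow> adj \<mu> y x"
  by (simp add: adj_def weight_sym)

lemma relpowp_adj_sym: "(adj \<mu> ^^ n) x y \<Longrightarrow> (adj \<mu> ^^ n) y x"
proof (induction n arbitrary: y)
  case (Suc n)
  then obtain z where "(adj \<mu> ^^ n) x z" "adj \<mu> z y" by auto
  then show ?case using Suc.IH adj_sym relpowp_Suc_I2 by metis
qed auto

lemma relpowp_dist: "(adj \<mu> ^^ d x y) x y"
  using connected[of x y] unfolding graph_dist_def joined_by_path_eq_relpowp
  by (auto intro: LeastI_ex)

lemma dist_le: "(adj \<mu> ^^ n) x y \<Longrightarrow> d x y \<le> n"
  unfolding graph_dist_def joined_by_path_eq_relpowp by (rule Least_le)

lemma dist_refl [simp]: "d x x = 0"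
  using dist_le[of 0 x x] by simp

lemma dist_eq_0 [simp]: "d x y = 0 \<longleftrightarrow> x = y"
  using relpowp_dist[of x y] by auto

lemma dist_sym: "d x y = d y x"
  by (meson relpowp_adj_sym dist_le relpowp_dist le_antisym)

lemma dist_triangle: "d x z \<le> d x y + d y z"
  by (metis dist_le relpowp_dist relpowp_trans)

lemma dist_adj: "adj \<mu> x y \<Longrightarrow> d x y \<le> 1"
  by (rule dist_le) auto

lemma mem_ball: "y \<in> B x r \<longleftrightarrow> real (d x y) \<le> r"
  by (simp add: graph_ball_def)

lemma finite_neighbours [simp, intro]: "finite {y. adj \<mu> x y}"
proof -
  have "{y. adj \<mu> x y} \<subseteq> B x 1" using dist_adj by (fastforce simp: mem_ball)
  then show ?thesis using locally_uniformly_finite finite_subset by blast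
qed

lemma finite_ball [simp, intro]: "finite (B x r)"
proof -
  have *: "finite (B x (real n))" for n
  proof (induction n)
    case 0
    have "B x (real 0) \<subseteq> {x}" by (auto simp: mem_ball)
    then show ?case using finite_subset by blast
  next
    case (Suc n)
    have "B x (real (Suc n)) \<subseteq> (\<Union>y\<in>B x (real n). insert y {z. adj \<mu> y z})"
    proof
      fix z assume z: "z \<in> B x (real (Suc n))"
      have D: "(adj \<mu> ^^ d x z) x z" by (rule relpowp_dist)
      show "z \<in> (\<Union>y\<in>B x (real n). insert y {z. adj \<mu> y z})"
      proof (cases "d x z \<le> n")
        case True then show ?thesis by (auto simp: mem_ball)
      next
        case False
        with z have "d x z = Suc n" by (auto simp: mem_ball)
        with D obtain y where "(adj \<mu> ^^ n) x y" "adj \<mu> y z" by auto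
        then show ?thesis using dist_le by (auto simp: mem_ball)
      qed
    qed
    then show ?case using Suc by (auto intro: finite_subset)
  qed
  have "B x r \<subseteq> B x (real (nat \<lceil>r\<rceil>))"
    using order_trans[OF _ real_nat_ceiling_ge[of r]] by (auto simp: mem_ball)
  then show ?thesis using * finite_subset by blast
qed

lemma weight_zero: "\<not> adj \<mu> x y \<Longrightarrow> \<mu> x y = 0"
  using weight_nonneg[of x y] by (auto simp: adj_def)

lemma m_nonneg [simp]: "0 \<le> m x"
  using vertex_measure_pos[of x] by simp

lemma m_neq_0 [simp]: "m x \<noteq> 0"
  using vertex_measure_pos[of x] by simp

section \<open>The Markov operator on real functions, and finite supports\<close>

definition P :: "('a \<Rightarrow> real) \<Rightarrow> 'a \<Rightarrow> real" where
  "P u x = (\<Sum>y | adj \<mu> x y. \<mu> x y * u y) / m x"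

lemma m_times_P: "m x * P u x = (\<Sum>y | adj \<mu> x y. \<mu> x y * u y)"
  by (simp add: P_def)

lemma P_zero [simp]: "P (\<lambda>x. 0) = (\<lambda>x. 0)"
  by (auto simp: P_def)

lemma P_add: "P (\<lambda>x. u x + v x) = (\<lambda>x. P u x + P v x)"
  by (auto simp: P_def distrib_left sum.distrib add_divide_distrib)

lemma P_diff: "P (\<lambda>x. u x - v x) = (\<lambda>x. P u x - P v x)"
  by (auto simp: P_def right_diff_distrib sum_subtractf diff_divide_distrib)

lemma P_scale: "P (\<lambda>x. c * u x) = (\<lambda>x. c * P u x)"
  by (auto simp: P_def sum_distrib_left sum_divide_distrib mult_ac intro!: sum.cong)

lemma P_mono: "(\<And>y. u y \<le> v y) \<Longrightarrow> P u x \<le> P v x"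
  unfolding P_def
  by (intro divide_right_mono sum_mono mult_left_mono) (auto simp: weight_nonneg)

lemma P_nonneg: "(\<And>y. 0 \<le> u y) \<Longrightarrow> 0 \<le> P u x"
  using P_mono[of "\<lambda>x. 0" u x] by simp

lemma P_const: "P (\<lambda>x. c) = (\<lambda>x. c)"
proof
  fix x
  have "(\<Sum>y | adj \<mu> x y. \<mu> x y * c) = m x * c"
    by (simp add: vertex_measure_def sum_distrib_right)
  then show "P (\<lambda>x. c) x = c" by (simp add: P_def)
qed

lemma P_pow_zero [simp]: "(P ^^ n) (\<lambda>x. 0) = (\<lambda>x. 0)"
  by (induction n) auto

lemma P_pow_add: "(P ^^ n) (\<lambda>x. u x + v x) = (\<lambda>x. (P ^^ n) u x + (P ^^ n) v x)"
  by (induction n) (auto simp: P_add)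

lemma P_pow_diff: "(P ^^ n) (\<lambda>x. u x - v x) = (\<lambda>x. (P ^^ n) u x - (P ^^ n) v x)"
  by (induction n) (auto simp: P_diff)

lemma P_pow_scale: "(P ^^ n) (\<lambda>x. c * u x) = (\<lambda>x. c * (P ^^ n) u x)"
  by (induction n) (auto simp: P_scale)

lemma P_pow_sum: "finite A \<Longrightarrow> (P ^^ n) (\<lambda>x. \<Sum>i\<in>A. u i x) = (\<lambda>x. \<Sum>i\<in>A. (P ^^ n) (u i) x)"
  by (induction A rule: finite_induct) (auto simp: P_pow_add)

lemma P_pow_nonneg: "(\<And>y. 0 \<le> u y) \<Longrightarrow> 0 \<le> (P ^^ n) u x"
  by (induction n arbitrary: x) (auto intro: P_nonneg)


text \<open>Jensen's inequality as nonnegativity of a variance: expand the square centred at the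
  mean \<open>P u x\<close>, using that P fixes constants.\<close>

lemma P_square_le: "(P u x)^2 \<le> P (\<lambda>y. (u y)^2) x"
proof -
  let ?c = "P u x"
  have "0 \<le> P (\<lambda>y. (u y - ?c)^2) x" by (rule P_nonneg) simp
  also have "(\<lambda>y. (u y - ?c)^2) = (\<lambda>y. ((u y)^2 + ?c^2) - 2 * ?c * u y)"
    by (auto simp: power2_eq_square algebra_simps)
  also have "P \<dots> x = P (\<lambda>y. (u y)^2) x + ?c^2 - 2 * ?c * ?c"
    by (simp add: P_diff P_add P_scale P_const)
  finally show ?thesis by (simp add: power2_eq_square)
qed

lemma P_pow_square_le: "((P ^^ n) u x)^2 \<le> (P ^^ n) (\<lambda>y. (u y)^2) x"
proof (induction n arbitrary: x)
  case (Suc n)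
  have "((P ^^ Suc n) u x)^2 \<le> P (\<lambda>y. ((P ^^ n) u y)^2) x"
    using P_square_le by simp
  also have "\<dots> \<le> P ((P ^^ n) (\<lambda>y. (u y)^2)) x" by (rule P_mono) (rule Suc)
  finally show ?case by simp
qed simp

lemma P_cong: "(\<And>y. adj \<mu> x y \<Longrightarrow> u y = v y) \<Longrightarrow> P u x = P v x"
  unfolding P_def by (metis (no_types, lifting) mem_Collect_eq sum.cong)

text \<open>Finite propagation speed. It gives the supports of iterates and later allows an
  arbitrary f to be truncated.\<close>

lemma P_pow_local:
  "(\<And>y. d x y \<le> n \<Longrightarrow> u y = v y) \<Longrightarrow> (P ^^ n) u x = (P ^^ n) v x"
proof (induction n arbitrary: x)
  case (Suc n)
  have "P ((P ^^ n) u) x = P ((P ^^ n) v) x"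
  proof (rule P_cong)
    fix y assume "adj \<mu> x y"
    then have "d x z \<le> Suc n" if "d y z \<le> n" for z
      using that dist_triangle[of x z y] dist_adj[of x y] by linarith
    then show "(P ^^ n) u y = (P ^^ n) v y" using Suc.prems by (intro Suc.IH) auto
  qed
  then show ?case by simp
qed auto

lemma P_pow_eq_0: "(\<And>y. d x y \<le> n \<Longrightarrow> u y = 0) \<Longrightarrow> (P ^^ n) u x = 0"
  using P_pow_local[of x n u "\<lambda>y. 0"] by simp

text \<open>\<open>Y\<close> contains the support of \<open>u\<close> together with its neighbours, so that sums over \<open>Y\<close> behave like
  sums over the whole graph.\<close>

definition inside :: "'a set \<Rightarrow> ('a \<Rightarrow> real) \<Rightarrow> bool" where
  "inside Y u \<longleftrightarrow> finite Y \<and> (\<forall>x. u x \<noteq> 0 \<longrightarrow> x \<in> Y) \<and> (\<forall>x y. adj \<mu> x y \<longrightarrow> u y \<noteq> 0 \<longrightarrow> x \<in> Y)"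


lemma inside_diff: "inside Y u \<Longrightarrow> inside Y v \<Longrightarrow> inside Y (\<lambda>x. u x - v x)"
  by (auto simp: inside_def) (metis+)

lemma exists_inside:
  assumes "finite {x. u x \<noteq> 0}" "finite K"
  shows "\<exists>Y. finite Y \<and> K \<subseteq> Y \<and> (\<forall>l\<le>L. inside Y ((P ^^ l) u))"
proof -
  \<comment> \<open>L steps of propagation, plus one because \<open>inside\<close> also asks for the
    neighbours of the support.\<close>
  define Y where "Y = K \<union> (\<Union>s\<in>{x. u x \<noteq> 0}. B s (real (L + 1)))"
  have "finite Y" using assms by (auto simp: Y_def)
  moreover have "x \<in> Y" if l: "l \<le> L" and xy: "d x y \<le> 1" and nz: "(P ^^ l) u y \<noteq> 0" for x y l
  proof -
    obtain s where s: "d y s \<le> l" "u s \<noteq> 0" using nz by (metis P_pow_eq_0)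
    have "d s x \<le> L + 1"
      using dist_triangle[of s x y] dist_sym[of s y] dist_sym[of x y] s l xy by linarith
    then show ?thesis using s by (auto simp: Y_def mem_ball)
  qed
  ultimately have "inside Y ((P ^^ l) u)" if "l \<le> L" for l
    using that dist_adj unfolding inside_def by (metis dist_refl zero_le)
  then show ?thesis using \<open>finite Y\<close> by (intro exI[of _ Y]) (auto simp: Y_def)
qed

text \<open>P sums over neighbours, whereas summation by parts needs one index set for both
  endpoints. Neighbours outside \<open>Y\<close> contribute nothing: there u vanishes at both ends
  of the edge, which is why h has to vanish in that case.\<close>

lemma sum_neighbours:
  assumes "inside Y u" "x \<in> Y" and "\<And>y. u x = 0 \<Longrightarrow> u y = 0 \<Longrightarrow> h y = 0"
  shows "(\<Sum>y | adj \<mu> x y. \<mu> x y * h y) = (\<Sum>y\<in>Y. \<mu> x y * h y)"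
proof (rule sum.mono_neutral_cong)
  show "finite Y" "finite {y. adj \<mu> x y}" using assms by (auto simp: inside_def)
  show "\<mu> x i * h i = 0" if "i \<in> Y - {y. adj \<mu> x y}" for i using that weight_zero by auto
  show "\<mu> x i * h i = 0" if i: "i \<in> {y. adj \<mu> x y} - Y" for i
  proof -
    have "u x = 0" using assms(1) i adj_sym by (auto simp: inside_def)
    moreover have "u i = 0" using assms(1) i by (auto simp: inside_def)
    ultimately show ?thesis using assms(3) by auto
  qed
qed auto

end

section \<open>Energy inequalities for the lazy walk\<close>

lemma power2_sum_le: "(a + b)^2 \<le> 2 * (a^2 + b^2)" for a b :: real
  using sum_squares_bound[of a b] by (simp add: power2_sum)

locale lazy_graph = weighted_graph \<mu> for \<mu> :: "'a \<Rightarrow> 'a \<Rightarrow> real" +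
  fixes \<alpha> :: real
  assumes alpha_pos: "\<alpha> > 0" and Delta: "Delta_cond \<mu> \<alpha>"
begin

lemma adj_refl [simp]: "adj \<mu> x x"
  using Delta unfolding Delta_cond_def by blast

lemma loop_ge: "\<alpha> * m x \<le> \<mu> x x"
  using Delta adj_refl unfolding Delta_cond_def by blast

text \<open>The quantitative form of laziness on which both energy inequalities rest.\<close>

lemma sum_neighbours_remove_loop:
  "(\<Sum>y\<in>{y. adj \<mu> x y} - {x}. \<mu> x y) \<le> (1 - \<alpha>) * m x"
proof -
  have "m x = \<mu> x x + (\<Sum>y\<in>{y. adj \<mu> x y} - {x}. \<mu> x y)"
    unfolding vertex_measure_def by (rule sum.remove) auto
  then show ?thesis using loop_ge[of x] by (simp add: algebra_simps)
qed

lemma alpha_le_1: "\<alpha> \<le> 1"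
proof -
  have "0 \<le> (1 - \<alpha>) * m undefined"
    using sum_neighbours_remove_loop[of undefined]
    by (rule order_trans[rotated]) (auto intro!: sum_nonneg weight_nonneg)
  then show ?thesis using vertex_measure_pos[of undefined] by (auto simp: zero_le_mult_iff)
qed

lemma laplacian_eq: "m x * (u x - P u x) = (\<Sum>y | adj \<mu> x y. \<mu> x y * (u x - u y))"
  unfolding right_diff_distrib sum_subtractf m_times_P
  by (simp add: vertex_measure_def sum_distrib_right)

text \<open>The loop does not contribute to the sum of u x - u y, so Cauchy-Schwarz is applied to
  the other neighbours only, whose total weight is at most (1 - \<alpha>) m x.\<close>

lemma laplacian_square_lazy:
  "m x * (u x - P u x)^2 \<le> (1 - \<alpha>) * (\<Sum>y | adj \<mu> x y. \<mu> x y * (u x - u y)^2)"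
proof -
  let ?N = "{y. adj \<mu> x y} - {x}"
  let ?Q = "\<Sum>y | adj \<mu> x y. \<mu> x y * (u x - u y)^2"
  have "(m x * (u x - P u x))^2 = (\<Sum>y\<in>?N. \<mu> x y * (u x - u y))^2"
    unfolding laplacian_eq by (subst sum.remove[of _ x]) auto
  also have "\<dots> = (\<Sum>y\<in>?N. sqrt (\<mu> x y) * (sqrt (\<mu> x y) * (u x - u y)))^2"
    by (simp add: mult.assoc[symmetric] weight_nonneg)
  also have "\<dots> \<le> (\<Sum>y\<in>?N. (sqrt (\<mu> x y))^2) * (\<Sum>y\<in>?N. (sqrt (\<mu> x y) * (u x - u y))^2)"
    by (rule Cauchy_Schwarz_ineq_sum)
  also have "\<dots> = (\<Sum>y\<in>?N. \<mu> x y) * (\<Sum>y\<in>?N. \<mu> x y * (u x - u y)^2)"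
    by (simp add: power_mult_distrib weight_nonneg)
  also have "\<dots> \<le> ((1 - \<alpha>) * m x) * ?Q"
    by (intro mult_mono sum_neighbours_remove_loop sum_mono2 sum_nonneg mult_nonneg_nonneg)
       (auto simp: weight_nonneg alpha_le_1)
  finally have "m x * (m x * (u x - P u x)^2) \<le> m x * ((1 - \<alpha>) * ?Q)"
    by (simp add: power2_eq_square mult_ac)
  then show ?thesis using vertex_measure_pos[of x] by simp
qed

text \<open>Laziness makes the variance of a function under one step of the walk control its full
  local energy.\<close>

lemma P_square_plus_energy:
  "m x * (P u x)^2 + \<alpha> * (\<Sum>y | adj \<mu> x y. \<mu> x y * (u x - u y)^2)
     \<le> m x * (u x)^2 + (\<Sum>y | adj \<mu> x y. \<mu> x y * ((u y)^2 - (u x)^2))"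
proof -
  let ?Q = "\<Sum>y | adj \<mu> x y. \<mu> x y * (u x - u y)^2"
  have "?Q = (\<Sum>y | adj \<mu> x y. \<mu> x y * ((u y)^2 - (u x)^2) + 2 * u x * (\<mu> x y * (u x - u y)))"
    by (rule sum.cong) (auto simp: power2_eq_square algebra_simps)
  also have "\<dots> = (\<Sum>y | adj \<mu> x y. \<mu> x y * ((u y)^2 - (u x)^2)) + 2 * u x * (m x * (u x - P u x))"
    unfolding laplacian_eq by (simp add: sum.distrib sum_distrib_left)
  finally have Q: "?Q = \<dots>" .
  have "m x * (P u x)^2 = m x * (u x)^2 - 2 * u x * (m x * (u x - P u x)) + m x * (u x - P u x)^2"
    by (simp add: power2_eq_square algebra_simps)
  moreover have "(1 - \<alpha>) * ?Q = ?Q - \<alpha> * ?Q" by (simp add: left_diff_distrib)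
  ultimately show ?thesis using laplacian_square_lazy[of x u] Q by linarith
qed

definition energy :: "'a set \<Rightarrow> ('a \<Rightarrow> real) \<Rightarrow> ('a \<Rightarrow> real) \<Rightarrow> real" where
  "energy Y \<eta> u = (\<Sum>x\<in>Y. \<Sum>y\<in>Y. \<mu> x y * ((\<eta> x)^2 * (u x - u y)^2))"

lemma energy_nonneg: "0 \<le> energy Y \<eta> u"
  unfolding energy_def by (auto intro!: sum_nonneg mult_nonneg_nonneg weight_nonneg)

lemma edge_sum_swap:
  "edge_sum Y h = edge_sum Y (\<lambda>x y. h y x)"
  by (subst sum.swap) (simp add: weight_sym)

lemma edge_sum_add:
  "edge_sum Y (\<lambda>x y. h x y + k x y)
     = edge_sum Y h + edge_sum Y k"
  by (simp add: distrib_left sum.distrib)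

lemma edge_sum_scale:
  "edge_sum Y (\<lambda>x y. c * h x y) = c * edge_sum Y h"
  by (simp add: sum_distrib_left mult_ac)

lemma edge_sum_mono:
  assumes "\<And>x y. x \<in> Y \<Longrightarrow> y \<in> Y \<Longrightarrow> adj \<mu> x y \<Longrightarrow> h x y \<le> k x y"
  shows "edge_sum Y h \<le> edge_sum Y k"
proof (intro sum_mono)
  fix x y assume "x \<in> Y" "y \<in> Y"
  then show "\<mu> x y * h x y \<le> \<mu> x y * k x y"
    using assms[of x y] weight_zero[of x y] weight_nonneg[of x y]
    by (cases "adj \<mu> x y") (auto intro: mult_left_mono)
qed

lemma edge_sum_le_vertex_sum:
  assumes "finite Y" "\<And>x. 0 \<le> h x"
  shows "edge_sum Y (\<lambda>x y. h x) \<le> (\<Sum>x\<in>Y. h x * m x)"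
proof (rule sum_mono)
  fix x
  have "(\<Sum>y\<in>Y. \<mu> x y) = (\<Sum>y\<in>Y \<inter> {y. adj \<mu> x y}. \<mu> x y)"
    by (rule sum.mono_neutral_right) (auto simp: assms weight_zero)
  also have "\<dots> \<le> m x" unfolding vertex_measure_def
    by (rule sum_mono2) (auto simp: weight_nonneg)
  finally have "(\<Sum>y\<in>Y. \<mu> x y) * h x \<le> m x * h x"
    using assms by (intro mult_right_mono)
  then show "(\<Sum>y\<in>Y. \<mu> x y * h x) \<le> h x * m x"
    by (simp only: sum_distrib_right mult.commute[of "m x"])
qed

text \<open>\<open>P_square_plus_energy\<close> tested against \<eta>^2. The flux term
  \<open>?Z\<close> is antisymmetric in the edge apart from the cutoff, so only differences of
  \<eta>^2 survive; half of the energy is spent on absorbing them.\<close>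

lemma caccioppoli:
  assumes Y: "inside Y u"
  shows "(\<Sum>x\<in>Y. (\<eta> x)^2 * (P u x)^2 * m x) + \<alpha> / 2 * energy Y \<eta> u
     \<le> (\<Sum>x\<in>Y. (\<eta> x)^2 * (u x)^2 * m x)
        + 2 / \<alpha> * edge_sum Y (\<lambda>x y. (\<eta> x - \<eta> y)^2 * (u x)^2)"
proof -
  let ?Z = "edge_sum Y (\<lambda>x y. (\<eta> x)^2 * ((u y)^2 - (u x)^2))"
  let ?R = "edge_sum Y (\<lambda>x y. (\<eta> x - \<eta> y)^2 * (u x)^2)"
  have "(\<Sum>x\<in>Y. (\<eta> x)^2 * (P u x)^2 * m x) + \<alpha> * energy Y \<eta> u
     = (\<Sum>x\<in>Y. (\<eta> x)^2 * (m x * (P u x)^2 + \<alpha> * (\<Sum>y\<in>Y. \<mu> x y * (u x - u y)^2)))"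
    unfolding energy_def
    by (simp add: sum.distrib sum_distrib_left distrib_left mult_ac)
  also have "\<dots> \<le> (\<Sum>x\<in>Y. (\<eta> x)^2 * (m x * (u x)^2 + (\<Sum>y\<in>Y. \<mu> x y * ((u y)^2 - (u x)^2))))"
  proof (intro sum_mono mult_left_mono)
    fix x assume x: "x \<in> Y"
    show "m x * (P u x)^2 + \<alpha> * (\<Sum>y\<in>Y. \<mu> x y * (u x - u y)^2)
      \<le> m x * (u x)^2 + (\<Sum>y\<in>Y. \<mu> x y * ((u y)^2 - (u x)^2))"
      using P_square_plus_energy[of x u] by (subst (asm) (1 2) sum_neighbours[OF Y x]) auto
  qed auto
  also have "\<dots> = (\<Sum>x\<in>Y. (\<eta> x)^2 * (u x)^2 * m x) + ?Z"
    by (simp add: sum.distrib sum_distrib_left distrib_left mult_ac)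
  also have "?Z \<le> \<alpha> / 2 * energy Y \<eta> u + 2 / \<alpha> * ?R"
  proof -
    \<comment> \<open>Symmetrised, the flux is minus the product of (a + b) (c - e) and (a - b) (c +
      e). Young's inequality puts the first factor into the energy and the second into the gradient
      error.\<close>
    have pt: "(\<eta> x)^2 * ((u y)^2 - (u x)^2) + (\<eta> y)^2 * ((u x)^2 - (u y)^2)
       \<le> \<alpha> / 2 * ((\<eta> x)^2 * (u x - u y)^2) + \<alpha> / 2 * ((\<eta> y)^2 * (u y - u x)^2)
         + (2 / \<alpha> * ((\<eta> x - \<eta> y)^2 * (u x)^2) + 2 / \<alpha> * ((\<eta> y - \<eta> x)^2 * (u y)^2))" for x y
    proof -
      define a b c e where "a = \<eta> x" "b = \<eta> y" "c = u x" "e = u y"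
      have "0 \<le> (\<alpha> / 2 * ((a + b) * (c - e)) + (a - b) * (c + e))^2 / \<alpha>"
        using alpha_pos by simp
      also have "\<dots> = \<alpha> / 4 * ((a + b)^2 * (c - e)^2) + (a - b)^2 * (c + e)^2 / \<alpha>
           + (a^2 - b^2) * (c^2 - e^2)"
        using alpha_pos by (simp add: field_simps power2_eq_square)
      finally have 0: "0 \<le> \<alpha> / 4 * ((a + b)^2 * (c - e)^2) + (a - b)^2 * (c + e)^2 / \<alpha>
           + (a^2 - b^2) * (c^2 - e^2)" .
      have 1: "\<alpha> / 4 * ((a + b)^2 * (c - e)^2) \<le> \<alpha> / 4 * (2 * (a^2 + b^2) * (c - e)^2)"
        using alpha_pos by (intro mult_left_mono mult_right_mono power2_sum_le) auto
      have 2: "(a - b)^2 * (c + e)^2 / \<alpha> \<le> (a - b)^2 * (2 * (c^2 + e^2)) / \<alpha>"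
        using alpha_pos by (intro divide_right_mono mult_left_mono power2_sum_le) auto
      have "0 \<le> \<alpha> / 4 * (2 * (a^2 + b^2) * (c - e)^2) + (a - b)^2 * (2 * (c^2 + e^2)) / \<alpha>
           + (a^2 - b^2) * (c^2 - e^2)"
        using 0 1 2 by linarith
      then show ?thesis unfolding a_b_c_e_def[symmetric]
        by (simp add: algebra_simps power2_commute[of b a] power2_commute[of e c] add_divide_distrib)
    qed
    have "2 * ?Z = (\<Sum>x\<in>Y. \<Sum>y\<in>Y. \<mu> x y *
        ((\<eta> x)^2 * ((u y)^2 - (u x)^2) + (\<eta> y)^2 * ((u x)^2 - (u y)^2)))"
      unfolding edge_sum_add by (subst (3) edge_sum_swap) simp
    also have "\<dots> \<le> (\<Sum>x\<in>Y. \<Sum>y\<in>Y. \<mu> x y *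
       (\<alpha> / 2 * ((\<eta> x)^2 * (u x - u y)^2) + \<alpha> / 2 * ((\<eta> y)^2 * (u y - u x)^2)
         + (2 / \<alpha> * ((\<eta> x - \<eta> y)^2 * (u x)^2) + 2 / \<alpha> * ((\<eta> y - \<eta> x)^2 * (u y)^2))))"
      by (rule edge_sum_mono) (rule pt)
    also have "\<dots> = \<alpha> / 2 * energy Y \<eta> u + \<alpha> / 2 * energy Y \<eta> u + (2 / \<alpha> * ?R + 2 / \<alpha> * ?R)"
      unfolding edge_sum_add edge_sum_scale energy_def
      using edge_sum_swap[of "\<lambda>x y. (\<eta> x)^2 * (u x - u y)^2" Y]
        edge_sum_swap[of "\<lambda>x y. (\<eta> x - \<eta> y)^2 * (u x)^2" Y] by simp
    finally show ?thesis by simp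
  qed
  finally show ?thesis by (simp add: algebra_simps)
qed

end

context lazy_graph
begin

lemma P_square_le_energy:
  assumes Y: "inside Y u" "x \<in> Y"
  shows "m x * (u x - P u x)^2 \<le> (\<Sum>y\<in>Y. \<mu> x y * (u x - u y)^2)"
proof -
  have "0 \<le> \<alpha> * (\<Sum>y | adj \<mu> x y. \<mu> x y * (u x - u y)^2)"
    using alpha_pos by (intro mult_nonneg_nonneg sum_nonneg) (auto simp: weight_nonneg)
  then have "m x * (u x - P u x)^2 \<le> (\<Sum>y | adj \<mu> x y. \<mu> x y * (u x - u y)^2)"
    using laplacian_square_lazy[of x u] by (simp add: left_diff_distrib)
  then show ?thesis by (subst (asm) sum_neighbours[OF Y]) auto
qed

text \<open>Laziness enters through the bound \<open>(1 - \<alpha>) (4 + 2 \<alpha>) \<le> 4 - 2 \<alpha>\<close> for the energy of the Laplacian itself.\<close>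

lemma energy_step:
  assumes Y: "inside Y u" "inside Y (P u)"
  defines "v \<equiv> \<lambda>x. u x - P u x"
  shows "energy Y \<eta> (P u) + \<alpha> * (\<Sum>x\<in>Y. (\<eta> x)^2 * (v x)^2 * m x)
     \<le> energy Y \<eta> u
        + (4 / \<alpha> + 3) * edge_sum Y (\<lambda>x y. (\<eta> x - \<eta> y)^2 * ((u x - u y)^2 + (v x)^2))"
proof -
  let ?S = "\<Sum>x\<in>Y. (\<eta> x)^2 * (v x)^2 * m x"
  let ?R = "edge_sum Y (\<lambda>x y. (\<eta> x - \<eta> y)^2 * ((u x - u y)^2 + (v x)^2))"
  let ?R1 = "edge_sum Y (\<lambda>x y. (\<eta> x - \<eta> y)^2 * (u x - u y)^2)"
  let ?R2 = "edge_sum Y (\<lambda>x y. (\<eta> x - \<eta> y)^2 * (v x)^2)"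
  let ?X = "edge_sum Y (\<lambda>x y. ((\<eta> y)^2 - (\<eta> x)^2) * (u x - u y) * v x)"
  let ?M = "edge_sum Y (\<lambda>x y. (\<eta> x)^2 * ((u x - u y) * (v x - v y)))"
  have Yv: "inside Y v" unfolding v_def by (rule inside_diff[OF Y])
  have fin: "finite Y" using Y by (simp add: inside_def)
  have Pu: "P u = (\<lambda>x. u x - v x)" by (simp add: v_def)
  have R: "?R = ?R1 + ?R2" by (simp add: distrib_left sum.distrib)
  have R2: "0 \<le> ?R1" "0 \<le> ?R2" by (auto intro!: sum_nonneg simp: weight_nonneg)
  have lap: "(\<Sum>y\<in>Y. \<mu> x y * (u x - u y)) = m x * v x" if "x \<in> Y" for x
    unfolding v_def laplacian_eq by (rule sum_neighbours[OF Y(1) that, symmetric]) auto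
  have expand: "energy Y \<eta> (P u) = energy Y \<eta> u - 2 * ?M + energy Y \<eta> v"
  proof -
    have "energy Y \<eta> (P u) = edge_sum Y (\<lambda>x y. (\<eta> x)^2 * (u x - u y)^2
      + ((-2) * ((\<eta> x)^2 * ((u x - u y) * (v x - v y))) + (\<eta> x)^2 * (v x - v y)^2))"
      unfolding energy_def Pu
      by (intro sum.cong refl arg_cong2[where f="(*)"]) (simp add: power2_eq_square algebra_simps)
    then show ?thesis unfolding edge_sum_add edge_sum_scale energy_def by simp
  qed
  \<comment> \<open>Summation by parts: for constant \<eta> the mixed term is exactly 2
    \<open>?S\<close>, and \<open>?X\<close> is the commutator with the cutoff.\<close>
  have M: "?M = 2 * ?S + ?X"
  proof -
    have "?M = edge_sum Y (\<lambda>x y. (\<eta> x)^2 * ((u x - u y) * v x)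
        + (\<eta> x)^2 * ((u y - u x) * v y))"
      by (intro sum.cong refl arg_cong2[where f="(*)"]) (simp add: algebra_simps)
    also have "\<dots> = edge_sum Y (\<lambda>x y. (\<eta> x)^2 * ((u x - u y) * v x))
        + edge_sum Y (\<lambda>x y. (\<eta> y)^2 * ((u x - u y) * v x))"
      unfolding edge_sum_add
      using edge_sum_swap[of "\<lambda>x y. (\<eta> x)^2 * ((u y - u x) * v y)" Y] by simp
    also have "\<dots> = edge_sum Y (\<lambda>x y. 2 * ((\<eta> x)^2 * ((u x - u y) * v x))
        + ((\<eta> y)^2 - (\<eta> x)^2) * (u x - u y) * v x)"
      unfolding edge_sum_add[symmetric]
      by (intro sum.cong refl arg_cong2[where f="(*)"]) (simp add: algebra_simps)
    also have "\<dots> = 2 * (\<Sum>x\<in>Y. (\<eta> x)^2 * v x * (\<Sum>y\<in>Y. \<mu> x y * (u x - u y))) + ?X"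
      unfolding edge_sum_add edge_sum_scale by (simp add: sum_distrib_left mult_ac)
    also have "(\<Sum>x\<in>Y. (\<eta> x)^2 * v x * (\<Sum>y\<in>Y. \<mu> x y * (u x - u y))) = ?S"
      by (intro sum.cong refl) (simp add: lap power2_eq_square)
    finally show ?thesis .
  qed
  \<comment> \<open>The budget: the mixed term gives -4 \<open>?S\<close> and the energy of v costs
    at most (4 - 2 \<alpha>) \<open>?S\<close>. Of the surplus 2 \<alpha> \<open>?S\<close>, one
    half pays for the commutator and the other is the gain claimed.\<close>
  have X: "- 2 * ?X \<le> \<alpha> * ?S + (4 / \<alpha> + 1) * ?R1 + ?R2"
  proof -
    have "- 2 * ?X = edge_sum Y (\<lambda>x y. (-2) * (((\<eta> y)^2 - (\<eta> x)^2) * (u x - u y) * v x))"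
      unfolding edge_sum_scale by simp
    also have "\<dots> \<le> edge_sum Y (\<lambda>x y. \<alpha> * ((\<eta> x)^2 * (v x)^2) +
        ((4 / \<alpha> + 1) * ((\<eta> x - \<eta> y)^2 * (u x - u y)^2) + (\<eta> x - \<eta> y)^2 * (v x)^2))"
    proof (rule edge_sum_mono)
      fix x y
      define a D g w where "a = \<eta> x" "D = \<eta> y - \<eta> x" "g = u x - u y" "w = v x"
      have b: "\<eta> y = a + D" by (simp add: a_D_g_w_def)
      have e: "(\<alpha> * (a * w) + 2 * (D * g))^2 / \<alpha> = \<alpha> * (a^2 * w^2) + 4 / \<alpha> * (D^2 * g^2) + 4 * a * w * D * g"
        using alpha_pos by (simp add: field_simps power2_eq_square)
      have "0 \<le> (\<alpha> * (a * w) + 2 * (D * g))^2 / \<alpha>" using alpha_pos by simp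
      moreover have "0 \<le> D^2 * (g + w)^2" by simp
      ultimately have "(-2) * (((a + D)^2 - a^2) * g * w)
          \<le> \<alpha> * (a^2 * w^2) + ((4 / \<alpha> + 1) * (D^2 * g^2) + D^2 * w^2)"
        unfolding e by (simp add: power2_eq_square algebra_simps)
      then show "- 2 * (((\<eta> y)^2 - (\<eta> x)^2) * (u x - u y) * v x) \<le> \<alpha> * ((\<eta> x)^2 * (v x)^2) +
        ((4 / \<alpha> + 1) * ((\<eta> x - \<eta> y)^2 * (u x - u y)^2) + (\<eta> x - \<eta> y)^2 * (v x)^2)"
        unfolding b power2_commute[of "\<eta> x" "a + D"] unfolding a_D_g_w_def by (simp add: mult.assoc)
    qed
    also have "\<dots> = \<alpha> * edge_sum Y (\<lambda>x y. (\<eta> x)^2 * (v x)^2) + ((4 / \<alpha> + 1) * ?R1 + ?R2)"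
      unfolding edge_sum_add edge_sum_scale by simp
    also have "edge_sum Y (\<lambda>x y. (\<eta> x)^2 * (v x)^2) \<le> ?S"
      by (rule edge_sum_le_vertex_sum) (auto simp: fin)
    finally show ?thesis using alpha_pos by simp
  qed
  \<comment> \<open>Diagonal pairs carry no energy, so splitting (v x - v y)^2 is charged only to
    the non-loop weight 1 - \<alpha>.\<close>
  have E: "energy Y \<eta> v \<le> (4 - 2 * \<alpha>) * ?S + (2 + 2 / \<alpha>) * ?R2"
  proof -
    let ?\<nu> = "\<lambda>x y. if x = y then 0 else \<mu> x y"
    let ?F = "\<lambda>x y. \<mu> x y * (if x = y then 0 else (\<eta> x)^2 * (v x)^2)"
    have "energy Y \<eta> v \<le> edge_sum Y (\<lambda>x y. 2 * (if x = y then 0 else (\<eta> x)^2 * (v x)^2)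
        + 2 * (if x = y then 0 else (\<eta> x)^2 * (v y)^2))"
      unfolding energy_def
    proof (rule edge_sum_mono)
      fix x y
      have "(v x - v y)^2 \<le> 2 * ((v x)^2 + (v y)^2)"
        using power2_sum_le[of "v x" "- v y"] by simp
      from mult_left_mono[OF this, of "(\<eta> x)^2"]
      show "(\<eta> x)^2 * (v x - v y)^2 \<le> 2 * (if x = y then 0 else (\<eta> x)^2 * (v x)^2)
        + 2 * (if x = y then 0 else (\<eta> x)^2 * (v y)^2)" by (auto simp: algebra_simps)
    qed
    also have "\<dots> = 2 * (\<Sum>x\<in>Y. \<Sum>y\<in>Y. ?F x y)
        + 2 * edge_sum Y (\<lambda>x y. if x = y then 0 else (\<eta> y)^2 * (v x)^2)"
      unfolding edge_sum_add edge_sum_scale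
      using edge_sum_swap[of "\<lambda>x y. if x = y then 0 else (\<eta> x)^2 * (v y)^2" Y]
      by (simp cong: if_cong add: eq_commute)
    \<comment> \<open>The cutoff is moved from y to x at the price of a factor 1 + \<alpha>, small
      enough for (4 + 2 \<alpha>) (1 - \<alpha>) to stay below 4 - 2 \<alpha>.\<close>
    also have "edge_sum Y (\<lambda>x y. if x = y then 0 else (\<eta> y)^2 * (v x)^2)
       \<le> edge_sum Y (\<lambda>x y. (1 + \<alpha>) * (if x = y then 0 else (\<eta> x)^2 * (v x)^2)
          + (1 + 1 / \<alpha>) * ((\<eta> x - \<eta> y)^2 * (v x)^2))"
    proof (rule edge_sum_mono)
      fix x y
      define a D where "a = \<eta> x" "D = \<eta> y - \<eta> x"
      have b: "\<eta> y = a + D" by (simp add: a_D_def)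
      have "0 \<le> (\<alpha> * a - D)^2 / \<alpha>" using alpha_pos by simp
      also have "\<dots> = \<alpha> * a^2 + D^2 / \<alpha> - 2 * a * D"
        using alpha_pos by (simp add: field_simps power2_eq_square)
      finally have "(a + D)^2 \<le> (1 + \<alpha>) * a^2 + (1 + 1 / \<alpha>) * D^2"
        by (simp add: power2_eq_square algebra_simps)
      from mult_right_mono[OF this, of "(v x)^2"]
      have "(\<eta> y)^2 * (v x)^2 \<le> (1 + \<alpha>) * ((\<eta> x)^2 * (v x)^2) + (1 + 1 / \<alpha>) * ((\<eta> x - \<eta> y)^2 * (v x)^2)"
        unfolding b power2_commute[of "\<eta> x" "a + D"] unfolding a_D_def by (simp add: algebra_simps)
      then show "(if x = y then 0 else (\<eta> y)^2 * (v x)^2)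
        \<le> (1 + \<alpha>) * (if x = y then 0 else (\<eta> x)^2 * (v x)^2)
          + (1 + 1 / \<alpha>) * ((\<eta> x - \<eta> y)^2 * (v x)^2)" by auto
    qed
    also have "\<dots> = (1 + \<alpha>) * (\<Sum>x\<in>Y. \<Sum>y\<in>Y. ?F x y) + (1 + 1 / \<alpha>) * ?R2"
      unfolding edge_sum_add edge_sum_scale by simp
    finally have "energy Y \<eta> v \<le> (4 + 2 * \<alpha>) * (\<Sum>x\<in>Y. \<Sum>y\<in>Y. ?F x y) + (2 + 2 / \<alpha>) * ?R2"
      by (simp add: algebra_simps)
    also have "(\<Sum>x\<in>Y. \<Sum>y\<in>Y. ?F x y) \<le> (1 - \<alpha>) * ?S"
      unfolding sum_distrib_left
    proof (rule sum_mono)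
      fix x assume "x \<in> Y"
      have "(\<Sum>y\<in>Y. ?F x y) = (\<Sum>y\<in>Y - {x}. \<mu> x y) * ((\<eta> x)^2 * (v x)^2)"
        unfolding sum_distrib_right
        by (rule sum.mono_neutral_cong_right) (auto simp: fin)
      also have "(\<Sum>y\<in>Y - {x}. \<mu> x y) = (\<Sum>y\<in>(Y - {x}) \<inter> {y. adj \<mu> x y}. \<mu> x y)"
        by (rule sum.mono_neutral_right) (use fin weight_zero in auto)
      also have "\<dots> \<le> (\<Sum>y\<in>{y. adj \<mu> x y} - {x}. \<mu> x y)"
        by (rule sum_mono2) (auto simp: weight_nonneg)
      also have "\<dots> \<le> (1 - \<alpha>) * m x" by (rule sum_neighbours_remove_loop)
      finally show "(\<Sum>y\<in>Y. ?F x y) \<le> (1 - \<alpha>) * ((\<eta> x)^2 * (v x)^2 * m x)"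
        by (simp add: mult_right_mono mult_ac)
    qed
    finally have "energy Y \<eta> v \<le> (4 + 2 * \<alpha>) * ((1 - \<alpha>) * ?S) + (2 + 2 / \<alpha>) * ?R2"
      using alpha_pos by (simp add: mult_left_mono)
    moreover have "(4 + 2 * \<alpha>) * ((1 - \<alpha>) * ?S) \<le> (4 - 2 * \<alpha>) * ?S"
    proof -
      have "0 \<le> 2 * \<alpha> * \<alpha> * ?S" using alpha_pos by (auto intro!: mult_nonneg_nonneg sum_nonneg)
      then show ?thesis by (simp add: algebra_simps)
    qed
    ultimately show ?thesis by linarith
  qed
  have c: "(4 / \<alpha> + 3) * ?R \<ge> (4 / \<alpha> + 1) * ?R1 + ?R2 + (2 + 2 / \<alpha>) * ?R2"
  proof -
    have "(4 / \<alpha> + 3) * ?R - ((4 / \<alpha> + 1) * ?R1 + ?R2 + (2 + 2 / \<alpha>) * ?R2) = 2 * ?R1 + 2 / \<alpha> * ?R2"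
      unfolding R by (simp add: algebra_simps)
    moreover have "0 \<le> 2 * ?R1 + 2 / \<alpha> * ?R2" using R2 alpha_pos by simp
    ultimately show ?thesis by linarith
  qed
  have "(4 - 2 * \<alpha>) * ?S = 4 * ?S - 2 * (\<alpha> * ?S)" by (simp add: algebra_simps)
  then show ?thesis using expand M X E c by linarith
qed

end

section \<open>The localised square function for general cutoffs\<close>

context lazy_graph
begin

definition energy_const :: real where "energy_const = 4 / \<alpha> + 3"

text \<open>Read off from \<open>localized_square_function\<close>: 6 + 48
  \<open>energy_const\<close> multiplies the total energy, which Caccioppoli bounds with the factor
  2 / \<alpha> (512 / \<alpha> + 1); 4096 is 16 times the bound 256 on the error terms; the division
  by \<alpha> undoes the factor of the square function in
  \<open>weighted_energy_step\<close>.\<close>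

definition local_const :: real where
  "local_const =
     ((6 + 48 * energy_const) * (2 / \<alpha> * (512 / \<alpha> + 1)) + 4096 * energy_const) / \<alpha>"

lemma energy_const_pos: "energy_const > 0"
  using alpha_pos by (simp add: energy_const_def add_pos_pos)

lemma local_const_pos: "local_const > 0"
  unfolding local_const_def using alpha_pos energy_const_pos
  by (intro divide_pos_pos add_pos_pos mult_pos_pos) auto

text \<open>Both u and P u occur because the increment u - P u is estimated by its two parts
  wherever the cutoff varies.\<close>

definition error_term :: "'a set \<Rightarrow> ('a \<Rightarrow> real) \<Rightarrow> ('a \<Rightarrow> real) \<Rightarrow> real" where
  "error_term Y \<eta> u = edge_sum Y (\<lambda>x y. (\<eta> x - \<eta> y)^2 * ((u x)^2 + (P u x)^2))"

text \<open>The energy inequality is run with the cutoff \<open>\<eta>\<^sup>2\<close>: its gradient is at most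
  \<open>2 \<eta>\<close> times that of \<open>\<eta>\<close>, so the errors are controlled by the energy with cutoff \<open>\<eta>\<close>, hence by the Caccioppoli inequality.\<close>

lemma weighted_energy_step:
  fixes \<eta> \<eta>' :: "'a \<Rightarrow> real" and n :: real
  assumes Y: "inside Y u" "inside Y (P u)" and n: "n > 0"
    and range: "\<And>x. 0 \<le> \<eta> x" "\<And>x. 0 \<le> \<eta>' x" "\<And>x. \<eta>' x \<le> 1"
    and edge: "\<And>x y. adj \<mu> x y \<Longrightarrow> n * (\<eta> x - \<eta> y)^2 \<le> 4"
    and time: "\<And>x. n * (\<eta>' x - \<eta> x) \<le> 1"
  shows "(n + 1) * energy Y (\<lambda>x. (\<eta>' x)^2) (P u) + \<alpha> * (n * (\<Sum>x\<in>Y. (\<eta> x)^4 * (u x - P u x)^2 * m x))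
    \<le> n * energy Y (\<lambda>x. (\<eta> x)^2) u + energy_const * (48 * energy Y \<eta> u + 16 * error_term Y \<eta> u)
       + 5 * energy Y \<eta>' (P u)"
proof -
  define v where "v = (\<lambda>x. u x - P u x)"
  have fin: "finite Y" using Y by (simp add: inside_def)
  let ?\<theta> = "\<lambda>x. (\<eta> x)^2" and ?\<theta>' = "\<lambda>x. (\<eta>' x)^2"
  let ?S = "\<Sum>x\<in>Y. (\<eta> x)^4 * (v x)^2 * m x"
  let ?R = "edge_sum Y (\<lambda>x y. (?\<theta> x - ?\<theta> y)^2 * ((u x - u y)^2 + (v x)^2))"
  have step: "energy Y ?\<theta> (P u) + \<alpha> * ?S \<le> energy Y ?\<theta> u + energy_const * ?R"
    using energy_step[OF Y, of ?\<theta>] by (simp add: energy_const_def v_def)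
  have R: "n * ?R \<le> 48 * energy Y \<eta> u + 16 * error_term Y \<eta> u"
  proof -
    have "n * ?R = edge_sum Y (\<lambda>x y. n * ((?\<theta> x - ?\<theta> y)^2 * ((u x - u y)^2 + (v x)^2)))"
      by (simp only: edge_sum_scale)
    also have "\<dots> \<le> edge_sum Y (\<lambda>x y. 8 * ((\<eta> x)^2 * (u x - u y)^2) + 8 * ((\<eta> y)^2 * (u y - u x)^2)
       + (32 * ((\<eta> x)^2 * (v x)^2) + 16 * ((\<eta> x - \<eta> y)^2 * ((u x)^2 + (P u x)^2))))"
    proof (rule edge_sum_mono)
      fix x y assume "adj \<mu> x y"
      note D = edge[OF this]
      let ?D = "(\<eta> x - \<eta> y)^2" and ?a = "\<eta> x + \<eta> y"
      have th: "(?\<theta> x - ?\<theta> y)^2 = ?D * ?a^2"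
        by (simp add: power2_eq_square algebra_simps)
      have a1: "?a^2 \<le> 2 * ((\<eta> x)^2 + (\<eta> y)^2)" by (rule power2_sum_le)
      \<comment> \<open>Anchored at x: this term carries the increment at x, which is controlled by
        the energy with cutoff \<eta> x, so the remainder has to fall on the gradient of
        \<eta>.\<close>
      have a2: "?a^2 \<le> 8 * (\<eta> x)^2 + 2 * ?D"
        using power2_sum_le[of "2 * \<eta> x" "\<eta> y - \<eta> x"]
        by (simp add: power_mult_distrib power2_commute[of "\<eta> y"])
      have "n * ((?\<theta> x - ?\<theta> y)^2 * (u x - u y)^2) = (n * ?D) * (?a^2 * (u x - u y)^2)"
        by (simp add: th)
      also have "\<dots> \<le> 4 * (2 * ((\<eta> x)^2 + (\<eta> y)^2) * (u x - u y)^2)"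
        using D a1 by (intro mult_mono mult_right_mono) auto
      finally have 1: "n * ((?\<theta> x - ?\<theta> y)^2 * (u x - u y)^2)
         \<le> 8 * ((\<eta> x)^2 * (u x - u y)^2) + 8 * ((\<eta> y)^2 * (u y - u x)^2)"
        by (simp add: algebra_simps power2_commute[of "u y"])
      have "n * ((?\<theta> x - ?\<theta> y)^2 * (v x)^2) = (n * ?D) * (?a^2 * (v x)^2)"
        by (simp add: th)
      also have "\<dots> \<le> 4 * ((8 * (\<eta> x)^2 + 2 * ?D) * (v x)^2)"
        using D a2 by (intro mult_mono mult_right_mono) auto
      also have "\<dots> = 32 * ((\<eta> x)^2 * (v x)^2) + 8 * (?D * (v x)^2)" by (simp add: algebra_simps)
      also have "?D * (v x)^2 \<le> ?D * (2 * ((u x)^2 + (P u x)^2))"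
        using power2_sum_le[of "u x" "- P u x"] by (intro mult_left_mono) (auto simp: v_def)
      finally have 2: "n * ((?\<theta> x - ?\<theta> y)^2 * (v x)^2)
         \<le> 32 * ((\<eta> x)^2 * (v x)^2) + 16 * (?D * ((u x)^2 + (P u x)^2))" by (simp add: algebra_simps)
      show "n * ((?\<theta> x - ?\<theta> y)^2 * ((u x - u y)^2 + (v x)^2))
         \<le> 8 * ((\<eta> x)^2 * (u x - u y)^2) + 8 * ((\<eta> y)^2 * (u y - u x)^2)
       + (32 * ((\<eta> x)^2 * (v x)^2) + 16 * (?D * ((u x)^2 + (P u x)^2)))"
        using 1 2 by (simp only: distrib_left)
    qed
    also have "\<dots> = 16 * energy Y \<eta> u + (32 * edge_sum Y (\<lambda>x y. (\<eta> x)^2 * (v x)^2)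
        + 16 * error_term Y \<eta> u)"
      unfolding edge_sum_add edge_sum_scale error_term_def energy_def
      using edge_sum_swap[of "\<lambda>x y. (\<eta> x)^2 * (u x - u y)^2" Y] by simp
    also have "edge_sum Y (\<lambda>x y. (\<eta> x)^2 * (v x)^2) \<le> (\<Sum>x\<in>Y. (\<eta> x)^2 * (v x)^2 * m x)"
      by (rule edge_sum_le_vertex_sum) (auto simp: fin)
    also have "\<dots> \<le> energy Y \<eta> u"
      unfolding energy_def
    proof (rule sum_mono)
      fix x assume "x \<in> Y"
      from mult_left_mono[OF P_square_le_energy[OF Y(1) this], of "(\<eta> x)^2"]
      show "(\<eta> x)^2 * (v x)^2 * m x \<le> (\<Sum>y\<in>Y. \<mu> x y * ((\<eta> x)^2 * (u x - u y)^2))"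
        by (simp add: v_def sum_distrib_left mult_ac)
    qed
    finally show ?thesis by simp
  qed
  \<comment> \<open>Passing from weight n and cutoff \<eta> to n + 1 and \<eta>' costs at most 5
    \<eta>'^2: one from the extra unit of weight, four from the growth of the cutoff, whose rate
    \<open>time\<close> limits to 1 / n.\<close>
  have T: "(n + 1) * energy Y ?\<theta>' (P u) \<le> n * energy Y ?\<theta> (P u) + 5 * energy Y \<eta>' (P u)"
    unfolding energy_def edge_sum_scale[symmetric] edge_sum_add[symmetric]
  proof (rule edge_sum_mono)
    fix x y
    define a b where "a = \<eta> x" "b = \<eta>' x"
    have ab: "0 \<le> a" "0 \<le> b" "b \<le> 1" "n * (b - a) \<le> 1" using range time by (auto simp: a_b_def)
    have b4: "b^4 \<le> b^2" using ab by (intro power_decreasing) auto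
    have "n * (b^4 - a^4) \<le> 4 * b^2"
    proof (cases "b \<le> a")
      case True
      then have "b^4 \<le> a^4" using ab by (intro power_mono) auto
      then have "n * (b^4 - a^4) \<le> 0" using n by (simp add: mult_nonneg_nonpos)
      then show ?thesis using zero_le_power2[of b] by linarith
    next
      case False
      have "n * (b^4 - a^4) = (n * (b - a)) * ((b + a) * (b^2 + a^2))"
        by (simp add: power2_eq_square power4_eq_xxxx algebra_simps)
      also have "\<dots> \<le> 1 * ((b + b) * (b^2 + b^2))"
        using ab False by (intro mult_mono add_mono power_mono) auto
      also have "\<dots> \<le> 4 * b^2" using ab mult_right_mono[of b 1 "4 * b^2"] by (simp add: algebra_simps)
      finally show ?thesis .
    qed
    with b4 have "(n + 1) * b^4 \<le> n * a^4 + 5 * b^2" by (simp add: algebra_simps)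
    from mult_right_mono[OF this, of "(P u x - P u y)^2"]
    show "(n + 1) * (((\<eta>' x)^2)^2 * (P u x - P u y)^2)
      \<le> n * (((\<eta> x)^2)^2 * (P u x - P u y)^2) + 5 * ((\<eta>' x)^2 * (P u x - P u y)^2)"
      by (simp add: a_b_def algebra_simps)
  qed
  have "n * energy Y ?\<theta> (P u) + \<alpha> * (n * ?S) = n * (energy Y ?\<theta> (P u) + \<alpha> * ?S)"
    by (simp add: algebra_simps)
  also have "\<dots> \<le> n * (energy Y ?\<theta> u + energy_const * ?R)" using step n by (intro mult_left_mono) auto
  also have "\<dots> = n * energy Y ?\<theta> u + energy_const * (n * ?R)" by (simp add: algebra_simps)
  also have "\<dots> \<le> n * energy Y ?\<theta> u + energy_const * (48 * energy Y \<eta> u + 16 * error_term Y \<eta> u)"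
    using R energy_const_pos by simp
  finally show ?thesis using T unfolding v_def by linarith
qed

text \<open>Two telescoping sums: Caccioppoli bounds the total energy, then the decrease of the
  energy weighted by l + 1 pays for the square function. \<open>Q\<close> has to dominate u^2 only
  where \<eta> varies. At each edge or vertex the variation over all times is bounded
  (\<open>edge_sum\<close>, \<open>time_sum\<close>), so \<open>Q\<close> is charged a bounded
  number of times.\<close>

lemma localized_square_function:
  fixes \<eta> :: "nat \<Rightarrow> 'a \<Rightarrow> real" and Q f :: "'a \<Rightarrow> real"
  defines "u \<equiv> \<lambda>l. (P ^^ l) f"
  assumes Y: "\<And>l. l \<le> Suc L \<Longrightarrow> inside Y (u l)"
    and range: "\<And>l x. 0 \<le> \<eta> l x" "\<And>l x. \<eta> l x \<le> 1"
    and edge: "\<And>l x y. adj \<mu> x y \<Longrightarrow> real (Suc l) * (\<eta> l x - \<eta> l y)^2 \<le> 4"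
    and time: "\<And>l x. real (Suc l) * (\<eta> (Suc l) x - \<eta> l x) \<le> 1"
    and edge_sum: "\<And>x y. adj \<mu> x y \<Longrightarrow> (\<Sum>l\<le>L. (\<eta> l x - \<eta> l y)^2) \<le> 64"
    and time_sum: "\<And>x. (\<Sum>l\<le>L. \<bar>(\<eta> (Suc l) x)^2 - (\<eta> l x)^2\<bar>) \<le> 1"
    and Q: "\<And>x. 0 \<le> Q x"
    and edge_Q: "\<And>l x y. l \<le> L \<Longrightarrow> adj \<mu> x y \<Longrightarrow> \<eta> l x \<noteq> \<eta> l y \<Longrightarrow>
        (u l x)^2 \<le> Q x + Q y \<and> (u (Suc l) x)^2 \<le> Q x + Q y"
    and time_Q: "\<And>l x. l \<le> L \<Longrightarrow> \<eta> (Suc l) x \<noteq> \<eta> l x \<Longrightarrow> (u (Suc l) x)^2 \<le> Q x"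
  shows "(\<Sum>l<L. real (Suc l) * (\<Sum>x\<in>Y. (\<eta> l x)^4 * (u l x - u (Suc l) x)^2 * m x))
    \<le> local_const * ((\<Sum>x\<in>Y. (\<eta> 0 x)^2 * (f x)^2 * m x) + (\<Sum>x\<in>Y. Q x * m x))"
proof -
  let ?E = "\<lambda>l. energy Y (\<eta> l) (u l)" and ?R = "\<lambda>l. error_term Y (\<eta> l) (u l)"
  let ?S = "\<lambda>l. real (Suc l) * (\<Sum>x\<in>Y. (\<eta> l x)^4 * (u l x - u (Suc l) x)^2 * m x)"
  let ?Ini = "\<Sum>x\<in>Y. (\<eta> 0 x)^2 * (f x)^2 * m x" and ?Q = "\<Sum>x\<in>Y. Q x * m x"
  let ?K = energy_const
  have Pu: "P (u l) = u (Suc l)" for l by (simp add: u_def)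
  have fin: "finite Y" using Y[of 0] by (simp add: inside_def)
  have Q0: "0 \<le> ?Q" using Q by (intro sum_nonneg mult_nonneg_nonneg) auto
  have S0: "0 \<le> ?Ini" by (intro sum_nonneg mult_nonneg_nonneg) auto
  have R0: "0 \<le> ?R l" for l unfolding error_term_def by (auto intro!: sum_nonneg simp: weight_nonneg)
  \<comment> \<open>64 from \<open>edge_sum\<close>, a factor 2 for u and P u, and another 2 for the
    two endpoints.\<close>
  have R_sum: "(\<Sum>l\<le>L. ?R l) \<le> 256 * ?Q"
  proof -
    have "(\<Sum>l\<le>L. ?R l) \<le> (\<Sum>l\<le>L. edge_sum Y (\<lambda>x y. (\<eta> l x - \<eta> l y)^2 * (2 * (Q x + Q y))))"
      unfolding error_term_def Pu
    proof (rule sum_mono, rule edge_sum_mono)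
      fix l x y assume "l \<in> {..L}" "adj \<mu> x y"
      then show "(\<eta> l x - \<eta> l y)^2 * ((u l x)^2 + (u (Suc l) x)^2) \<le> (\<eta> l x - \<eta> l y)^2 * (2 * (Q x + Q y))"
        using edge_Q[of l x y] by (cases "\<eta> l x = \<eta> l y") (auto intro!: mult_left_mono)
    qed
    also have "\<dots> = (\<Sum>x\<in>Y. \<Sum>l\<le>L. \<Sum>y\<in>Y. \<mu> x y * ((\<eta> l x - \<eta> l y)^2 * (2 * (Q x + Q y))))"
      by (rule sum.swap)
    also have "\<dots> = (\<Sum>x\<in>Y. \<Sum>y\<in>Y. \<Sum>l\<le>L. \<mu> x y * ((\<eta> l x - \<eta> l y)^2 * (2 * (Q x + Q y))))"
      by (rule sum.cong[OF refl], rule sum.swap)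
    also have "\<dots> = edge_sum Y (\<lambda>x y. (\<Sum>l\<le>L. (\<eta> l x - \<eta> l y)^2) * (2 * (Q x + Q y)))"
      by (simp only: sum_distrib_left sum_distrib_right)
    also have "\<dots> \<le> edge_sum Y (\<lambda>x y. 128 * Q x + 128 * Q y)"
    proof (rule edge_sum_mono)
      fix x y assume "adj \<mu> x y"
      from mult_right_mono[OF edge_sum[OF this], of "2 * (Q x + Q y)"]
      show "(\<Sum>l\<le>L. (\<eta> l x - \<eta> l y)^2) * (2 * (Q x + Q y)) \<le> 128 * Q x + 128 * Q y"
        using Q[of x] Q[of y] by simp
    qed
    also have "\<dots> = 256 * edge_sum Y (\<lambda>x y. Q x)"
      unfolding edge_sum_add edge_sum_scale using edge_sum_swap[of "\<lambda>x y. Q x" Y] by simp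
    also have "edge_sum Y (\<lambda>x y. Q x) \<le> ?Q"
      by (rule edge_sum_le_vertex_sum) (auto simp: fin Q)
    finally show ?thesis by simp
  qed
  have E_sum: "(\<Sum>l\<le>L. ?E l) \<le> 2 / \<alpha> * (?Ini + (512 / \<alpha> + 1) * ?Q)"
  proof -
    let ?A = "\<lambda>l. \<Sum>x\<in>Y. (\<eta> l x)^2 * (u l x)^2 * m x"
    let ?T = "\<lambda>l. \<Sum>x\<in>Y. \<bar>(\<eta> (Suc l) x)^2 - (\<eta> l x)^2\<bar> * Q x * m x"
    \<comment> \<open>\<open>?T l\<close> pays for replacing \<eta> at time l by \<eta> at time l +
      1 in front of the new value of u.\<close>
    have step: "?A (Suc l) + \<alpha> / 2 * ?E l \<le> ?A l + 2 / \<alpha> * ?R l + ?T l" if "l \<le> L" for l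
    proof -
      have "?A (Suc l) \<le> (\<Sum>x\<in>Y. (\<eta> l x)^2 * (u (Suc l) x)^2 * m x
          + \<bar>(\<eta> (Suc l) x)^2 - (\<eta> l x)^2\<bar> * Q x * m x)"
      proof (rule sum_mono)
        fix x
        have "((\<eta> (Suc l) x)^2 - (\<eta> l x)^2) * (u (Suc l) x)^2 \<le> \<bar>(\<eta> (Suc l) x)^2 - (\<eta> l x)^2\<bar> * Q x"
          using time_Q[OF that, of x] Q[of x]
          by (cases "\<eta> (Suc l) x = \<eta> l x") (auto intro!: mult_mono)
        from mult_right_mono[OF this, of "m x"]
        show "(\<eta> (Suc l) x)^2 * (u (Suc l) x)^2 * m x \<le> (\<eta> l x)^2 * (u (Suc l) x)^2 * m x
          + \<bar>(\<eta> (Suc l) x)^2 - (\<eta> l x)^2\<bar> * Q x * m x" by (simp add: algebra_simps)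
      qed
      moreover have "edge_sum Y (\<lambda>x y. (\<eta> l x - \<eta> l y)^2 * (u l x)^2) \<le> ?R l"
        unfolding error_term_def by (intro edge_sum_mono mult_left_mono) auto
      ultimately show ?thesis using caccioppoli[of Y "u l" "\<eta> l"] Y[of l] that alpha_pos
        mult_left_mono[of "edge_sum Y (\<lambda>x y. (\<eta> l x - \<eta> l y)^2 * (u l x)^2)" "?R l" "2 / \<alpha>"]
        by (simp add: Pu sum.distrib)
    qed
    have "?A (Suc k) + \<alpha> / 2 * (\<Sum>l\<le>k. ?E l) \<le> ?A 0 + 2 / \<alpha> * (\<Sum>l\<le>k. ?R l) + (\<Sum>l\<le>k. ?T l)"
      if "k \<le> L" for k using that
    proof (induction k)
      case 0 then show ?case using step[of 0] by simp
    next
      case (Suc k) then show ?case using step[of "Suc k"] by (simp add: algebra_simps)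
    qed
    from this[of L] have "\<alpha> / 2 * (\<Sum>l\<le>L. ?E l) \<le> ?A 0 + 2 / \<alpha> * (\<Sum>l\<le>L. ?R l) + (\<Sum>l\<le>L. ?T l)"
      using sum_nonneg[of Y "\<lambda>x. (\<eta> (Suc L) x)^2 * (u (Suc L) x)^2 * m x"] by simp
    also have "2 / \<alpha> * (\<Sum>l\<le>L. ?R l) \<le> 2 / \<alpha> * (256 * ?Q)"
      using R_sum alpha_pos by (intro mult_left_mono) auto
    also have "(\<Sum>l\<le>L. ?T l) \<le> ?Q"
    proof -
      have "(\<Sum>l\<le>L. ?T l) = (\<Sum>x\<in>Y. (\<Sum>l\<le>L. \<bar>(\<eta> (Suc l) x)^2 - (\<eta> l x)^2\<bar>) * (Q x * m x))"
        by (subst sum.swap) (simp add: sum_distrib_left sum_distrib_right mult_ac)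
      also have "\<dots> \<le> (\<Sum>x\<in>Y. 1 * (Q x * m x))"
        using time_sum Q by (intro sum_mono mult_right_mono mult_nonneg_nonneg) auto
      finally show ?thesis by simp
    qed
    also have "?A 0 = ?Ini" by (simp add: u_def)
    finally have "\<alpha> / 2 * (\<Sum>l\<le>L. ?E l) \<le> ?Ini + (512 / \<alpha> + 1) * ?Q"
      by (simp add: algebra_simps)
    from mult_left_mono[OF this, of "2 / \<alpha>"] show ?thesis using alpha_pos by (simp add: field_simps)
  qed
  have "\<alpha> * (\<Sum>l<L. ?S l) \<le> (6 + 48 * ?K) * (\<Sum>l\<le>L. ?E l) + 16 * ?K * (\<Sum>l\<le>L. ?R l)"
  proof -
    let ?G = "\<lambda>l. real (Suc l) * energy Y (\<lambda>x. (\<eta> l x)^2) (u l)"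
    have step: "?G (Suc l) + \<alpha> * ?S l \<le> ?G l + ?K * (48 * ?E l + 16 * ?R l) + 5 * ?E (Suc l)" if "l < L" for l
      using weighted_energy_step[of Y "u l" "real (Suc l)" "\<eta> l" "\<eta> (Suc l)"] Y[of l] Y[of "Suc l"] that
        range edge time by (simp add: Pu add_ac)
    have "?G k + \<alpha> * (\<Sum>l<k. ?S l) \<le> ?G 0 + ?K * (48 * (\<Sum>l<k. ?E l) + 16 * (\<Sum>l<k. ?R l)) + 5 * (\<Sum>l<k. ?E (Suc l))"
      if "k \<le> L" for k using that
    proof (induction k)
      case (Suc k) then show ?case using step[of k] by (simp add: algebra_simps)
    qed simp
    from this[of L] have "?G L + \<alpha> * (\<Sum>l<L. ?S l)
       \<le> ?G 0 + ?K * (48 * (\<Sum>l<L. ?E l) + 16 * (\<Sum>l<L. ?R l)) + 5 * (\<Sum>l<L. ?E (Suc l))" by simp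
    moreover have "0 \<le> ?G L" by (simp add: energy_nonneg)
    \<comment> \<open>The initial term gives one unit of energy; with the five from the changing
      weight these are the 6 in \<open>local_const\<close>.\<close>
    moreover have "?G 0 \<le> ?E 0"
    proof -
      have "?G 0 = energy Y (\<lambda>x. (\<eta> 0 x)^2) (u 0)" by simp
      also have "\<dots> \<le> ?E 0" unfolding energy_def
      proof (intro edge_sum_mono mult_right_mono)
        show "((\<eta> 0 x)^2)^2 \<le> (\<eta> 0 x)^2" for x
          using range[of 0 x] power_decreasing[of 2 4 "\<eta> 0 x"] by simp
      qed auto
      finally show ?thesis .
    qed
    moreover have "(\<Sum>l<L. ?E l) \<le> (\<Sum>l\<le>L. ?E l)" "(\<Sum>l<L. ?R l) \<le> (\<Sum>l\<le>L. ?R l)"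
      by (auto intro!: sum_mono2 energy_nonneg R0)
    moreover have "(\<Sum>l<L. ?E (Suc l)) \<le> (\<Sum>l\<le>L. ?E l)"
    proof -
      have "(\<Sum>l\<le>L. ?E l) = ?E 0 + (\<Sum>l<L. ?E (Suc l))"
        by (simp only: lessThan_Suc_atMost[symmetric] sum.lessThan_Suc_shift)
      then show ?thesis using energy_nonneg[of Y "\<eta> 0" "u 0"] by linarith
    qed
    moreover have "?E 0 \<le> (\<Sum>l\<le>L. ?E l)" by (rule member_le_sum) (auto simp: energy_nonneg)
    moreover have "?K * (48 * a + 16 * b) \<le> ?K * (48 * a' + 16 * b')" if "a \<le> a'" "b \<le> b'" for a a' b b' :: real
      using that energy_const_pos by (intro mult_left_mono) auto
    ultimately have "\<alpha> * (\<Sum>l<L. ?S l) \<le> (\<Sum>l\<le>L. ?E l) + ?K * (48 * (\<Sum>l\<le>L. ?E l) + 16 * (\<Sum>l\<le>L. ?R l))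
        + 5 * (\<Sum>l\<le>L. ?E l)" by (smt (verit, best))
    then show ?thesis by (simp add: algebra_simps)
  qed
  also have "\<dots> \<le> (6 + 48 * ?K) * (2 / \<alpha> * (?Ini + (512 / \<alpha> + 1) * ?Q)) + 16 * ?K * (256 * ?Q)"
    using E_sum R_sum energy_const_pos by (intro add_mono mult_left_mono) auto
  also have "\<dots> \<le> (6 + 48 * ?K) * (2 / \<alpha> * ((512 / \<alpha> + 1) * (?Ini + ?Q))) + 4096 * ?K * (?Ini + ?Q)"
  proof -
    have "?Ini \<le> (512 / \<alpha> + 1) * ?Ini" using S0 alpha_pos by (simp add: algebra_simps)
    then have "?Ini + (512 / \<alpha> + 1) * ?Q \<le> (512 / \<alpha> + 1) * (?Ini + ?Q)" by (simp add: algebra_simps)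
    moreover have "16 * ?K * (256 * ?Q) \<le> 4096 * ?K * (?Ini + ?Q)" using S0 energy_const_pos by simp
    ultimately show ?thesis using energy_const_pos alpha_pos by (intro add_mono mult_left_mono) auto
  qed
  also have "\<dots> = \<alpha> * (local_const * (?Ini + ?Q))"
    using alpha_pos unfolding local_const_def by (simp add: field_simps)
  finally show ?thesis using alpha_pos by simp
qed

end

section \<open>Localised square functions\<close>

text \<open>To be evaluated at a distance \<open>t\<close> to a set: the transition layer then lies at times of order
  \<open>t\<^sup>2\<close>, so that squared gradients, of size \<open>1 / l\<close>, have a bounded sum over time.\<close>

definition cutoff :: "nat \<Rightarrow> nat \<Rightarrow> real" where
  "cutoff l t = min 1 (max 0 (2 * real t / sqrt (real (Suc l)) - 1))"

lemma cutoff_range: "0 \<le> cutoff l t" "cutoff l t \<le> 1"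
  by (auto simp: cutoff_def)

lemma cutoff_at_0 [simp]: "cutoff l 0 = 0"
  by (simp add: cutoff_def)

lemma cutoff_eq_1: "sqrt (real (Suc l)) \<le> real t \<Longrightarrow> cutoff l t = 1"
  by (simp add: cutoff_def field_simps)

lemma cutoff_0_pos [simp]: "0 < t \<Longrightarrow> cutoff 0 t = 1"
  by (rule cutoff_eq_1) simp

lemma cutoff_mono: "s \<le> t \<Longrightarrow> cutoff l s \<le> cutoff l t"
  unfolding cutoff_def by (intro min.mono max.mono diff_mono divide_right_mono) auto

lemma cutoff_antimono_time: "cutoff (Suc l) t \<le> cutoff l t"
  unfolding cutoff_def by (intro min.mono max.mono diff_mono divide_left_mono) auto

lemma cutoff_diff: "\<bar>cutoff l t - cutoff l s\<bar> \<le> 2 * \<bar>real t - real s\<bar> / sqrt (real (Suc l))"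
proof -
  have "\<bar>cutoff l t - cutoff l s\<bar> \<le> \<bar>2 * real t / sqrt (real (Suc l)) - 2 * real s / sqrt (real (Suc l))\<bar>"
    unfolding cutoff_def by linarith
  also have "\<dots> = \<bar>2 * (real t - real s) / sqrt (real (Suc l))\<bar>"
    by (simp only: diff_divide_distrib right_diff_distrib)
  also have "\<dots> = 2 * \<bar>real t - real s\<bar> / sqrt (real (Suc l))"
    by (subst abs_divide, subst abs_mult) simp
  finally show ?thesis .
qed

lemma cutoff_edge:
  assumes "t \<le> Suc s" "s \<le> Suc t"
  shows "real (Suc l) * (cutoff l t - cutoff l s)^2 \<le> 4"
proof -
  have "\<bar>cutoff l t - cutoff l s\<bar> \<le> 2 * \<bar>real t - real s\<bar> / sqrt (real (Suc l))" by (rule cutoff_diff)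
  also have "\<dots> \<le> 2 * 1 / sqrt (real (Suc l))" using assms
    by (intro divide_right_mono mult_left_mono) auto
  finally have "\<bar>cutoff l t - cutoff l s\<bar>^2 \<le> (2 / sqrt (real (Suc l)))^2"
    by (intro power_mono) auto
  also have "\<dots> = 4 / real (Suc l)" by (simp add: power_divide)
  finally show ?thesis by (simp add: field_simps)
qed

lemma cutoff_time_neq:
  assumes "cutoff (Suc l) t \<noteq> cutoff l t"
  shows "0 < t" "real t < sqrt (real (Suc (Suc l)))"
proof -
  show "0 < t" using assms by (cases t) auto
  show "real t < sqrt (real (Suc (Suc l)))"
  proof (rule ccontr)
    assume "\<not> ?thesis"
    then have "sqrt (real (Suc (Suc l))) \<le> real t" by simp
    moreover have "sqrt (real (Suc l)) \<le> sqrt (real (Suc (Suc l)))" by simp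
    ultimately show False using assms cutoff_eq_1[of l t] cutoff_eq_1[of "Suc l" t] by linarith
  qed
qed

text \<open>While the cutoff moves, t < b, so its drop is at most 2 (b - a) / a; multiplied by a^2
  this is at most (b - a) (a + b) = 1.\<close>

lemma cutoff_time: "real (Suc l) * (cutoff l t - cutoff (Suc l) t) \<le> 1"
proof (cases "cutoff (Suc l) t = cutoff l t")
  case False
  define a b where "a = sqrt (real (Suc l))" "b = sqrt (real (Suc (Suc l)))"
  have ab: "0 < a" "a \<le> b" "a * a = real (Suc l)" "b * b = real (Suc l) + 1" by (auto simp: a_b_def)
  have t: "real t < b" using cutoff_time_neq[OF False] by (simp add: a_b_def)
  have "b * b - a * a = 1" using ab by simp
  then have 1: "(b - a) * (a + b) = 1" by (simp add: algebra_simps)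
  have "cutoff l t - cutoff (Suc l) t \<le> \<bar>2 * real t / a - 2 * real t / b\<bar>"
    unfolding cutoff_def a_b_def by linarith
  also have "2 * real t / a - 2 * real t / b = 2 * real t * (b - a) / (a * b)"
    using ab by (simp add: field_simps)
  also have "\<bar>\<dots>\<bar> = 2 * real t * (b - a) / (a * b)" using ab by simp
  also have "\<dots> \<le> 2 * b * (b - a) / (a * b)" using t ab
    by (intro divide_right_mono mult_right_mono) auto
  also have "\<dots> = 2 * (b - a) / a" using ab by simp
  finally have "real (Suc l) * (cutoff l t - cutoff (Suc l) t) \<le> real (Suc l) * (2 * (b - a) / a)"
    by (intro mult_left_mono) auto
  also have "\<dots> = (a * a) * (2 * (b - a) / a)" by (simp only: ab(3))
  also have "\<dots> = (b - a) * (a + a)" using ab(1) by (simp add: field_simps)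
  also have "\<dots> \<le> (b - a) * (a + b)" using ab by (intro mult_left_mono) auto
  finally show ?thesis using 1 by simp
qed simp

text \<open>Locates the layer: one endpoint lies off the set, so the error can be charged there, and
  the nearer endpoint is within reach of the nontangential bound.\<close>

lemma cutoff_edge_neq:
  assumes "cutoff l t \<noteq> cutoff l s"
  shows "0 < max s t" "real (min s t) < sqrt (real (Suc l))"
proof -
  show "0 < max s t" using assms by (cases "s = 0 \<and> t = 0") auto
  show "real (min s t) < sqrt (real (Suc l))"
  proof (rule ccontr)
    assume "\<not> ?thesis"
    then have "sqrt (real (Suc l)) \<le> real s" "sqrt (real (Suc l)) \<le> real t"
      by (simp_all only: of_nat_min min_less_iff_disj not_less de_Morgan_disj)
    then show False using assms cutoff_eq_1[of l t] cutoff_eq_1[of l s] by simp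
  qed
qed

text \<open>With k = s + 1, the difference vanishes unless l < 4 k^2, and it is nonzero only if l +
  1 > s^2, which makes each square at most 16 / k^2. For s = 0 the range of the cutoff replaces the
  second fact.\<close>

lemma cutoff_edge_sum_Suc: "(\<Sum>l\<le>L. (cutoff l (Suc s) - cutoff l s)^2) \<le> 64"
proof -
  let ?k = "Suc s"
  have 1: "(cutoff l ?k - cutoff l s)^2 \<le> (if l < 4 * ?k^2 then 16 / (real ?k)^2 else 0)" for l
  proof (cases "cutoff l ?k = cutoff l s")
    case False
    then have "cutoff l ?k \<noteq> 0" using cutoff_mono[of s ?k l] cutoff_range(1)[of l s] by auto
    then have "sqrt (real (Suc l)) < 2 * real ?k"
      by (auto simp: cutoff_def field_simps max_def min_def split: if_splits)
    then have "(sqrt (real (Suc l)))^2 < (2 * real ?k)^2" by (intro power_strict_mono) auto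
    also have "(2 * real ?k)^2 = real (4 * ?k^2)"
      by (simp only: of_nat_mult of_nat_power power_mult_distrib) simp
    finally have "real (Suc l) < real (4 * ?k^2)" by simp
    then have l: "l < 4 * ?k^2" unfolding of_nat_less_iff by simp
    have "(cutoff l ?k - cutoff l s)^2 \<le> 16 / (real ?k)^2"
    proof (cases "s = 0")
      case True
      have "(cutoff l ?k - cutoff l s)^2 \<le> 1^2"
        using cutoff_range[of l ?k] True by (intro power_mono) auto
      then show ?thesis using True by simp
    next
      case s: False
      have "real s < sqrt (real (Suc l))" using cutoff_edge_neq(2)[OF False] by simp
      then have "(real ?k / 2)^2 \<le> (sqrt (real (Suc l)))^2" using s by (intro power_mono) auto
      then have k: "(real ?k)^2 \<le> 4 * real (Suc l)" by (simp add: power_divide)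
      have "(cutoff l ?k - cutoff l s)^2 \<le> 4 / real (Suc l)"
        using cutoff_edge[of ?k s l] by (simp add: field_simps)
      also have "\<dots> = 16 / (4 * real (Suc l))" by (simp add: field_simps del: of_nat_Suc)
      also have "\<dots> \<le> 16 / (real ?k)^2" using k by (intro divide_left_mono mult_pos_pos) auto
      finally show ?thesis .
    qed
    then show ?thesis using l by simp
  qed simp
  have "(\<Sum>l\<le>L. (cutoff l ?k - cutoff l s)^2) \<le> (\<Sum>l\<le>L. if l < 4 * ?k^2 then 16 / (real ?k)^2 else 0)"
    by (intro sum_mono 1)
  also have "\<dots> = (\<Sum>l\<in>{..L} \<inter> {..<4 * ?k^2}. 16 / (real ?k)^2)"
    by (rule sum.mono_neutral_cong_right) auto
  also have "\<dots> \<le> (\<Sum>l\<in>{..<4 * ?k^2}. 16 / (real ?k)^2)"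
    by (rule sum_mono2) auto
  also have "\<dots> = real (4 * ?k^2) * (16 / (real ?k)^2)" by simp
  also have "\<dots> = 64" by (simp only: of_nat_mult of_nat_power) (simp add: field_simps)
  finally show ?thesis .
qed

lemma cutoff_edge_sum:
  assumes "t \<le> Suc s" "s \<le> Suc t"
  shows "(\<Sum>l\<le>L. (cutoff l t - cutoff l s)^2) \<le> 64"
proof -
  consider "t = s" | "t = Suc s" | "s = Suc t" using assms by linarith
  then show ?thesis
  proof cases
    case 3 then show ?thesis
      using cutoff_edge_sum_Suc[of t L] by (subst power2_commute) simp
  qed (auto simp: cutoff_edge_sum_Suc)
qed

text \<open>Total variation of a monotone sequence in [0, 1]; the two forms serve cutoffs for tents
  and for their complements.\<close>

lemma sum_abs_diff_squares_decreasing: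
  fixes a :: "nat \<Rightarrow> real"
  assumes "\<And>l. 0 \<le> a l" "\<And>l. a l \<le> 1" "\<And>l. a (Suc l) \<le> a l"
  shows "(\<Sum>l\<le>L. \<bar>(a (Suc l))^2 - (a l)^2\<bar>) \<le> 1"
    and "(\<Sum>l\<le>L. \<bar>(1 - a (Suc l))^2 - (1 - a l)^2\<bar>) \<le> 1"
proof -
  have *: "(\<Sum>l\<le>L. \<bar>b (Suc l) - b l\<bar>) = \<bar>b (Suc L) - b 0\<bar>"
    if "(\<forall>l. b (Suc l) \<le> b l) \<or> (\<forall>l. b l \<le> b (Suc l))" for b :: "nat \<Rightarrow> real"
  proof -
    have "\<exists>e\<in>{1, -1}. \<forall>l. \<bar>b (Suc l) - b l\<bar> = e * (b (Suc l) - b l)" using that by auto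
    then obtain e where e: "e = 1 \<or> e = -1" "\<And>l. \<bar>b (Suc l) - b l\<bar> = e * (b (Suc l) - b l)" by blast
    have "(\<Sum>l\<le>L. \<bar>b (Suc l) - b l\<bar>) = e * (b (Suc L) - b 0)"
      unfolding e(2) sum_distrib_left[symmetric] lessThan_Suc_atMost[symmetric] sum_lessThan_telescope ..
    moreover have "0 \<le> (\<Sum>l\<le>L. \<bar>b (Suc l) - b l\<bar>)" by (rule sum_nonneg) auto
    ultimately show ?thesis using e(1) by auto
  qed
  have le1: "\<bar>x^2 - y^2\<bar> \<le> 1" if "0 \<le> x" "x \<le> 1" "0 \<le> y" "y \<le> 1" for x y :: real
    using power_le_one[OF that(1,2), of 2] power_le_one[OF that(3,4), of 2]
      zero_le_power2[of x] zero_le_power2[of y] by linarith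
  show "(\<Sum>l\<le>L. \<bar>(a (Suc l))^2 - (a l)^2\<bar>) \<le> 1"
    using *[of "\<lambda>l. (a l)^2"] assms le1[of "a (Suc L)" "a 0"] by (simp add: power_mono)
  show "(\<Sum>l\<le>L. \<bar>(1 - a (Suc l))^2 - (1 - a l)^2\<bar>) \<le> 1"
    using *[of "\<lambda>l. (1 - a l)^2"] assms le1[of "1 - a (Suc L)" "1 - a 0"] by (simp add: power_mono)
qed

context weighted_graph
begin

text \<open>Unspecified for empty F; the sets used later are nonempty by
  \<open>exists_maxfun_zero\<close>.\<close>

definition dist_set :: "'a set \<Rightarrow> 'a \<Rightarrow> nat" where
  "dist_set F x = (LEAST n. \<exists>z\<in>F. d x z = n)"

lemma dist_set_attained: "F \<noteq> {} \<Longrightarrow> \<exists>z\<in>F. d x z = dist_set F x"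
  unfolding dist_set_def by (rule LeastI_ex) auto

lemma dist_set_le: "z \<in> F \<Longrightarrow> dist_set F x \<le> d x z"
  unfolding dist_set_def by (rule Least_le) auto

lemma dist_set_eq_0: "F \<noteq> {} \<Longrightarrow> dist_set F x = 0 \<longleftrightarrow> x \<in> F"
  using dist_set_attained[of F x] dist_set_le[of x F x] by auto

lemma dist_set_pos: "F \<noteq> {} \<Longrightarrow> x \<notin> F \<Longrightarrow> 0 < dist_set F x"
  using dist_set_eq_0[of F x] by (cases "dist_set F x") auto

lemma dist_set_adj:
  assumes "F \<noteq> {}" "adj \<mu> x y"
  shows "dist_set F x \<le> Suc (dist_set F y)"
proof -
  obtain z where "z \<in> F" "d y z = dist_set F y" using dist_set_attained assms by blast
  then show ?thesis using dist_set_le[of z F x] dist_triangle[of x z y] dist_adj[OF assms(2)] by linarith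
qed

abbreviation increment :: "('a \<Rightarrow> real) \<Rightarrow> nat \<Rightarrow> 'a \<Rightarrow> real" where
  "increment f l x \<equiv> (P ^^ l) f x - (P ^^ Suc l) f x"

text \<open>Aperture 2 leaves room for the one edge by which the transition layer exceeds sqrt (l +
  1).\<close>

definition nontangential_bound :: "nat \<Rightarrow> ('a \<Rightarrow> real) \<Rightarrow> ('a \<Rightarrow> real) \<Rightarrow> bool" where
  "nontangential_bound L f H \<longleftrightarrow>
     (\<forall>x z l. l \<le> L \<longrightarrow> real (d x z) \<le> 2 * sqrt (real (Suc l)) \<longrightarrow> \<bar>(P ^^ l) f x\<bar> \<le> H z)"

lemma nontangential_boundD:
  assumes "nontangential_bound L f H" "l \<le> L" "real (d x z) \<le> 2 * sqrt (real (Suc l))"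
  shows "\<bar>(P ^^ l) f x\<bar> \<le> H z" "((P ^^ l) f x)^2 \<le> (H z)^2"
proof -
  show 1: "\<bar>(P ^^ l) f x\<bar> \<le> H z" using assms unfolding nontangential_bound_def by blast
  then have "\<bar>(P ^^ l) f x\<bar>^2 \<le> (H z)^2" by (intro power_mono) auto
  then show "((P ^^ l) f x)^2 \<le> (H z)^2" by simp
qed

end

context lazy_graph
begin

text \<open>The cutoff vanishes on F and is 1 on the tent. Any edge or time step on which it varies
  involves a vertex off F, whose value of H bounds u there and at its neighbours. The initial term
  obeys the same bound as the errors, whence the factor 2.\<close>

lemma tent_estimate:
  assumes Y: "\<And>l. l \<le> Suc L \<Longrightarrow> inside Y ((P ^^ l) f)" and F: "F \<noteq> {}"
    and H: "nontangential_bound (Suc L) f H"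
  shows "(\<Sum>l<L. real (Suc l) * (\<Sum>x\<in>{x\<in>Y. sqrt (real (Suc l)) \<le> real (dist_set F x)}.
            (increment f l x)^2 * m x))
    \<le> 2 * local_const * (\<Sum>x\<in>Y - F. (H x)^2 * m x)"
proof -
  let ?u = "\<lambda>l. (P ^^ l) f" and ?T = "\<lambda>l. {x\<in>Y. sqrt (real (Suc l)) \<le> real (dist_set F x)}"
  let ?\<eta> = "\<lambda>l x. cutoff l (dist_set F x)"
  let ?Q = "\<lambda>x. if x \<in> F then 0 else (H x)^2"
  have fin: "finite Y" using Y[of 0] by (simp add: inside_def)
  have adj: "dist_set F x \<le> Suc (dist_set F y)" "dist_set F y \<le> Suc (dist_set F x)" if "adj \<mu> x y" for x y
    using dist_set_adj[OF F] that adj_sym by auto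
  have HQ: "(?u l x)^2 \<le> ?Q z" if "l \<le> Suc L" "d x z \<le> 1" "z \<notin> F" for l x z
  proof -
    have "real (d x z) \<le> 1" using that by simp
    also have "\<dots> \<le> 2 * sqrt (real (Suc l))" using real_sqrt_ge_one[of "real (Suc l)"] by linarith
    finally show ?thesis using nontangential_boundD(2)[OF H, of l x z] that by simp
  qed
  have "(\<Sum>l<L. real (Suc l) * (\<Sum>x\<in>Y. (?\<eta> l x)^4 * (?u l x - ?u (Suc l) x)^2 * m x))
    \<le> local_const * ((\<Sum>x\<in>Y. (?\<eta> 0 x)^2 * (f x)^2 * m x) + (\<Sum>x\<in>Y. ?Q x * m x))"
  proof (rule localized_square_function)
    fix l x
    have "real (Suc l) * (?\<eta> (Suc l) x - ?\<eta> l x) \<le> 0"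
      using cutoff_antimono_time by (intro mult_nonneg_nonpos) (auto simp: algebra_simps)
    then show "real (Suc l) * (?\<eta> (Suc l) x - ?\<eta> l x) \<le> 1" by linarith
  next
    fix x show "(\<Sum>l\<le>L. \<bar>(?\<eta> (Suc l) x)^2 - (?\<eta> l x)^2\<bar>) \<le> 1"
      by (rule sum_abs_diff_squares_decreasing(1)) (auto simp: cutoff_range cutoff_antimono_time)
  next
    fix l x y assume l: "l \<le> L" and xy: "adj \<mu> x y" and neq: "?\<eta> l x \<noteq> ?\<eta> l y"
    from cutoff_edge_neq(1)[OF neq] have "x \<notin> F \<or> y \<notin> F"
      using dist_set_eq_0[OF F, of x] dist_set_eq_0[OF F, of y] by linarith
    then show "(?u l x)^2 \<le> ?Q x + ?Q y \<and> (?u (Suc l) x)^2 \<le> ?Q x + ?Q y"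
      using HQ[of l x x] HQ[of l x y] HQ[of "Suc l" x x] HQ[of "Suc l" x y] l dist_adj[OF xy]
      by (smt (verit) Suc_le_mono dist_refl le_SucI zero_le zero_le_power2)
  next
    fix l x assume l: "l \<le> L" and neq: "?\<eta> (Suc l) x \<noteq> ?\<eta> l x"
    from cutoff_time_neq(1)[OF neq] have "x \<notin> F" using dist_set_eq_0[OF F, of x] by simp
    then show "(?u (Suc l) x)^2 \<le> ?Q x" using HQ[of "Suc l" x x] l by auto
  next
    fix l x y assume "adj \<mu> x y"
    from cutoff_edge[OF adj[OF this], of l]
    show "real (Suc l) * (?\<eta> l x - ?\<eta> l y)^2 \<le> 4" .
  qed (use Y adj in \<open>auto simp: cutoff_range intro!: cutoff_edge_sum\<close>)
  moreover have "(\<Sum>x\<in>Y. (?\<eta> 0 x)^2 * (f x)^2 * m x) \<le> (\<Sum>x\<in>Y. ?Q x * m x)"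
  proof (intro sum_mono mult_right_mono)
    fix x
    show "(?\<eta> 0 x)^2 * (f x)^2 \<le> ?Q x"
    proof (cases "x \<in> F")
      case True
      then have "dist_set F x = 0" using dist_set_eq_0[OF F] by simp
      then show ?thesis by simp
    next
      case False
      then have "dist_set F x > 0" by (rule dist_set_pos[OF F])
      then show ?thesis using HQ[of 0 x x] False by simp
    qed
  qed auto
  moreover have "(\<Sum>x\<in>Y. ?Q x * m x) = (\<Sum>x\<in>Y - F. (H x)^2 * m x)"
    by (rule sum.mono_neutral_cong_right) (auto simp: fin)
  moreover have "(\<Sum>l<L. real (Suc l) * (\<Sum>x\<in>?T l.
            (?u l x - ?u (Suc l) x)^2 * m x))
      \<le> (\<Sum>l<L. real (Suc l) * (\<Sum>x\<in>Y. (?\<eta> l x)^4 * (?u l x - ?u (Suc l) x)^2 * m x))"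
  proof (intro sum_mono mult_left_mono)
    fix l
    have "(\<Sum>x\<in>?T l. (?u l x - ?u (Suc l) x)^2 * m x)
      = (\<Sum>x\<in>?T l. (?\<eta> l x)^4 * (?u l x - ?u (Suc l) x)^2 * m x)"
      by (rule sum.cong) (auto simp: cutoff_eq_1)
    also have "\<dots> \<le> (\<Sum>x\<in>Y. (?\<eta> l x)^4 * (?u l x - ?u (Suc l) x)^2 * m x)"
      by (rule sum_mono2) (auto simp: fin cutoff_range)
    finally show "(\<Sum>x\<in>?T l. (?u l x - ?u (Suc l) x)^2 * m x)
       \<le> (\<Sum>x\<in>Y. (?\<eta> l x)^4 * (?u l x - ?u (Suc l) x)^2 * m x)" .
  qed auto
  moreover have "local_const * (a + b) \<le> 2 * local_const * b" if "a \<le> b" for a b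
    using that local_const_pos by (simp add: distrib_left)
  ultimately show ?thesis by (metis (no_types, lifting) order_trans)
qed

text \<open>The cutoff is supported in the sawtooth region above \<open>F\<close>, where the nontangential bound
  keeps the evolution below \<open>c\<close>.\<close>

lemma sawtooth_estimate:
  fixes c :: real
  assumes Y: "\<And>l. l \<le> Suc L \<Longrightarrow> inside Y ((P ^^ l) f)" and F: "F \<noteq> {}"
    and H: "nontangential_bound (Suc L) f H" and HF: "\<And>x. x \<in> F \<Longrightarrow> H x \<le> c"
  shows "(\<Sum>l<L. real (Suc l) * (\<Sum>x\<in>Y \<inter> F. (increment f l x)^2 * m x))
    \<le> local_const * ((\<Sum>x\<in>Y \<inter> F. (f x)^2 * m x) + (\<Sum>x\<in>Y - F. c^2 * m x))"
proof -
  let ?u = "\<lambda>l. (P ^^ l) f"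
  let ?\<eta> = "\<lambda>l x. 1 - cutoff l (dist_set F x)"
  let ?Q = "\<lambda>x. if x \<in> F then 0 else c^2"
  have fin: "finite Y" using Y[of 0] by (simp add: inside_def)
  have adj: "dist_set F x \<le> Suc (dist_set F y)" "dist_set F y \<le> Suc (dist_set F x)" if "adj \<mu> x y" for x y
    using dist_set_adj[OF F] that adj_sym by auto
  \<comment> \<open>A point of the layer sees its nearest point of F inside the cone, since sqrt (l
    + 1) + 1 is at most 2 sqrt (l + 1).\<close>
  have near: "(?u l x)^2 \<le> c^2" if l: "l \<le> Suc L" and x: "real (dist_set F x) \<le> sqrt (real (Suc l)) + 1" for l x
  proof -
    obtain z where z: "z \<in> F" "d x z = dist_set F x" using dist_set_attained[OF F] by blast
    have "1 \<le> sqrt (real (Suc l))" by simp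
    then have "real (d x z) \<le> 2 * sqrt (real (Suc l))" using x unfolding z(2) by linarith
    from nontangential_boundD(1)[OF H l this] HF[OF z(1)] have "\<bar>?u l x\<bar> \<le> c" by linarith
    then have "\<bar>?u l x\<bar>^2 \<le> c^2" by (intro power_mono) auto
    then show ?thesis by simp
  qed
  have "(\<Sum>l<L. real (Suc l) * (\<Sum>x\<in>Y. (?\<eta> l x)^4 * (?u l x - ?u (Suc l) x)^2 * m x))
    \<le> local_const * ((\<Sum>x\<in>Y. (?\<eta> 0 x)^2 * (f x)^2 * m x) + (\<Sum>x\<in>Y. ?Q x * m x))"
  proof (rule localized_square_function)
    fix l x
    show "real (Suc l) * (?\<eta> (Suc l) x - ?\<eta> l x) \<le> 1"
      using cutoff_time[of l "dist_set F x"] by simp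
  next
    fix x show "(\<Sum>l\<le>L. \<bar>(?\<eta> (Suc l) x)^2 - (?\<eta> l x)^2\<bar>) \<le> 1"
      by (rule sum_abs_diff_squares_decreasing(2)) (auto simp: cutoff_range cutoff_antimono_time)
  next
    fix l x y assume l: "l \<le> L" and xy: "adj \<mu> x y" and "?\<eta> l x \<noteq> ?\<eta> l y"
    then have neq: "cutoff l (dist_set F x) \<noteq> cutoff l (dist_set F y)" by simp
    from cutoff_edge_neq(1)[OF neq] have "x \<notin> F \<or> y \<notin> F"
      using dist_set_eq_0[OF F, of x] dist_set_eq_0[OF F, of y] by linarith
    then have Q: "c^2 \<le> ?Q x + ?Q y" by auto
    have D: "real (dist_set F x) \<le> sqrt (real (Suc l)) + 1"
      using cutoff_edge_neq(2)[OF neq] adj[OF xy] by (auto simp: min_def split: if_splits)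
    moreover have "sqrt (real (Suc l)) \<le> sqrt (real (Suc (Suc l)))" by simp
    ultimately have D': "real (dist_set F x) \<le> sqrt (real (Suc (Suc l))) + 1" by linarith
    show "(?u l x)^2 \<le> ?Q x + ?Q y \<and> (?u (Suc l) x)^2 \<le> ?Q x + ?Q y"
      using near[OF _ D] near[OF _ D'] l Q by (meson Suc_le_mono le_SucI order_trans)
  next
    fix l x assume l: "l \<le> L" and "?\<eta> (Suc l) x \<noteq> ?\<eta> l x"
    then have neq: "cutoff (Suc l) (dist_set F x) \<noteq> cutoff l (dist_set F x)" by simp
    from cutoff_time_neq(1)[OF neq] have "x \<notin> F" using dist_set_eq_0[OF F, of x] by simp
    moreover have "real (dist_set F x) \<le> sqrt (real (Suc (Suc l))) + 1"
      using cutoff_time_neq(2)[OF neq] by linarith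
    ultimately show "(?u (Suc l) x)^2 \<le> ?Q x" using near[of "Suc l" x] l by auto
  next
    fix l x y assume "adj \<mu> x y"
    from cutoff_edge[OF adj[OF this], of l]
    show "real (Suc l) * (?\<eta> l x - ?\<eta> l y)^2 \<le> 4" by (simp add: power2_commute)
  next
    fix x y assume "adj \<mu> x y"
    from cutoff_edge_sum[OF adj[OF this], of L]
    show "(\<Sum>l\<le>L. (?\<eta> l x - ?\<eta> l y)^2) \<le> 64" by (simp add: power2_commute)
  qed (use Y in \<open>auto simp: cutoff_range\<close>)
  moreover have "(\<Sum>x\<in>Y. (?\<eta> 0 x)^2 * (f x)^2 * m x) = (\<Sum>x\<in>Y \<inter> F. (f x)^2 * m x)"
  proof (rule sum.mono_neutral_cong_right)
    show "\<forall>x\<in>Y - Y \<inter> F. (?\<eta> 0 x)^2 * (f x)^2 * m x = 0"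
    proof
      fix x assume "x \<in> Y - Y \<inter> F"
      then have "dist_set F x > 0" using dist_set_pos[OF F, of x] by blast
      then show "(?\<eta> 0 x)^2 * (f x)^2 * m x = 0" by simp
    qed
    fix x assume "x \<in> Y \<inter> F"
    then have "dist_set F x = 0" using dist_set_eq_0[OF F, of x] by simp
    then show "(?\<eta> 0 x)^2 * (f x)^2 * m x = (f x)^2 * m x" by simp
  qed (auto simp: fin)
  moreover have "(\<Sum>x\<in>Y. ?Q x * m x) = (\<Sum>x\<in>Y - F. c^2 * m x)"
    by (rule sum.mono_neutral_cong_right) (auto simp: fin)
  moreover have "(\<Sum>l<L. real (Suc l) * (\<Sum>x\<in>Y \<inter> F. (?u l x - ?u (Suc l) x)^2 * m x))
      \<le> (\<Sum>l<L. real (Suc l) * (\<Sum>x\<in>Y. (?\<eta> l x)^4 * (?u l x - ?u (Suc l) x)^2 * m x))"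
  proof (intro sum_mono mult_left_mono)
    fix l
    have "(\<Sum>x\<in>Y \<inter> F. (?u l x - ?u (Suc l) x)^2 * m x)
      = (\<Sum>x\<in>Y \<inter> F. (?\<eta> l x)^4 * (?u l x - ?u (Suc l) x)^2 * m x)"
    proof (rule sum.cong)
      fix x assume "x \<in> Y \<inter> F"
      then have "dist_set F x = 0" using dist_set_eq_0[OF F, of x] by simp
      then show "(?u l x - ?u (Suc l) x)^2 * m x = (?\<eta> l x)^4 * (?u l x - ?u (Suc l) x)^2 * m x" by simp
    qed simp
    also have "\<dots> \<le> (\<Sum>x\<in>Y. (?\<eta> l x)^4 * (?u l x - ?u (Suc l) x)^2 * m x)"
      by (rule sum_mono2) (auto simp: fin cutoff_range)
    finally show "(\<Sum>x\<in>Y \<inter> F. (?u l x - ?u (Suc l) x)^2 * m x)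
       \<le> (\<Sum>x\<in>Y. (?\<eta> l x)^4 * (?u l x - ?u (Suc l) x)^2 * m x)" .
  qed auto
  ultimately show ?thesis by simp
qed

end

section \<open>The maximal function\<close>

abbreviation pow2 :: "int \<Rightarrow> real" where "pow2 k \<equiv> 2 powr real_of_int k"

lemma sum_UNION_le:
  fixes g :: "'b \<Rightarrow> real"
  assumes "finite T" "\<And>x. finite (A x)" "\<And>y. 0 \<le> g y"
  shows "(\<Sum>y\<in>(\<Union>x\<in>T. A x). g y) \<le> (\<Sum>x\<in>T. \<Sum>y\<in>A x. g y)"
  using assms(1)
proof (induction T rule: finite_induct)
  case (insert x T)
  have "(\<Sum>y\<in>A x \<union> (\<Union>x\<in>T. A x). g y) \<le> (\<Sum>y\<in>A x. g y) + (\<Sum>y\<in>(\<Union>x\<in>T. A x). g y)"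
    using insert.hyps assms by (subst sum_Un) (auto intro: sum_nonneg)
  then show ?case using insert by simp
qed simp

lemma dyadic_exists:
  assumes "(t::real) > 0"
  shows "\<exists>k::int. pow2 k < t \<and> t \<le> 2 powr (real_of_int k + 1)"
proof -
  let ?k = "\<lceil>log 2 t\<rceil> - 1"
  have "real_of_int ?k < log 2 t" "log 2 t \<le> real_of_int ?k + 1" by linarith+
  then have "2 powr real_of_int ?k < 2 powr (log 2 t)" "2 powr (log 2 t) \<le> 2 powr (real_of_int ?k + 1)"
    by (intro powr_less_mono powr_mono; simp)+
  then have "2 powr real_of_int ?k < t \<and> t \<le> 2 powr (real_of_int ?k + 1)" using assms by simp
  then show ?thesis by blast
qed

text \<open>A geometric series counted downwards from its top exponent \<open>?k0\<close>.\<close>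

lemma sum_dyadic_le:
  fixes K :: "int set" and a t :: real
  assumes "finite K" "a > 0" "t > 0"
  shows "(\<Sum>k\<in>{k\<in>K. pow2 k \<le> t}. 2 powr (a * real_of_int k)) \<le> t powr a / (1 - 2 powr (- a))"
proof -
  let ?q = "2 powr (- a) :: real"
  let ?k0 = "\<lfloor>log 2 t\<rfloor>"
  let ?K = "{k\<in>K. pow2 k \<le> t}"
  have q: "0 < ?q" "?q < 1" using assms by (auto simp: powr_less_one)
  have k: "k \<le> ?k0" if "k \<in> ?K" for k
    using that assms by (simp add: le_floor_iff le_log_iff)
  have "(\<Sum>k\<in>?K. 2 powr (a * real_of_int k)) = (\<Sum>k\<in>?K. 2 powr (a * real_of_int ?k0) * ?q ^ nat (?k0 - k))"
  proof (rule sum.cong[OF refl])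
    fix k assume "k \<in> ?K"
    then have "real (nat (?k0 - k)) = real_of_int ?k0 - real_of_int k" using k[of k] by simp
    moreover have "?q ^ nat (?k0 - k) = ?q powr real (nat (?k0 - k))" by (simp add: powr_realpow)
    ultimately have "?q ^ nat (?k0 - k) = 2 powr (- a * (real_of_int ?k0 - real_of_int k))"
      by (simp add: powr_powr)
    then show "2 powr (a * real_of_int k) = 2 powr (a * real_of_int ?k0) * ?q ^ nat (?k0 - k)"
      by (simp add: powr_add[symmetric] algebra_simps)
  qed
  also have "\<dots> = 2 powr (a * real_of_int ?k0) * (\<Sum>k\<in>?K. ?q ^ nat (?k0 - k))"
    by (simp add: sum_distrib_left)
  also have "(\<Sum>k\<in>?K. ?q ^ nat (?k0 - k)) = (\<Sum>j\<in>(\<lambda>k. nat (?k0 - k)) ` ?K. ?q ^ j)"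
    by (subst sum.reindex) (use k in \<open>auto simp: inj_on_def o_def eq_nat_nat_iff\<close>)
  also have "\<dots> \<le> (\<Sum>j. ?q ^ j)"
    using assms q by (intro sum_le_suminf) (auto simp: summable_geometric)
  also have "\<dots> = 1 / (1 - ?q)" using q by (simp add: suminf_geometric)
  finally have "(\<Sum>k\<in>?K. 2 powr (a * real_of_int k)) \<le> 2 powr (a * real_of_int ?k0) * (1 / (1 - ?q))" by simp
  also have "2 powr (a * real_of_int ?k0) = (2 powr real_of_int ?k0) powr a" by (simp add: powr_powr mult.commute)
  also have "\<dots> * (1 / (1 - ?q)) \<le> t powr a * (1 / (1 - ?q))"
  proof (intro mult_right_mono powr_mono2)
    show "2 powr real_of_int ?k0 \<le> t" using powr_mono[OF of_int_floor_le[of "log 2 t"], of 2] assms by simp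
  qed (use assms q in auto)
  finally show ?thesis by simp
qed

text \<open>The reflection of \<open>sum_dyadic_le\<close> under k -> -k and t -> 1 / t.\<close>

lemma sum_dyadic_ge:
  fixes K :: "int set" and a t :: real
  assumes "finite K" "a > 0" "t > 0"
  shows "(\<Sum>k\<in>{k\<in>K. t \<le> pow2 k}. 2 powr (- a * real_of_int k)) \<le> t powr (- a) / (1 - 2 powr (- a))"
proof -
  have "(\<Sum>k\<in>{k\<in>(\<lambda>k::int. - k) ` K. pow2 k \<le> 1 / t}. 2 powr (a * real_of_int k))
     = (\<Sum>k\<in>(\<lambda>k::int. - k) ` {k\<in>K. t \<le> pow2 k}. 2 powr (a * real_of_int k))"
    by (rule sum.cong) (use assms in \<open>auto simp: powr_minus field_simps\<close>)
  also have "\<dots> = (\<Sum>k\<in>{k\<in>K. t \<le> pow2 k}. 2 powr (- a * real_of_int k))"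
    by (subst sum.reindex) auto
  finally have "(\<Sum>k\<in>{k\<in>K. t \<le> pow2 k}. 2 powr (- a * real_of_int k))
      = (\<Sum>k\<in>{k\<in>(\<lambda>k::int. - k) ` K. pow2 k \<le> 1 / t}. 2 powr (a * real_of_int k))" by simp
  also have "\<dots> \<le> (1 / t) powr a / (1 - 2 powr (- a))"
    using assms by (intro sum_dyadic_le) auto
  also have "(1 / t) powr a = t powr (- a)" using assms by (simp add: powr_divide powr_minus_divide)
  finally show ?thesis .
qed

lemma dyadic_layers:
  fixes h :: "'b \<Rightarrow> real"
  assumes "finite Y"
  shows "\<exists>K::int set. finite K \<and> (\<forall>x\<in>Y. h x > 0 \<longrightarrow> (\<exists>k\<in>K. pow2 k < h x \<and> h x \<le> 2 powr (real_of_int k + 1)))"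
proof -
  have "\<forall>x. \<exists>k::int. h x > 0 \<longrightarrow> pow2 k < h x \<and> h x \<le> 2 powr (real_of_int k + 1)"
    using dyadic_exists by blast
  from choice[OF this] obtain \<kappa> :: "'b \<Rightarrow> int" where
    "\<forall>x. h x > 0 \<longrightarrow> 2 powr real_of_int (\<kappa> x) < h x \<and> h x \<le> 2 powr (real_of_int (\<kappa> x) + 1)" by blast
  then show ?thesis using assms by (intro exI[of _ "\<kappa> ` Y"]) auto
qed

text \<open>The highest level below h x alone carries h x ^ p up to the factor 2 ^ p; the lower
  levels are only added. Finitely many levels serve a finite \<open>Y\<close>.\<close>

lemma dyadic_layer_cake:
  fixes h w :: "'b \<Rightarrow> real"
  assumes "finite Y" "p > 0" "\<And>x. x \<in> Y \<Longrightarrow> 0 \<le> h x" "\<And>x. x \<in> Y \<Longrightarrow> 0 \<le> w x"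
  shows "\<exists>K::int set. finite K \<and>
    (\<Sum>x\<in>Y. h x powr p * w x) \<le> 2 powr p * (\<Sum>k\<in>K. 2 powr (p * real_of_int k) * (\<Sum>x\<in>{x\<in>Y. pow2 k < h x}. w x))"
proof -
  obtain K :: "int set" where K: "finite K"
      "\<And>x. x \<in> Y \<Longrightarrow> h x > 0 \<Longrightarrow> \<exists>k\<in>K. pow2 k < h x \<and> h x \<le> 2 powr (real_of_int k + 1)"
    using dyadic_layers[OF assms(1), of h] by blast
  have "(\<Sum>x\<in>Y. h x powr p * w x)
     \<le> (\<Sum>x\<in>Y. (\<Sum>k\<in>K. if pow2 k < h x then 2 powr p * 2 powr (p * real_of_int k) else 0) * w x)"
  proof (intro sum_mono mult_right_mono)
    fix x assume x: "x \<in> Y"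
    show "h x powr p \<le> (\<Sum>k\<in>K. if pow2 k < h x then 2 powr p * 2 powr (p * real_of_int k) else 0)"
    proof (cases "h x = 0")
      case False
      then have "h x > 0" using assms x by force
      with K(2)[OF x] obtain k where k: "k \<in> K" "pow2 k < h x" "h x \<le> 2 powr (real_of_int k + 1)" by blast
      have "h x powr p \<le> (2 powr (real_of_int k + 1)) powr p" using k assms x by (intro powr_mono2) auto
      also have "\<dots> = (if pow2 k < h x then 2 powr p * 2 powr (p * real_of_int k) else 0)"
        using k by (simp add: powr_powr powr_add[symmetric] algebra_simps)
      also have "\<dots> \<le> (\<Sum>k\<in>K. if pow2 k < h x then 2 powr p * 2 powr (p * real_of_int k) else 0)"
        by (rule member_le_sum) (use k K in auto)
      finally show ?thesis .
    qed (auto intro!: sum_nonneg)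
  qed (use assms in auto)
  also have "\<dots> = (\<Sum>x\<in>Y. \<Sum>k\<in>K. if pow2 k < h x then 2 powr p * 2 powr (p * real_of_int k) * w x else 0)"
    by (simp add: sum_distrib_right if_distrib[of "\<lambda>c. c * _"] cong: if_cong)
  also have "\<dots> = (\<Sum>k\<in>K. \<Sum>x\<in>Y. if pow2 k < h x then 2 powr p * 2 powr (p * real_of_int k) * w x else 0)"
    by (rule sum.swap)
  also have "\<dots> = (\<Sum>k\<in>K. \<Sum>x\<in>{x\<in>Y. pow2 k < h x}. 2 powr p * 2 powr (p * real_of_int k) * w x)"
    using assms by (intro sum.cong refl sum.inter_filter[symmetric])
  also have "\<dots> = 2 powr p * (\<Sum>k\<in>K. 2 powr (p * real_of_int k) * (\<Sum>x\<in>{x\<in>Y. pow2 k < h x}. w x))"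
    by (simp add: sum_distrib_left mult.assoc)
  finally show ?thesis using K by blast
qed

section \<open>Balls, the truncated maximal function and a covering lemma\<close>

context weighted_graph
begin

lemma center_in_ball: "0 \<le> r \<Longrightarrow> x \<in> B x r"
  by (simp add: mem_ball)

lemma volume_pos: "0 \<le> r \<Longrightarrow> 0 < V x r"
  unfolding volume_def using center_in_ball vertex_measure_pos
  by (intro sum_pos) auto

lemma ball_mono: "r \<le> s \<Longrightarrow> B x r \<subseteq> B x s"
  by (auto simp: mem_ball)

lemma volume_mono: "r \<le> s \<Longrightarrow> V x r \<le> V x s"
  unfolding volume_def by (intro sum_mono2 ball_mono) auto

abbreviation mass :: "('a \<Rightarrow> real) \<Rightarrow> 'a set \<Rightarrow> real" where
  "mass f S \<equiv> \<Sum>z\<in>S. \<bar>f z\<bar> * m z"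

text \<open>The radii are truncated at \<open>R\<close> so that the maximal function of a finitely supported function
  is finitely supported.\<close>

definition maxfun :: "nat \<Rightarrow> ('a \<Rightarrow> real) \<Rightarrow> 'a \<Rightarrow> real" where
  "maxfun R f x = Max ((\<lambda>r. mass f (B x (real r)) / V x (real r)) ` {..R})"

lemma ball_average_le_maxfun:
  assumes "r \<le> R"
  shows "mass f (B x (real r)) \<le> maxfun R f x * V x (real r)"
proof -
  have "mass f (B x (real r)) / V x (real r) \<le> maxfun R f x"
    unfolding maxfun_def using assms by (intro Max_ge) auto
  then show ?thesis using volume_pos[of "real r" x] by (simp add: field_simps)
qed

lemma maxfun_attained:
  "\<exists>r\<le>R. maxfun R f x * V x (real r) = mass f (B x (real r))"
proof -
  have "maxfun R f x \<in> (\<lambda>r. mass f (B x (real r)) / V x (real r)) ` {..R}"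
    unfolding maxfun_def by (rule Max_in) auto
  then obtain r where "r \<le> R" "maxfun R f x = mass f (B x (real r)) / V x (real r)" by auto
  then show ?thesis using volume_pos[of "real r" x] by (intro exI[of _ r]) auto
qed

lemma maxfun_nonneg: "0 \<le> maxfun R f x"
proof -
  obtain r where "maxfun R f x * V x (real r) = mass f (B x (real r))"
    using maxfun_attained by blast
  moreover have "0 \<le> mass f (B x (real r))" by (intro sum_nonneg) auto
  ultimately show ?thesis using volume_pos[of "real r" x] by (metis of_nat_0_le_iff zero_le_mult_iff not_less)
qed

lemma finite_maxfun_support:
  assumes "finite {x. f x \<noteq> 0}"
  shows "finite {x. maxfun R f x \<noteq> 0}"
proof -
  have "{x. maxfun R f x \<noteq> 0} \<subseteq> (\<Union>s\<in>{x. f x \<noteq> 0}. B s (real R))"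
  proof safe
    fix x assume "maxfun R f x \<noteq> 0"
    moreover obtain r where r: "r \<le> R" "maxfun R f x * V x (real r) = mass f (B x (real r))"
      using maxfun_attained by blast
    ultimately have "mass f (B x (real r)) \<noteq> 0" using volume_pos[of "real r" x] by auto
    then obtain z where "z \<in> B x (real r)" "f z \<noteq> 0" 
      by (auto elim!: sum.not_neutral_contains_not_neutral)
    moreover from this have "d z x \<le> R" using r(1) dist_sym[of z x] by (simp add: mem_ball)
    ultimately show "x \<in> (\<Union>s\<in>{x. f x \<noteq> 0}. B s (real R))" by (auto simp: mem_ball)
  qed
  then show ?thesis using assms finite_subset by blast
qed

text \<open>Finite support on an infinite vertex set. It keeps every sublevel set of the maximal
  function nonempty, so that distances to it make sense.\<close>

lemma exists_maxfun_zero: "finite {x. f x \<noteq> 0} \<Longrightarrow> \<exists>x. maxfun R f x = 0"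
  using finite_maxfun_support[of f R] infinite_vertices
  by (metis (mono_tags, lifting) ex_new_if_finite mem_Collect_eq)

text \<open>Greedy choice of the largest radius. Only centres have to be covered: if two balls meet,
  the smaller one's centre lies within the sum of the radii, hence within twice the larger.\<close>

lemma vitali:
  fixes r :: "'a \<Rightarrow> nat"
  assumes "finite S"
  shows "\<exists>T\<subseteq>S. (\<forall>x\<in>T. \<forall>y\<in>T. x \<noteq> y \<longrightarrow> B x (real (r x)) \<inter> B y (real (r y)) = {})
      \<and> (\<forall>y\<in>S. \<exists>x\<in>T. d x y \<le> 2 * r x)"
  using assms
proof (induction "card S" arbitrary: S rule: less_induct)
  case less
  show ?case
  proof (cases "S = {}")
    case False
    then have "Max (r ` S) \<in> r ` S" using less.prems by (intro Max_in) auto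
    then obtain x where x: "x \<in> S" "r x = Max (r ` S)" by auto
    then have rx: "r y \<le> r x" if "y \<in> S" for y using that less.prems by auto
    define S' where "S' = {y\<in>S. B y (real (r y)) \<inter> B x (real (r x)) = {}}"
    have "x \<in> B x (real (r x))" by (simp add: mem_ball)
    then have "x \<notin> S'" "S' \<subseteq> S" unfolding S'_def by blast+
    then have "S' \<subset> S" using x(1) by blast
    then have "card S' < card S" "finite S'" using less.prems by (auto intro: psubset_card_mono finite_subset)
    from less.hyps[OF this] obtain T where T: "T \<subseteq> S'"
      "\<forall>x\<in>T. \<forall>y\<in>T. x \<noteq> y \<longrightarrow> B x (real (r x)) \<inter> B y (real (r y)) = {}"
      "\<forall>y\<in>S'. \<exists>x\<in>T. d x y \<le> 2 * r x" by blast
    have "\<exists>z\<in>insert x T. d z y \<le> 2 * r z" if y: "y \<in> S" for y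
    proof (cases "y \<in> S'")
      case False
      then obtain z where "d y z \<le> r y" "d x z \<le> r x" using y by (auto simp: S'_def mem_ball)
      then show ?thesis using dist_triangle[of x y z] dist_sym[of y z] rx[OF y] by auto
    qed (use T in auto)
    moreover have "insert x T \<subseteq> S" using T(1) x by (auto simp: S'_def)
    moreover have "\<forall>y\<in>insert x T. \<forall>z\<in>insert x T. y \<noteq> z \<longrightarrow> B y (real (r y)) \<inter> B z (real (r z)) = {}"
      using T(1,2) unfolding S'_def by blast
    ultimately show ?thesis by blast
  qed auto
qed

end

section \<open>Weak and strong type bounds under doubling\<close>

locale doubling_graph = weighted_graph \<mu> for \<mu> :: "'a \<Rightarrow> 'a \<Rightarrow> real" +
  fixes C\<^sub>D :: real
  assumes CD_ge_1: "C\<^sub>D \<ge> 1" and volume_doubling: "r > 0 \<Longrightarrow> volume \<mu> x (2 * r) \<le> C\<^sub>D * volume \<mu> x r"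
begin

lemma maxfun_weak_type:
  assumes "finite S" "finite A" "{z. f z \<noteq> 0} \<subseteq> A" "c > 0" "\<And>x. x \<in> S \<Longrightarrow> c < maxfun R f x"
  shows "c * (\<Sum>x\<in>S. m x) \<le> C\<^sub>D * (\<Sum>z\<in>A. \<bar>f z\<bar> * m z)"
proof -
  have "\<forall>x. \<exists>r. maxfun R f x * V x (real r) = mass f (B x (real r))"
    using maxfun_attained by blast
  from choice[OF this] obtain r where
    r: "\<And>x. maxfun R f x * V x (real (r x)) = mass f (B x (real (r x)))" by blast
  obtain T where T: "T \<subseteq> S"
      "\<forall>x\<in>T. \<forall>y\<in>T. x \<noteq> y \<longrightarrow> B x (real (r x)) \<inter> B y (real (r y)) = {}"
      "\<forall>y\<in>S. \<exists>x\<in>T. d x y \<le> 2 * r x" 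
    using vitali[OF assms(1), of r] by (elim exE conjE) (rule that)
  have finT: "finite T" using T(1) assms(1) finite_subset by blast
  \<comment> \<open>\<open>volume_doubling\<close> speaks of positive radii; a ball of radius 0 is
    its own double.\<close>
  have D: "V x (2 * real (r x)) \<le> C\<^sub>D * V x (real (r x))" for x
  proof (cases "r x = 0")
    case True
    then show ?thesis using mult_right_mono[OF CD_ge_1, of "V x 0"] volume_pos[of 0 x] by simp
  next
    case False
    then show ?thesis by (intro volume_doubling) simp
  qed
  have "(\<Sum>x\<in>S. m x) \<le> (\<Sum>x\<in>(\<Union>x\<in>T. B x (2 * real (r x))). m x)"
  proof (rule sum_mono2)
    show "S \<subseteq> (\<Union>x\<in>T. B x (2 * real (r x)))"
    proof
      fix y assume "y \<in> S"
      then obtain x where "x \<in> T" "d x y \<le> 2 * r x" using T(3) by blast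
      then have "real (d x y) \<le> 2 * real (r x)" by linarith
      then show "y \<in> (\<Union>x\<in>T. B x (2 * real (r x)))" using \<open>x \<in> T\<close> mem_ball by blast
    qed
  qed (auto simp: finT)
  also have "\<dots> \<le> (\<Sum>x\<in>T. V x (2 * real (r x)))"
    unfolding volume_def by (rule sum_UNION_le) (auto simp: finT)
  also have "\<dots> \<le> (\<Sum>x\<in>T. C\<^sub>D * V x (real (r x)))" by (intro sum_mono D)
  finally have "c * (\<Sum>x\<in>S. m x) \<le> c * (\<Sum>x\<in>T. C\<^sub>D * V x (real (r x)))"
    using assms(4) by simp
  also have "\<dots> = C\<^sub>D * (\<Sum>x\<in>T. c * V x (real (r x)))" by (simp add: sum_distrib_left mult_ac)
  also have "(\<Sum>x\<in>T. c * V x (real (r x))) \<le> (\<Sum>x\<in>T. \<Sum>z\<in>B x (real (r x)). \<bar>f z\<bar> * m z)"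
    unfolding r[symmetric] using T(1) assms(5) volume_pos
    by (intro sum_mono mult_right_mono) (auto intro: less_imp_le)
  also have "\<dots> = (\<Sum>z\<in>(\<Union>x\<in>T. B x (real (r x))). \<bar>f z\<bar> * m z)"
    using T(2) by (intro sum.UNION_disjoint[symmetric]) (auto simp: finT)
  also have "\<dots> = (\<Sum>z\<in>(\<Union>x\<in>T. B x (real (r x))) \<inter> A. \<bar>f z\<bar> * m z)"
    using assms(3) by (intro sum.mono_neutral_right) (auto simp: finT)
  also have "\<dots> \<le> (\<Sum>z\<in>A. \<bar>f z\<bar> * m z)" by (rule sum_mono2) (auto simp: assms(2))
  finally show ?thesis using CD_ge_1 by simp
qed

text \<open>Values of |f| up to c / 2 raise an average by at most c / 2, so the remaining values
  must already have an average above c / 2 at each x.\<close>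

lemma maxfun_weak_type_truncated:
  assumes "finite S" "finite A" "{z. f z \<noteq> 0} \<subseteq> A" "c > 0" "\<And>x. x \<in> S \<Longrightarrow> c < maxfun R f x"
  shows "c * (\<Sum>x\<in>S. m x) \<le> 2 * C\<^sub>D * (\<Sum>z\<in>{z\<in>A. c < 2 * \<bar>f z\<bar>}. \<bar>f z\<bar> * m z)"
proof -
  let ?g = "\<lambda>z. if c < 2 * \<bar>f z\<bar> then f z else 0"
  have "c / 2 < maxfun R ?g x" if "x \<in> S" for x
  proof -
    obtain r where r: "r \<le> R" "maxfun R f x * V x (real r) = mass f (B x (real r))"
      using maxfun_attained by blast
    have V: "V x (real r) > 0" by (simp add: volume_pos)
    have "c * V x (real r) < mass f (B x (real r))"
      using assms(5)[OF that] V r by (simp flip: r(2))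
    also have "\<dots> \<le> (\<Sum>z\<in>B x (real r). \<bar>?g z\<bar> * m z + c / 2 * m z)"
    proof (rule sum_mono)
      fix z
      have "\<bar>f z\<bar> \<le> \<bar>?g z\<bar> + c / 2" using assms(4) by auto
      from mult_right_mono[OF this, of "m z"]
      show "\<bar>f z\<bar> * m z \<le> \<bar>?g z\<bar> * m z + c / 2 * m z" by (simp only: distrib_right m_nonneg)
    qed
    also have "\<dots> = (\<Sum>z\<in>B x (real r). \<bar>?g z\<bar> * m z) + c / 2 * V x (real r)"
      by (simp add: sum.distrib volume_def sum_distrib_left)
    also have "\<dots> \<le> maxfun R ?g x * V x (real r) + c / 2 * V x (real r)"
      using ball_average_le_maxfun[OF r(1), where f = ?g and x = x] by simp
    finally have "c / 2 * V x (real r) < maxfun R ?g x * V x (real r)" by (simp add: field_simps)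
    then show ?thesis using V by simp
  qed
  then have "c / 2 * (\<Sum>x\<in>S. m x) \<le> C\<^sub>D * (\<Sum>z\<in>A. \<bar>?g z\<bar> * m z)"
    using assms by (intro maxfun_weak_type[where f = ?g and R = R]) auto
  also have "(\<Sum>z\<in>A. \<bar>?g z\<bar> * m z) = (\<Sum>z\<in>{z\<in>A. c < 2 * \<bar>f z\<bar>}. \<bar>f z\<bar> * m z)"
    using assms(2) by (intro sum.mono_neutral_cong_right) auto
  finally show ?thesis by simp
qed

text \<open>Marcinkiewicz interpolation over dyadic levels. After exchanging the sums, a fixed z
  meets only levels below 2 |f z|, with weights 2^((p - 1) k) that are summable downwards because p
  > 1.\<close>

theorem maxfun_strong_type:
  assumes "1 < p"
  shows "\<exists>C>0. \<forall>f R Y A. finite Y \<longrightarrow> finite A \<longrightarrow> {z. f z \<noteq> 0} \<subseteq> A \<longrightarrow>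
     (\<Sum>x\<in>Y. maxfun R f x powr p * m x) \<le> C * (\<Sum>z\<in>A. \<bar>f z\<bar> powr p * m z)"
proof -
  let ?q = "1 - 2 powr (- (p - 1)) :: real"
  have q: "?q > 0" using assms by (simp add: powr_less_one)
  define C where "C = 2 powr p * (2 * C\<^sub>D * (2 powr (p - 1) / ?q))"
  have "C > 0" unfolding C_def using q CD_ge_1 by (intro mult_pos_pos divide_pos_pos) auto
  moreover have "(\<Sum>x\<in>Y. maxfun R f x powr p * m x) \<le> C * (\<Sum>z\<in>A. \<bar>f z\<bar> powr p * m z)"
    if fin: "finite Y" "finite A" and supp: "{z. f z \<noteq> 0} \<subseteq> A" for f R Y A
  proof -
    let ?A = "\<lambda>k z. if pow2 k < 2 * \<bar>f z\<bar> then 2 * C\<^sub>D * (\<bar>f z\<bar> * m z) * 2 powr ((p - 1) * real_of_int k) else 0"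
    obtain K :: "int set" where K: "finite K" and le: "(\<Sum>x\<in>Y. maxfun R f x powr p * m x)
       \<le> 2 powr p * (\<Sum>k\<in>K. 2 powr (p * real_of_int k) * (\<Sum>x\<in>{x\<in>Y. pow2 k < maxfun R f x}. m x))"
      using dyadic_layer_cake[OF fin(1), of p "maxfun R f" m] assms maxfun_nonneg by auto
    have "(\<Sum>k\<in>K. 2 powr (p * real_of_int k) * (\<Sum>x\<in>{x\<in>Y. pow2 k < maxfun R f x}. m x))
       \<le> (\<Sum>k\<in>K. 2 powr ((p - 1) * real_of_int k) * (2 * C\<^sub>D * (\<Sum>z\<in>{z\<in>A. pow2 k < 2 * \<bar>f z\<bar>}. \<bar>f z\<bar> * m z)))"
    proof (rule sum_mono)
      fix k
      let ?S = "{x\<in>Y. pow2 k < maxfun R f x}"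
      have "2 powr (p * real_of_int k) * (\<Sum>x\<in>?S. m x) = 2 powr ((p - 1) * real_of_int k) * (pow2 k * (\<Sum>x\<in>?S. m x))"
        by (simp add: powr_add[symmetric] algebra_simps)
      also have "\<dots> \<le> 2 powr ((p - 1) * real_of_int k) * (2 * C\<^sub>D * (\<Sum>z\<in>{z\<in>A. pow2 k < 2 * \<bar>f z\<bar>}. \<bar>f z\<bar> * m z))"
        using fin supp by (intro mult_left_mono maxfun_weak_type_truncated[where f = f and R = R]) auto
      finally show "2 powr (p * real_of_int k) * (\<Sum>x\<in>?S. m x) \<le> \<dots>" .
    qed
    also have "\<dots> = (\<Sum>k\<in>K. \<Sum>z\<in>A. ?A k z)"
      using fin by (intro sum.cong refl)
        (simp add: sum_distrib_left mult_ac sum.inter_filter[symmetric])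
    also have "\<dots> = (\<Sum>z\<in>A. \<Sum>k\<in>K. ?A k z)"
      by (rule sum.swap)
    also have "\<dots> \<le> (\<Sum>z\<in>A. 2 * C\<^sub>D * (2 powr (p - 1) / ?q) * (\<bar>f z\<bar> powr p * m z))"
    proof (rule sum_mono)
      fix z
      show "(\<Sum>k\<in>K. ?A k z)
        \<le> 2 * C\<^sub>D * (2 powr (p - 1) / ?q) * (\<bar>f z\<bar> powr p * m z)"
      proof (cases "f z = 0")
        case False
        have "(\<Sum>k\<in>K. ?A k z)
          = 2 * C\<^sub>D * (\<bar>f z\<bar> * m z) * (\<Sum>k\<in>{k\<in>K. pow2 k < 2 * \<bar>f z\<bar>}. 2 powr ((p - 1) * real_of_int k))"
          using K by (simp add: sum.inter_filter[symmetric] sum_distrib_left)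
        also have "(\<Sum>k\<in>{k\<in>K. pow2 k < 2 * \<bar>f z\<bar>}. 2 powr ((p - 1) * real_of_int k))
           \<le> (\<Sum>k\<in>{k\<in>K. pow2 k \<le> 2 * \<bar>f z\<bar>}. 2 powr ((p - 1) * real_of_int k))"
          using K by (intro sum_mono2) auto
        also have "\<dots> \<le> (2 * \<bar>f z\<bar>) powr (p - 1) / ?q"
          using K assms False by (intro sum_dyadic_le) auto
        also have "2 * C\<^sub>D * (\<bar>f z\<bar> * m z) * ((2 * \<bar>f z\<bar>) powr (p - 1) / ?q)
          = 2 * C\<^sub>D * (2 powr (p - 1) / ?q) * ((\<bar>f z\<bar> * \<bar>f z\<bar> powr (p - 1)) * m z)"
          by (simp add: powr_mult)
        also have "\<bar>f z\<bar> * \<bar>f z\<bar> powr (p - 1) = \<bar>f z\<bar> powr p"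
          using False by (simp add: powr_mult_base)
        finally show ?thesis using CD_ge_1 by (simp add: mult_left_mono)
      qed auto
    qed
    also have "\<dots> = 2 * C\<^sub>D * (2 powr (p - 1) / ?q) * (\<Sum>z\<in>A. \<bar>f z\<bar> powr p * m z)"
      by (simp only: sum_distrib_left)
    finally have "2 powr p * (\<Sum>k\<in>K. 2 powr (p * real_of_int k) * (\<Sum>x\<in>{x\<in>Y. pow2 k < maxfun R f x}. m x))
      \<le> C * (\<Sum>z\<in>A. \<bar>f z\<bar> powr p * m z)"
      unfolding C_def mult.assoc by (intro mult_left_mono) auto
    then show ?thesis using le by linarith
  qed
  ultimately show ?thesis by blast
qed

end

section \<open>Heat kernel bounds\<close>

context weighted_graph
begin

lemma inside_mono: "inside Y u \<Longrightarrow> Y \<subseteq> Y' \<Longrightarrow> finite Y' \<Longrightarrow> inside Y' u"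
  unfolding inside_def by blast

text \<open>Self-adjointness with respect to m. Only u needs its support inside \<open>Y\<close>; w
  is arbitrary, as needed when w is a squared increment.\<close>

lemma P_symmetric:
  assumes "inside Y u"
  shows "(\<Sum>x\<in>Y. P u x * w x * m x) = (\<Sum>x\<in>Y. u x * P w x * m x)"
proof -
  have "(\<Sum>x\<in>Y. P u x * w x * m x) = (\<Sum>x\<in>Y. w x * (\<Sum>y\<in>Y. \<mu> x y * u y))"
  proof (rule sum.cong[OF refl])
    fix x assume "x \<in> Y"
    then have "m x * P u x = (\<Sum>y\<in>Y. \<mu> x y * u y)"
      unfolding m_times_P by (intro sum_neighbours[OF assms])
    then show "P u x * w x * m x = w x * (\<Sum>y\<in>Y. \<mu> x y * u y)" by (simp add: mult_ac)
  qed
  also have "\<dots> = (\<Sum>x\<in>Y. \<Sum>y\<in>Y. w x * (\<mu> x y * u y))" by (simp add: sum_distrib_left)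
  also have "\<dots> = (\<Sum>y\<in>Y. \<Sum>x\<in>Y. w x * (\<mu> x y * u y))" by (rule sum.swap)
  also have "\<dots> = edge_sum Y (\<lambda>x y. u x * w y)"
    by (intro sum.cong refl) (simp add: weight_sym mult_ac)
  also have "\<dots> = (\<Sum>x\<in>Y. u x * P w x * m x)"
  proof (rule sum.cong[OF refl])
    fix x assume x: "x \<in> Y"
    have "u x * P w x * m x = u x * (m x * P w x)" by simp
    also have "\<dots> = (\<Sum>y | adj \<mu> x y. \<mu> x y * (u x * w y))"
      unfolding m_times_P by (simp add: sum_distrib_left mult_ac)
    also have "\<dots> = (\<Sum>y\<in>Y. \<mu> x y * (u x * w y))" by (rule sum_neighbours[OF assms x]) auto
    finally show "(\<Sum>y\<in>Y. \<mu> x y * (u x * w y)) = u x * P w x * m x" by simp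
  qed
  finally show ?thesis .
qed

lemma P_pow_symmetric:
  assumes "\<And>l. l < k \<Longrightarrow> inside Y ((P ^^ l) u)"
  shows "(\<Sum>x\<in>Y. (P ^^ k) u x * w x * m x) = (\<Sum>x\<in>Y. u x * (P ^^ k) w x * m x)"
  using assms
proof (induction k arbitrary: w)
  case (Suc k)
  have "(\<Sum>x\<in>Y. (P ^^ Suc k) u x * w x * m x) = (\<Sum>x\<in>Y. (P ^^ k) u x * P w x * m x)"
    using P_symmetric[of Y "(P ^^ k) u" w] Suc.prems by simp
  also have "\<dots> = (\<Sum>x\<in>Y. u x * (P ^^ k) (P w) x * m x)"
    using Suc.prems by (intro Suc.IH) auto
  finally show ?case by (simp add: funpow_swap1)
qed simp

text \<open>The kernel p_k(y, x) / m(x): as a density with respect to m it is symmetric in x and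
  y.\<close>

definition heat :: "'a \<Rightarrow> nat \<Rightarrow> 'a \<Rightarrow> real" where
  "heat x k = (P ^^ k) (\<lambda>z. if z = x then 1 / m x else 0)"

lemma heat_0: "heat x 0 = (\<lambda>z. if z = x then 1 / m x else 0)"
  by (simp add: heat_def)

lemma heat_Suc: "heat x (Suc k) = P (heat x k)"
  by (simp add: heat_def)

lemma heat_add: "heat x (k + l) = (P ^^ l) (heat x k)"
  by (simp add: heat_def funpow_add add.commute[of k l])

lemma heat_nonneg: "0 \<le> heat x k y"
  unfolding heat_def by (rule P_pow_nonneg) auto

lemma heat_support: "heat x k y \<noteq> 0 \<Longrightarrow> d y x \<le> k"
  using P_pow_eq_0[of y k "\<lambda>z. if z = x then 1 / m x else 0"] unfolding heat_def
  by (metis (no_types, lifting))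

lemma heat_inside: "\<exists>Y. finite Y \<and> K \<subseteq> Y \<and> (\<forall>x\<in>K. \<forall>l\<le>L. inside Y (heat x l))" if "finite K"
proof -
  have "\<forall>x. \<exists>Y. finite Y \<and> K \<subseteq> Y \<and> (\<forall>l\<le>L. inside Y (heat x l))"
    using exists_inside[of "\<lambda>z. if z = _ then 1 / m _ else 0", OF _ that] unfolding heat_def by simp
  from choice[OF this] obtain Y where
    Y: "\<forall>x. finite (Y x) \<and> K \<subseteq> Y x \<and> (\<forall>l\<le>L. inside (Y x) (heat x l))" by blast
  have "finite (K \<union> (\<Union>x\<in>K. Y x))" using that Y by auto
  moreover have "inside (K \<union> (\<Union>x\<in>K. Y x)) (heat x l)" if "x \<in> K" "l \<le> L" for x l
    using Y that by (intro inside_mono[of "Y x", OF _ _ calculation]) auto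
  ultimately show ?thesis by blast
qed

text \<open>Chapman-Kolmogorov for densities: moving the j steps starting at y over to the other
  factor leaves a point mass at y.\<close>

lemma heat_convolution:
  assumes "\<And>l. l \<le> i + j \<Longrightarrow> inside Y (heat x l)"
  shows "(\<Sum>z\<in>Y. heat x i z * heat y j z * m z) = heat x (i + j) y"
proof -
  have fin: "finite Y" using assms[of 0] by (simp add: inside_def)
  have "(\<Sum>z\<in>Y. heat x i z * heat y j z * m z) = (\<Sum>z\<in>Y. (P ^^ j) (heat x i) z * heat y 0 z * m z)"
    unfolding heat_def[of y] funpow_0
    by (rule P_pow_symmetric[symmetric]) (use assms in \<open>simp add: heat_add[symmetric]\<close>)
  also have "\<dots> = (\<Sum>z\<in>Y. if z = y then heat x (i + j) y else 0)"
    unfolding heat_add by (intro sum.cong refl) (simp add: heat_0)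
  also have "\<dots> = heat x (i + j) y"
    using assms[of "i + j"] fin by (auto simp: inside_def)
  finally show ?thesis .
qed


lemma P_pow_eq_heat_sum:
  assumes "finite A" "{z. f z \<noteq> 0} \<subseteq> A"
  shows "(P ^^ k) f y = (\<Sum>z\<in>A. f z * m z * heat z k y)"
proof -
  have "f = (\<lambda>y. \<Sum>z\<in>A. (f z * m z) * heat z 0 y)"
  proof
    fix y
    have "(\<Sum>z\<in>A. (f z * m z) * heat z 0 y) = (\<Sum>z\<in>A. if y = z then f z else 0)"
      by (intro sum.cong refl) (simp add: heat_0)
    then show "f y = (\<Sum>z\<in>A. (f z * m z) * heat z 0 y)" using assms by auto
  qed
  then have "(P ^^ k) f = (P ^^ k) (\<lambda>y. \<Sum>z\<in>A. (f z * m z) * heat z 0 y)" by simp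
  then show ?thesis using assms(1) by (simp add: P_pow_sum P_pow_scale heat_def)
qed

lemma transition_iter_eq: "transition_iter \<mu> k y x = (P ^^ k) (\<lambda>z. if z = x then 1 else 0) y"
proof (induction k arbitrary: y)
  case (Suc k)
  have "transition_iter \<mu> (Suc k) y x
      = (\<Sum>\<^sub>\<infinity>z\<in>{z. adj \<mu> y z}. transition \<mu> y z * transition_iter \<mu> k z x)"
    unfolding transition_iter.simps
    by (rule infsum_cong_neutral) (auto simp: transition_def weight_zero)
  also have "\<dots> = (\<Sum>z | adj \<mu> y z. transition \<mu> y z * transition_iter \<mu> k z x)"
    by (rule infsum_finite) auto
  also have "\<dots> = P (\<lambda>z. transition_iter \<mu> k z x) y"
    by (simp add: P_def transition_def sum_divide_distrib)
  finally show ?case using Suc by (simp add: fun_eq_iff)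
qed auto

lemma heat_eq_transition_iter: "heat x k y = transition_iter \<mu> k y x / m x"
proof -
  have "heat x k = (P ^^ k) (\<lambda>z. 1 / m x * (if z = x then 1 else 0))"
    unfolding heat_def by (rule arg_cong[of _ _ "P ^^ k"]) auto
  then show ?thesis unfolding P_pow_scale transition_iter_eq by simp
qed

end

context doubling_graph
begin

text \<open>An integer bound for the growth exponent; being at least 1, it meets the side condition
  of \<open>one_plus_power_le_exp\<close> at each use.\<close>

definition volume_exponent :: nat where
  "volume_exponent = (SOME D. 1 \<le> D \<and> C\<^sub>D \<le> 2 ^ D)"

abbreviation D :: nat where "D \<equiv> volume_exponent"

lemma volume_exponent: "1 \<le> D" "C\<^sub>D \<le> 2 ^ D"
proof -
  obtain n where "C\<^sub>D < 2 ^ n" using real_arch_pow[of 2 C\<^sub>D] by auto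
  also have "(2::real) ^ n \<le> 2 ^ max 1 n" by (intro power_increasing) auto
  finally have "1 \<le> max 1 n \<and> C\<^sub>D \<le> 2 ^ max 1 n" by simp
  then have "1 \<le> D \<and> C\<^sub>D \<le> 2 ^ D" unfolding volume_exponent_def by (rule someI)
  then show "1 \<le> D" "C\<^sub>D \<le> 2 ^ D" by auto
qed

text \<open>Doubling iterated about log2 (s / r) times; the factor 2 pays for rounding that number
  up.\<close>

lemma volume_growth:
  assumes "0 < r" "r \<le> s"
  shows "V x s \<le> (2 * (s / r)) ^ D * V x r"
proof -
  have iter: "V x (2 ^ j * r) \<le> C\<^sub>D ^ j * V x r" for j
  proof (induction j)
    case (Suc j)
    have "V x (2 ^ Suc j * r) \<le> C\<^sub>D * V x (2 ^ j * r)"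
      using volume_doubling[of "2 ^ j * r" x] assms(1) by (simp add: mult_ac)
    also have "\<dots> \<le> C\<^sub>D * (C\<^sub>D ^ j * V x r)" using Suc CD_ge_1 by (intro mult_left_mono) auto
    finally show ?case by (simp add: mult_ac)
  qed simp
  define j where "j = nat \<lceil>log 2 (s / r)\<rceil>"
  have sr: "1 \<le> s / r" using assms by simp
  then have "real j = real_of_int \<lceil>log 2 (s / r)\<rceil>"
    unfolding j_def by (intro of_nat_nat) (simp add: le_ceiling_iff less_le_trans[of _ 0])
  then have j: "log 2 (s / r) \<le> real j" "real j \<le> log 2 (s / r) + 1" by linarith+
  have l: "2 powr log 2 (s / r) = s / r" using sr by simp
  have "s / r \<le> 2 powr real j" using powr_mono[OF j(1), of 2] l by simp
  then have "s \<le> 2 ^ j * r" using assms by (simp add: powr_realpow field_simps)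
  then have "V x s \<le> C\<^sub>D ^ j * V x r" using volume_mono iter order_trans by blast
  also have "C\<^sub>D ^ j \<le> (2 ^ D) ^ j" using CD_ge_1 volume_exponent(2) by (intro power_mono) auto
  also have "(2 ^ D) ^ j = ((2::real) ^ j) ^ D" by (simp flip: power_mult add: mult.commute)
  also have "\<dots> \<le> (2 * (s / r)) ^ D"
  proof (intro power_mono)
    have "2 powr real j \<le> 2 powr (log 2 (s / r) + 1)" using j(2) by (intro powr_mono) auto
    also have "\<dots> = 2 * (s / r)" using l by (simp add: powr_add)
    finally show "2 ^ j \<le> 2 * (s / r)" by (simp add: powr_realpow)
  qed auto
  finally show ?thesis using volume_pos[of r x] assms(1) by (simp add: mult_right_mono)
qed

end

text \<open>Discrete derivative of n^(-1/2), with 1/4 in place of 1/2 to absorb the discretisation.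
  It is what makes the exponential weight decrease in time.\<close>

lemma sqrt_reciprocal_gap:
  fixes n :: real
  assumes "n \<ge> 1"
  shows "1 / sqrt (n + 1) \<le> 1 / sqrt n - 1 / (4 * n * sqrt n)"
proof -
  define a b where "a = sqrt n" "b = sqrt (n + 1)"
  have ab: "1 \<le> a" "a \<le> b" "a * a = n" "b * b = n + 1" using assms by (auto simp: a_b_def)
  have "b * b - a * a = 1" using ab by simp
  then have 1: "(b - a) * (a + b) = 1" by (simp add: algebra_simps)
  have 2: "b * (a + b) \<le> 4 * (a * a)"
  proof -
    have "b * (a + b) \<le> b * (b + b)" using ab by (intro mult_left_mono) auto
    also have "\<dots> = 2 * (n + 1)" using ab(4) by simp
    also have "\<dots> \<le> 4 * (a * a)" using ab(3) assms by simp
    finally show ?thesis .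
  qed
  have pos: "0 < a" "0 < b" using ab by auto
  have "1 / a - 1 / b = (b - a) / (a * b)" using pos by (simp add: field_simps)
  also have "b - a = 1 / (a + b)" using 1 pos by (simp add: field_simps)
  also have "1 / (a + b) / (a * b) = 1 / (a * (b * (a + b)))" by (simp add: mult_ac)
  also have "\<dots> \<ge> 1 / (a * (4 * (a * a)))"
    using 2 pos by (intro divide_left_mono mult_left_mono) auto
  also have "a * (4 * (a * a)) = 4 * n * a" using ab(3) by (simp add: mult_ac)
  finally show ?thesis by (simp add: a_b_def)
qed

lemma exp_minus_one_le: "0 \<le> t \<Longrightarrow> exp t - 1 \<le> t * exp t" for t :: real
proof -
  have "1 + - t \<le> exp (- t)" by (rule exp_ge_add_one_self)
  then have "exp t * (1 - t) \<le> exp t * exp (- t)" by (intro mult_left_mono) auto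
  then show ?thesis by (simp add: exp_minus algebra_simps)
qed

text \<open>Absorbs polynomial volume growth into a chosen fraction c of an exponential: apply 1 + t
  \<le> exp t with t = c s / k and raise to the power k.\<close>

lemma one_plus_power_le_exp:
  fixes s c :: real
  assumes "0 \<le> s" "0 < c" "1 \<le> real k / c"
  shows "(1 + s) ^ k \<le> (real k / c) ^ k * exp (c * s)"
proof -
  have k: "real k > 0" using assms by (cases k) auto
  have "1 + s \<le> real k / c * (1 + c * s / real k)" using assms k by (simp add: field_simps)
  also have "\<dots> \<le> real k / c * exp (c * s / real k)"
    using assms by (intro mult_left_mono exp_ge_add_one_self) auto
  finally have "(1 + s) ^ k \<le> (real k / c * exp (c * s / real k)) ^ k"
    using assms by (intro power_mono) auto
  also have "\<dots> = (real k / c) ^ k * exp (c * s)"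
    unfolding power_mult_distrib exp_of_nat_mult[symmetric] using k by simp
  finally show ?thesis .
qed

section \<open>L2 decay of the heat kernel in exponential weights\<close>

locale heat_graph = lazy_graph \<mu> \<alpha> + doubling_graph \<mu> C\<^sub>D
  for \<mu> :: "'a \<Rightarrow> 'a \<Rightarrow> real" and \<alpha> C\<^sub>D :: real +
  fixes C\<^sub>U :: real
  assumes CU_pos: "C\<^sub>U > 0"
    and on_diagonal: "k \<ge> 1 \<Longrightarrow> transition_iter \<mu> k x x \<le> C\<^sub>U * vertex_measure \<mu> x / volume \<mu> x (sqrt (real k))"
begin

definition heat_L2_const :: real where "heat_L2_const = max C\<^sub>U C\<^sub>D"

lemma heat_L2_const_pos: "0 < heat_L2_const"
  using CU_pos by (simp add: heat_L2_const_def)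

text \<open>By convolution the squared norm is the diagonal value at time 2 k, to which (DUE)
  applies. Time 0 is treated apart: the ball of radius 1/2 is {x}, and one doubling compares m x
  with V x 1, hence the maximum in \<open>heat_L2_const\<close>.\<close>

lemma heat_L2:
  assumes "\<And>l. l \<le> 2 * k \<Longrightarrow> inside Y (heat x l)"
  shows "(\<Sum>z\<in>Y. (heat x k z)^2 * m z) \<le> heat_L2_const / V x (sqrt (real (Suc k)))"
proof -
  have "(\<Sum>z\<in>Y. (heat x k z)^2 * m z) = heat x (2 * k) x"
    using heat_convolution[of k k Y x x] assms by (simp add: power2_eq_square mult_2)
  also have "\<dots> = transition_iter \<mu> (2 * k) x x / m x" by (rule heat_eq_transition_iter)
  also have "\<dots> \<le> heat_L2_const / V x (sqrt (real (Suc k)))"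
  proof (cases "k = 0")
    case True
    have "V x 1 \<le> C\<^sub>D * V x (1 / 2)" using volume_doubling[of "1 / 2" x] by simp
    also have "B x (1 / 2) = {x}"
    proof (intro equalityI subsetI)
      fix y assume "y \<in> B x (1 / 2)"
      then have "d x y < 1" unfolding mem_ball by linarith
      then show "y \<in> {x}" by simp
    qed (simp add: mem_ball)
    then have "V x (1 / 2) = m x" by (simp add: volume_def)
    finally have "V x 1 \<le> heat_L2_const * m x"
      using mult_right_mono[of C\<^sub>D heat_L2_const "m x"] by (simp add: heat_L2_const_def)
    then show ?thesis using True volume_pos[of 1 x] vertex_measure_pos[of x] by (simp add: field_simps)
  next
    case False
    have "transition_iter \<mu> (2 * k) x x \<le> C\<^sub>U * m x / V x (sqrt (real (2 * k)))"
      using False by (intro on_diagonal) auto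
    then have "transition_iter \<mu> (2 * k) x x / m x \<le> C\<^sub>U / V x (sqrt (real (2 * k)))"
      using vertex_measure_pos[of x] by (simp add: field_simps)
    also have "\<dots> \<le> heat_L2_const / V x (sqrt (real (Suc k)))"
      using False CU_pos by (intro frac_le volume_mono volume_pos) (auto simp: heat_L2_const_def)
    finally show ?thesis .
  qed
  finally show ?thesis .
qed

text \<open>The exponential decreases in n far from x. Each step adds near x a source comparable to
  N^D / V x (sqrt N), N being the final time; the prefactor n^(D + 1) is what N such sources amount
  to.\<close>

definition gauss_weight :: "'a \<Rightarrow> real \<Rightarrow> 'a \<Rightarrow> real" where
  "gauss_weight x n y = n ^ Suc D * exp (real (d x y) / sqrt n)"

text \<open>D + 1 from the growth of the power prefactor, 2 / \<alpha> from the gradient error in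
  Caccioppoli.\<close>

definition weight_rate :: real where "weight_rate = real (Suc D) + 2 / \<alpha>"

lemma weight_rate_pos: "weight_rate > 0"
  using alpha_pos by (simp add: weight_rate_def add_pos_pos)

text \<open>Far from \<open>x\<close> the decay of the exponential in time beats both the growth of its power factor
  and the gradient error in the Caccioppoli inequality.\<close>

lemma gauss_weight_step:
  assumes "n \<ge> 1"
  shows "gauss_weight x (n + 1) y * (1 + 2 / (\<alpha> * (n + 1)))
    \<le> gauss_weight x n y + weight_rate * exp (5 * weight_rate) * n ^ D"
proof -
  define s where "s = real (d x y) / sqrt n"
  let ?\<beta> = "weight_rate"
  have s: "0 \<le> s" using assms by (simp add: s_def)
  have n: "n > 0" using assms by simp
  have "(1 + 1 / n) ^ Suc D \<le> exp (1 / n) ^ Suc D"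
    using n by (intro power_mono exp_ge_add_one_self) auto
  also have "\<dots> = exp (real (Suc D) / n)" by (simp only: exp_of_nat_mult[symmetric]) simp
  finally have "n ^ Suc D * (1 + 1 / n) ^ Suc D \<le> n ^ Suc D * exp (real (Suc D) / n)"
    using n by (intro mult_left_mono) auto
  moreover have "n ^ Suc D * (1 + 1 / n) ^ Suc D = (n + 1) ^ Suc D"
  proof -
    have "n * (1 + 1 / n) = n + 1" using n by (simp add: field_simps)
    then show ?thesis by (simp only: power_mult_distrib[symmetric])
  qed
  ultimately have 1: "(n + 1) ^ Suc D \<le> n ^ Suc D * exp (real (Suc D) / n)" by simp
  have "real (d x y) * (1 / sqrt (n + 1)) \<le> real (d x y) * (1 / sqrt n - 1 / (4 * n * sqrt n))"
    using sqrt_reciprocal_gap[OF assms] by (intro mult_left_mono) auto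
  also have "\<dots> = s - s / (4 * n)" by (simp add: s_def right_diff_distrib)
  finally have 2: "real (d x y) / sqrt (n + 1) \<le> s - s / (4 * n)" by simp
  have 3: "1 + 2 / (\<alpha> * (n + 1)) \<le> exp (2 / \<alpha> / n)"
  proof -
    have "2 / (\<alpha> * (n + 1)) \<le> 2 / (\<alpha> * n)"
      using n alpha_pos by (intro divide_left_mono mult_left_mono) auto
    also have "1 + \<dots> \<le> exp (2 / (\<alpha> * n))" by (rule exp_ge_add_one_self)
    finally show ?thesis by simp
  qed
  have "gauss_weight x (n + 1) y * (1 + 2 / (\<alpha> * (n + 1)))
     \<le> (n ^ Suc D * exp (real (Suc D) / n) * exp (s - s / (4 * n))) * exp (2 / \<alpha> / n)"
    unfolding gauss_weight_def using 1 2 3 n alpha_pos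
    by (intro mult_mono) auto
  also have "\<dots> = n ^ Suc D * exp s * exp ((?\<beta> - s / 4) / n)"
    using n by (simp add: weight_rate_def exp_add[symmetric] exp_diff[symmetric] mult.assoc)
      (simp add: field_simps)
  also have "\<dots> \<le> n ^ Suc D * exp s + ?\<beta> * exp (5 * ?\<beta>) * n ^ D"
  \<comment> \<open>Beyond s = 4 \<beta> the gain s / (4 n) beats the loss \<beta> / n. Below it exp
    s is at most exp (4 \<beta>), and bounding the factor of loss costs one more exp
    \<beta>.\<close>
  proof (cases "s \<ge> 4 * ?\<beta>")
    case True
    then have "exp ((?\<beta> - s / 4) / n) \<le> 1" using n by (simp add: divide_nonpos_pos)
    then have "n ^ Suc D * exp s * exp ((?\<beta> - s / 4) / n) \<le> n ^ Suc D * exp s * 1"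
      using n by (intro mult_left_mono) auto
    moreover have "0 \<le> ?\<beta> * exp (5 * ?\<beta>) * n ^ D" using n weight_rate_pos by simp
    ultimately show ?thesis by linarith
  next
    case False
    have "exp ((?\<beta> - s / 4) / n) \<le> exp (?\<beta> / n)" using n s by (simp add: divide_right_mono)
    also have "\<dots> \<le> 1 + ?\<beta> / n * exp (?\<beta> / n)"
      using exp_minus_one_le[of "?\<beta> / n"] n weight_rate_pos by simp
    also have "exp (?\<beta> / n) \<le> exp ?\<beta>" using assms weight_rate_pos by (simp add: field_simps)
    finally have "exp ((?\<beta> - s / 4) / n) \<le> 1 + ?\<beta> / n * exp ?\<beta>"
      using n weight_rate_pos by (simp add: mult_left_mono divide_right_mono)
    then have "n ^ Suc D * exp s * exp ((?\<beta> - s / 4) / n) \<le> n ^ Suc D * exp s * (1 + ?\<beta> / n * exp ?\<beta>)"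
      using n by (intro mult_left_mono) auto
    also have "\<dots> = n ^ Suc D * exp s + n ^ D * ?\<beta> * (exp s * exp ?\<beta>)"
      using n by (simp add: field_simps)
    also have "exp s * exp ?\<beta> \<le> exp (5 * ?\<beta>)"
      using False by (simp add: exp_add[symmetric])
    finally show ?thesis using n weight_rate_pos by (simp add: mult_left_mono mult_ac)
  qed
  finally show ?thesis by (simp add: gauss_weight_def s_def)
qed

text \<open>The square root is again an exponential of the distance, of rate r = 1 / (2 sqrt n). One
  edge changes the exponent by at most r, hence the value by a relative amount of at most 2 r, and
  (2 r)^2 = 1 / n.\<close>

lemma gauss_weight_gradient:
  assumes "n \<ge> 1" "adj \<mu> y z"
  shows "(sqrt (gauss_weight x n y) - sqrt (gauss_weight x n z))^2 \<le> gauss_weight x n y / n"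
proof -
  define r where "r = 1 / (2 * sqrt n)"
  define \<eta> where "\<eta> = (\<lambda>y. sqrt (n ^ Suc D) * exp (r * real (d x y)))"
  have n: "n > 0" using assms by simp
  have eta: "sqrt (gauss_weight x n y) = \<eta> y" for y
  proof -
    have "(\<eta> y)^2 = gauss_weight x n y"
    proof -
      have "(exp (r * real (d x y)))^2 = exp (real (d x y) / sqrt n)"
        using n by (simp add: r_def flip: exp_double)
      then show ?thesis using n by (simp add: \<eta>_def gauss_weight_def power_mult_distrib)
    qed
    moreover have "0 \<le> \<eta> y" using n by (simp add: \<eta>_def)
    ultimately show ?thesis using real_sqrt_unique by blast
  qed
  have r: "0 < r" "r \<le> 1 / 2" using assms by (auto simp: r_def field_simps)
  define t where "t = r * (real (d x z) - real (d x y))"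
  have "\<bar>real (d x z) - real (d x y)\<bar> \<le> 1"
    using dist_adj[OF assms(2)] dist_triangle[of x z y] dist_triangle[of x y z] dist_sym[of y z] by linarith
  then have t: "\<bar>t\<bar> \<le> r" using r mult_left_mono[of "\<bar>real (d x z) - real (d x y)\<bar>" 1 r]
    by (simp add: t_def abs_mult)
  have "\<bar>exp t - 1\<bar> \<le> 2 * \<bar>t\<bar>"
  proof (cases "0 \<le> t")
    case True
    then have "exp t \<le> 1 + t + t^2" using t r by (intro exp_bound) auto
    moreover have "t^2 \<le> t" using True t r mult_left_mono[of t 1 t] by (simp add: power2_eq_square)
    ultimately show ?thesis using True by simp
  next
    case False
    then have "exp t \<le> 1" "t < 0" by auto
    then show ?thesis using exp_ge_add_one_self[of t] by linarith
  qed
  then have et: "\<bar>exp t - 1\<bar> \<le> 2 * r" using t by linarith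
  have "r * real (d x z) = r * real (d x y) + t" by (simp add: t_def algebra_simps)
  then have "\<eta> z = \<eta> y * exp t" by (simp add: \<eta>_def exp_add)
  then have "(\<eta> y - \<eta> z)^2 = (\<eta> y)^2 * (\<bar>exp t - 1\<bar>)^2"
    by (simp add: power2_eq_square algebra_simps)
  also have "\<dots> \<le> (\<eta> y)^2 * (2 * r)^2" using et by (intro mult_left_mono power_mono) auto
  also have "(2 * r)^2 = 1 / n" using n by (simp add: r_def power_divide)
  also have "(\<eta> y)^2 = gauss_weight x n y" using n by (simp add: eta[symmetric] gauss_weight_def)
  finally show ?thesis by (simp add: eta)
qed

definition decay_const :: real where
  "decay_const = heat_L2_const * 2 ^ D * (1 + weight_rate * exp (5 * weight_rate))"

lemma decay_const_pos: "0 < decay_const"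
  unfolding decay_const_def using heat_L2_const_pos weight_rate_pos by (intro mult_pos_pos add_pos_pos) auto

text \<open>An integral maximum principle: Caccioppoli with the square root of the weight as cutoff
  shows that the weighted norm increases per step only by a source near x, which the unweighted
  bound \<open>heat_L2\<close> controls.\<close>

lemma heat_weighted_energy:
  assumes Y: "\<And>l. l \<le> 2 * k \<Longrightarrow> inside Y (heat x l)"
  shows "(\<Sum>y\<in>Y. (heat x k y)^2 * exp (real (d x y) / sqrt (real (Suc k))) * m y)
     \<le> decay_const / V x (sqrt (real (Suc k)))"
proof -
  let ?E = "\<lambda>k. \<Sum>y\<in>Y. gauss_weight x (real (Suc k)) y * (heat x k y)^2 * m y"
  let ?K = "weight_rate * exp (5 * weight_rate)"
  have fin: "finite Y" using Y[of 0] by (simp add: inside_def)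
  have w: "0 \<le> gauss_weight x n y" if "n \<ge> 0" for n y using that by (simp add: gauss_weight_def)
  have step: "?E (Suc l) \<le> ?E l + ?K * real (Suc l) ^ D * (heat_L2_const / V x (sqrt (real (Suc l))))"
    if l: "l < k" for l
  proof -
    let ?n = "real (Suc l)"
    let ?w = "gauss_weight x (?n + 1)"
    let ?u = "heat x l"
    have sq: "(sqrt (?w y))^2 = ?w y" for y using w by simp
    have "?E (Suc l) = (\<Sum>y\<in>Y. (sqrt (?w y))^2 * (P ?u y)^2 * m y)"
      unfolding sq by (simp add: heat_Suc add_ac)
    also have "\<dots> \<le> (\<Sum>y\<in>Y. ?w y * (?u y)^2 * m y)
        + 2 / \<alpha> * (\<Sum>y\<in>Y. \<Sum>z\<in>Y. \<mu> y z * ((sqrt (?w y) - sqrt (?w z))^2 * (?u y)^2))"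
    proof -
      have "0 \<le> \<alpha> / 2 * energy Y (\<lambda>y. sqrt (?w y)) ?u"
        using alpha_pos energy_nonneg by (intro mult_nonneg_nonneg) auto
      then show ?thesis
        using caccioppoli[OF Y, of l "\<lambda>y. sqrt (?w y)"] l unfolding sq by linarith
    qed
    also have "\<dots> \<le> (\<Sum>y\<in>Y. ?w y * (?u y)^2 * m y) + 2 / \<alpha> * (\<Sum>y\<in>Y. ?w y / (?n + 1) * (?u y)^2 * m y)"
    proof (intro add_left_mono mult_left_mono)
      have "(\<Sum>y\<in>Y. \<Sum>z\<in>Y. \<mu> y z * ((sqrt (?w y) - sqrt (?w z))^2 * (?u y)^2))
        \<le> (\<Sum>y\<in>Y. \<Sum>z\<in>Y. \<mu> y z * (?w y / (?n + 1) * (?u y)^2))"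
        by (intro edge_sum_mono mult_right_mono gauss_weight_gradient) auto
      also have "\<dots> \<le> (\<Sum>y\<in>Y. ?w y / (?n + 1) * (?u y)^2 * m y)"
        using w by (intro edge_sum_le_vertex_sum fin mult_nonneg_nonneg divide_nonneg_nonneg) auto
      finally show "(\<Sum>y\<in>Y. \<Sum>z\<in>Y. \<mu> y z * ((sqrt (?w y) - sqrt (?w z))^2 * (?u y)^2))
        \<le> (\<Sum>y\<in>Y. ?w y / (?n + 1) * (?u y)^2 * m y)" .
    qed (use alpha_pos in auto)
    also have "\<dots> = (\<Sum>y\<in>Y. ?w y * (1 + 2 / (\<alpha> * (?n + 1))) * ((?u y)^2 * m y))"
      unfolding sum_distrib_left sum.distrib[symmetric]
      by (intro sum.cong refl) (simp add: algebra_simps)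
    also have "\<dots> \<le> (\<Sum>y\<in>Y. (gauss_weight x ?n y + ?K * ?n ^ D) * ((?u y)^2 * m y))"
      by (intro sum_mono mult_right_mono gauss_weight_step) auto
    also have "\<dots> = ?E l + ?K * ?n ^ D * (\<Sum>y\<in>Y. (?u y)^2 * m y)"
      by (simp add: distrib_right sum.distrib sum_distrib_left mult.assoc)
    also have "\<dots> \<le> ?E l + ?K * ?n ^ D * (heat_L2_const / V x (sqrt ?n))"
      using Y l weight_rate_pos by (intro add_left_mono mult_left_mono heat_L2) auto
    finally show ?thesis .
  qed
  let ?N = "real (Suc k)"
  have V0: "0 < V x (sqrt ?N)" by (intro volume_pos) auto
  \<comment> \<open>The crude sqrt (N / n) \<le> N / n makes the volume loss (N / n)^D, whose n^(-D)
    cancels the n^D of the source at time n.\<close>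
  have vol: "1 / V x (sqrt (real (Suc l))) \<le> 2 ^ D * ?N ^ D / (real (Suc l) ^ D * V x (sqrt ?N))" if "l \<le> k" for l
  proof -
    let ?n = "real (Suc l)"
    have "V x (sqrt ?N) \<le> (2 * (sqrt ?N / sqrt ?n)) ^ D * V x (sqrt ?n)"
      using that by (intro volume_growth) auto
    also have "\<dots> \<le> (2 * (?N / ?n)) ^ D * V x (sqrt ?n)"
    proof (intro mult_right_mono power_mono mult_left_mono)
      have "1 \<le> ?N / ?n" using that by simp
      then have "sqrt (?N / ?n) \<le> ?N / ?n"
        using mult_left_mono[of 1 "?N / ?n" "?N / ?n"] by (intro real_le_lsqrt) (auto simp: power2_eq_square)
      then show "sqrt ?N / sqrt ?n \<le> ?N / ?n" by (simp only: real_sqrt_divide)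
    qed (use volume_pos[of "sqrt ?n" x] in auto)
    finally have "V x (sqrt ?N) * ?n ^ D \<le> 2 ^ D * ?N ^ D * V x (sqrt ?n)"
      by (simp add: power_mult_distrib power_divide field_simps del: of_nat_Suc)
    then show ?thesis using V0 volume_pos[of "sqrt ?n" x]
      by (simp add: field_simps del: of_nat_Suc)
  qed
  let ?c = "heat_L2_const * 2 ^ D * ?N ^ D / V x (sqrt ?N)"
  have c0: "0 \<le> ?c" using V0 heat_L2_const_pos by simp
  have "?E l \<le> ?c + real l * (?K * ?c)" if "l \<le> k" for l using that
  proof (induction l)
    case 0
    have "?E 0 = (\<Sum>y\<in>Y. (heat x 0 y)^2 * m y)"
      by (intro sum.cong refl) (auto simp: heat_0 gauss_weight_def)
    also have "\<dots> \<le> heat_L2_const * (1 / V x (sqrt (real (Suc 0))))"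
      using heat_L2[of 0 Y x] Y[of 0] by simp
    also have "\<dots> \<le> heat_L2_const * (2 ^ D * ?N ^ D / (real (Suc 0) ^ D * V x (sqrt ?N)))"
      using heat_L2_const_pos by (intro mult_left_mono vol) auto
    finally show ?case by simp
  next
    case (Suc l)
    have "real (Suc l) ^ D * (heat_L2_const / V x (sqrt (real (Suc l))))
       = real (Suc l) ^ D * (heat_L2_const * (1 / V x (sqrt (real (Suc l)))))" by simp
    also have "\<dots> \<le> real (Suc l) ^ D * (heat_L2_const * (2 ^ D * ?N ^ D / (real (Suc l) ^ D * V x (sqrt ?N))))"
      using heat_L2_const_pos Suc.prems by (intro mult_left_mono vol) auto
    also have "\<dots> = ?c" by simp
    finally have "?K * real (Suc l) ^ D * (heat_L2_const / V x (sqrt (real (Suc l)))) \<le> ?K * ?c"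
      using weight_rate_pos by (simp only: mult.assoc) (intro mult_left_mono, auto)
    then have "?E (Suc l) \<le> ?E l + ?K * ?c" using step[of l] Suc.prems by linarith
    moreover have "?E l \<le> ?c + real l * (?K * ?c)" using Suc by simp
    moreover have "real (Suc l) * (?K * ?c) = real l * (?K * ?c) + ?K * ?c"
      by (simp only: of_nat_Suc distrib_right mult_1_left)
    ultimately show ?case by linarith
  qed
  from this[of k] have "?E k \<le> ?c + real k * (?K * ?c)" by simp
  also have "\<dots> \<le> ?N * ?c + ?N * (?K * ?c)"
  proof (intro add_mono)
    show "?c \<le> ?N * ?c" using mult_right_mono[OF _ c0, of 1 ?N] by simp
    show "real k * (?K * ?c) \<le> ?N * (?K * ?c)"
      using c0 weight_rate_pos by (intro mult_right_mono mult_nonneg_nonneg) auto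
  qed
  also have "\<dots> = ?N ^ Suc D * (decay_const / V x (sqrt ?N))"
  proof -
    have "N * (c * p * q / v) + N * (K * (c * p * q / v)) = N * q * (c * p * (1 + K) / v)"
      for N c p q v K :: real by (simp add: distrib_left add_divide_distrib mult_ac)
    then show ?thesis by (simp only: decay_const_def power_Suc)
  qed
  also have "?E k = ?N ^ Suc D * (\<Sum>y\<in>Y. (heat x k y)^2 * exp (real (d x y) / sqrt ?N) * m y)"
    by (simp add: gauss_weight_def sum_distrib_left mult_ac)
  finally show ?thesis by (rule mult_left_le_imp_le) simp
qed

end

section \<open>Pointwise kernel bounds and domination by the maximal function\<close>

context heat_graph
begin

text \<open>Split the time into halves, distribute the exponential over both factors by the triangle
  inequality, and apply Cauchy-Schwarz with the weighted L2 bound at each end.\<close>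

lemma heat_pointwise:
  defines "r \<equiv> \<lambda>k. sqrt (real (Suc k))"
  shows "(heat x k y)^2 * exp (real (d x y) / r k) * (V x (r k) * V y (r k)) \<le> (decay_const * C\<^sub>D)^2"
proof -
  obtain Y where Y: "\<forall>z\<in>{x, y}. \<forall>l\<le>2 * k. inside Y (heat z l)"
    using heat_inside[of "{x, y}" "2 * k"] by blast
  define i j where "i = k div 2" "j = k - i"
  have ij: "i + j = k" "i \<le> k" "j \<le> k" by (auto simp: i_j_def)
  let ?e = "\<lambda>w z. exp (real (d w z) / (2 * r k))"
  let ?Q = "\<lambda>z l. \<Sum>w\<in>Y. (heat z l w)^2 * (?e z w)^2 * m w"
  \<comment> \<open>Each half l satisfies k + 1 \<le> 4 (l + 1), so the scales differ by at most a
    factor 2 and one doubling suffices.\<close>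
  have half: "V z (r k) * ?Q z l \<le> decay_const * C\<^sub>D"
    if z: "z \<in> {x, y}" and l: "l \<le> k" "k \<le> Suc (2 * l)" for z l
  proof -
    have rk: "r l \<le> r k" "0 < r l" using l by (auto simp: r_def)
    have "?Q z l
       \<le> (\<Sum>w\<in>Y. (heat z l w)^2 * exp (real (d z w) / r l) * m w)"
    proof (intro sum_mono mult_right_mono mult_left_mono)
      fix w
      have "(?e z w)^2 = exp (real (d z w) / r k)" by (simp flip: exp_double)
      also have "\<dots> \<le> exp (real (d z w) / r l)" using rk by (simp add: divide_left_mono)
      finally show "(?e z w)^2 \<le> exp (real (d z w) / r l)" .
    qed auto
    also have "\<dots> \<le> decay_const / V z (r l)"
      unfolding r_def using Y z l by (intro heat_weighted_energy) auto
    finally have 1: "?Q z l \<le> decay_const / V z (r l)" .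
    have "sqrt (real (Suc k)) \<le> sqrt (4 * real (Suc l))" using l by simp
    then have "r k \<le> 2 * r l" by (simp only: real_sqrt_mult r_def) simp
    then have "V z (r k) \<le> V z (2 * r l)" by (rule volume_mono)
    also have "\<dots> \<le> C\<^sub>D * V z (r l)" using rk by (intro volume_doubling)
    finally have "V z (r k) * ?Q z l
       \<le> (C\<^sub>D * V z (r l)) * (decay_const / V z (r l))"
      using 1 CD_ge_1 volume_pos[of "r l" z] rk by (intro mult_mono sum_nonneg) auto
    then show ?thesis using volume_pos[of "r l" z] rk by (simp add: mult_ac)
  qed
  have "heat x k y * ?e x y = (\<Sum>z\<in>Y. heat x i z * heat y j z * m z * ?e x y)"
    unfolding sum_distrib_right[symmetric] using heat_convolution[of i j Y x y] Y ij by simp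
  also have "\<dots> \<le> (\<Sum>z\<in>Y. (heat x i z * ?e x z * sqrt (m z)) * (heat y j z * ?e y z * sqrt (m z)))"
  proof (rule sum_mono)
    fix z
    have "real (d x y) \<le> real (d x z) + real (d y z)"
      using dist_triangle[of x y z] dist_sym[of y z] by simp
    then have "real (d x y) / (2 * r k) \<le> real (d x z) / (2 * r k) + real (d y z) / (2 * r k)"
      by (simp add: add_divide_distrib[symmetric] r_def divide_right_mono)
    then have "?e x y \<le> ?e x z * ?e y z" by (simp flip: exp_add)
    then have "heat x i z * heat y j z * m z * ?e x y \<le> heat x i z * heat y j z * m z * (?e x z * ?e y z)"
      by (intro mult_left_mono mult_nonneg_nonneg heat_nonneg) auto
    also have "\<dots> = (heat x i z * ?e x z * sqrt (m z)) * (heat y j z * ?e y z * sqrt (m z))"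
      using real_sqrt_mult_self[of "m z"] by (simp add: algebra_simps)
    finally show "heat x i z * heat y j z * m z * ?e x y \<le> \<dots>" .
  qed
  finally have "(heat x k y * ?e x y)^2
    \<le> (\<Sum>z\<in>Y. (heat x i z * ?e x z * sqrt (m z)) * (heat y j z * ?e y z * sqrt (m z)))^2"
    by (intro power_mono mult_nonneg_nonneg heat_nonneg) auto
  also have "\<dots> \<le> (\<Sum>z\<in>Y. (heat x i z * ?e x z * sqrt (m z))^2) * (\<Sum>z\<in>Y. (heat y j z * ?e y z * sqrt (m z))^2)"
    by (rule Cauchy_Schwarz_ineq_sum)
  also have "\<dots> = ?Q x i * ?Q y j"
    by (simp add: power_mult_distrib)
  finally have A: "(heat x k y * ?e x y)^2 \<le> \<dots>" .
  have pos: "0 \<le> V x (r k)" "0 \<le> V y (r k)" using volume_pos by (auto simp: r_def intro!: less_imp_le)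
  have "(heat x k y)^2 * exp (real (d x y) / r k) * (V x (r k) * V y (r k))
    = (heat x k y * ?e x y)^2 * (V x (r k) * V y (r k))"
    by (simp add: power_mult_distrib flip: exp_double)
  also have "\<dots> \<le> (?Q x i * ?Q y j)
      * (V x (r k) * V y (r k))"
    using pos by (intro mult_right_mono A) auto
  also have "\<dots> = (V x (r k) * ?Q x i)
      * (V y (r k) * ?Q y j)" by (simp only: mult_ac)
  also have "\<dots> \<le> (decay_const * C\<^sub>D) * (decay_const * C\<^sub>D)"
  proof -
    have "k \<le> Suc (2 * i)" "k \<le> Suc (2 * j)" unfolding i_j_def by presburger+
    then show ?thesis
      using ij pos decay_const_pos CD_ge_1
      by (intro mult_mono[OF half[of x i] half[of y j]]) (auto intro!: mult_nonneg_nonneg sum_nonneg)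
  qed
  finally show ?thesis by (simp add: power2_eq_square)
qed

definition kernel_const :: real where
  "kernel_const = decay_const * C\<^sub>D * (exp 1 * C\<^sub>D * (4 * real D) ^ D)"

lemma kernel_const_pos: "0 < kernel_const"
  unfolding kernel_const_def using decay_const_pos CD_ge_1 volume_exponent(1)
  by (intro mult_pos_pos zero_less_power) auto

text \<open>Recentres the kernel bound at any x whose cone contains y. The volume at y costs two
  doublings; the one at z costs a power of 1 + s, absorbed into exp (s / 2). Of the decay exp (-s)
  for the square, exp (-s / 2) is left, and the root gives exp (-s / 4).\<close>

lemma heat_near:
  defines "r \<equiv> \<lambda>k. sqrt (real (Suc k))"
  assumes "real (d x y) \<le> 2 * r k"
  shows "heat z k y * V x (r k) \<le> kernel_const * exp (- real (d x z) / (4 * r k))"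
proof -
  define s where "s = real (d x z) / r k"
  have r: "0 < r k" by (simp add: r_def)
  have s: "0 \<le> s" using r by (simp add: s_def)
  have pos: "0 < V w (r k)" for w using r volume_pos by auto
  have "V x (r k) \<le> V y (4 * r k)"
    unfolding volume_def
  proof (rule sum_mono2)
    show "B x (r k) \<subseteq> B y (4 * r k)"
    proof
      fix w assume "w \<in> B x (r k)"
      then show "w \<in> B y (4 * r k)"
        using assms(2) dist_triangle[of y w x] dist_sym[of x y] r unfolding mem_ball by linarith
    qed
  qed auto
  also have "\<dots> \<le> C\<^sub>D * V y (2 * r k)" using volume_doubling[of "2 * r k" y] r by simp
  also have "\<dots> \<le> C\<^sub>D * (C\<^sub>D * V y (r k))"
    using volume_doubling[of "r k" y] r CD_ge_1 by (intro mult_left_mono) auto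
  finally have Vy: "V x (r k) \<le> C\<^sub>D^2 * V y (r k)" by (simp add: power2_eq_square mult_ac)
  have "V x (r k) \<le> V z (r k * (1 + s))"
    unfolding volume_def
  proof (rule sum_mono2)
    have e: "r k * (1 + s) = r k + real (d x z)" using r by (simp add: s_def field_simps)
    show "B x (r k) \<subseteq> B z (r k * (1 + s))"
      unfolding e
    proof
      fix w assume "w \<in> B x (r k)"
      then show "w \<in> B z (r k + real (d x z))"
        using dist_triangle[of z w x] dist_sym[of x z] unfolding mem_ball by linarith
    qed
  qed auto
  also have "\<dots> \<le> (2 * (r k * (1 + s) / r k)) ^ D * V z (r k)"
    using r s by (intro volume_growth) auto
  also have "2 * (r k * (1 + s) / r k) = 2 * (1 + s)" using r by simp
  also have "(2 * (1 + s)) ^ D = 2 ^ D * (1 + s) ^ D" by (rule power_mult_distrib)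
  also have "\<dots> \<le> 2 ^ D * ((real D / (1 / 2)) ^ D * exp (1 / 2 * s))"
    using s volume_exponent(1) by (intro mult_left_mono one_plus_power_le_exp) auto
  also have "\<dots> = (4 * real D) ^ D * exp (s / 2)"
    by (simp only: mult.assoc[symmetric] power_mult_distrib[symmetric]) simp
  finally have Vz: "V x (r k) \<le> (4 * real D) ^ D * exp (s / 2) * V z (r k)"
    using pos by (simp add: mult_right_mono)
  have "s - 2 \<le> real (d z y) / r k"
  proof -
    have "real (d x z) - 2 * r k \<le> real (d z y)"
      using assms(2) dist_triangle[of x z y] dist_sym[of y z] by linarith
    then have "(real (d x z) - 2 * r k) / r k \<le> real (d z y) / r k" using r by (intro divide_right_mono) auto
    then show ?thesis using r by (simp add: s_def diff_divide_distrib)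
  qed
  then have ex: "exp s \<le> exp 2 * exp (real (d z y) / r k)"
    by (simp flip: exp_add)
  let ?h = "heat z k y"
  have "?h^2 * exp s * (V x (r k) * V x (r k))
     \<le> ?h^2 * (exp 2 * exp (real (d z y) / r k)) *
       (((4 * real D) ^ D * exp (s / 2) * V z (r k)) * (C\<^sub>D^2 * V y (r k)))"
    using pos ex Vy Vz by (intro mult_mono mult_left_mono) (auto intro!: mult_nonneg_nonneg less_imp_le[OF pos])
  also have "\<dots> = exp 2 * (4 * real D) ^ D * C\<^sub>D^2 * exp (s / 2)
       * (?h^2 * exp (real (d z y) / r k) * (V z (r k) * V y (r k)))"
    by (simp only: mult_ac)
  also have "\<dots> \<le> exp 2 * (4 * real D) ^ D * C\<^sub>D^2 * exp (s / 2) * (decay_const * C\<^sub>D)^2"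
    unfolding r_def by (intro mult_left_mono heat_pointwise) auto
  \<comment> \<open>Squaring this factor, which is at least 1, makes the constant the perfect square
    of \<open>kernel_const\<close>.\<close>
  also have "\<dots> \<le> exp 2 * ((4 * real D) ^ D)^2 * C\<^sub>D^2 * exp (s / 2) * (decay_const * C\<^sub>D)^2"
  proof (intro mult_right_mono mult_left_mono)
    have "1 \<le> (4 * real D) ^ D" using volume_exponent(1) by (intro one_le_power) auto
    then show "(4 * real D) ^ D \<le> ((4 * real D) ^ D)^2" by (rule self_le_power) simp
  qed auto
  also have "\<dots> = kernel_const^2 * exp (s / 2)"
  proof -
    have "exp (2::real) = (exp 1)^2" by (simp flip: exp_double)
    then show ?thesis unfolding kernel_const_def power_mult_distrib by (simp only: mult_ac)
  qed
  finally have "(?h * V x (r k))^2 * exp s * exp (- s) \<le> kernel_const^2 * exp (s / 2) * exp (- s)"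
    by (intro mult_right_mono) (simp_all add: power2_eq_square mult_ac)
  also have "(?h * V x (r k))^2 * exp s * exp (- s) = (?h * V x (r k))^2"
    by (simp add: mult.assoc flip: exp_add)
  also have "kernel_const^2 * exp (s / 2) * exp (- s) = (kernel_const * exp (- s / 4))^2"
    by (simp add: power_mult_distrib mult.assoc flip: exp_add exp_double)
  finally have "?h * V x (r k) \<le> kernel_const * exp (- s / 4)"
    by (rule power2_le_imp_le) (use kernel_const_pos in simp)
  moreover have "- s / 4 = - real (d x z) / (4 * r k)" by (simp add: s_def)
  ultimately show ?thesis by (simp only:)
qed

definition maxfun_const :: real where
  "maxfun_const = kernel_const * (16 * real D) ^ D / (1 - exp (- 1 / 8))"

lemma maxfun_const_pos: "0 < maxfun_const"
  unfolding maxfun_const_def using kernel_const_pos volume_exponent(1) by simp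

text \<open>Decompose into shells of width \<open>?r\<close> around x, the vertex of the cone,
  instead of y. The mass in the shell n is an average times a volume growing like (n + 1)^D, and the
  kernel decays like exp (-n / 4).\<close>

theorem maxfun_nontangential_bound:
  assumes f: "finite {z. f z \<noteq> 0}" and R: "4 * L + 3 \<le> R"
  shows "nontangential_bound L f (\<lambda>x. maxfun_const * maxfun R f x)"
  unfolding nontangential_bound_def
proof (intro allI impI)
  fix y x k assume k: "k \<le> L" and yx: "real (d y x) \<le> 2 * sqrt (real (Suc k))"
  let ?r = "sqrt (real (Suc k))"
  have r: "0 < ?r" "1 \<le> ?r" "?r \<le> real (Suc k)"
    using real_le_lsqrt[of "real (Suc k)" "real (Suc k)"] by (auto simp: power2_eq_square)
  let ?A = "{z. f z \<noteq> 0 \<and> d y z \<le> k}"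
  let ?q = "exp (- 1 / 8 :: real)"
  let ?c = "kernel_const * (16 * real D) ^ D * V x ?r * maxfun R f x"
  have fin: "finite ?A" by (rule finite_subset[OF _ f]) auto
  define i where "i = (\<lambda>z. nat \<lfloor>real (d x z) / ?r\<rfloor>)"
  have i: "real (i z) \<le> real (d x z) / ?r" "real (d x z) / ?r < real (i z) + 1" for z
    using r by (auto simp: i_def)
  have V: "0 < V x ?r" using r by (intro volume_pos) auto
  have M: "0 \<le> maxfun R f x" by (rule maxfun_nonneg)
  have shell: "mass f {z\<in>?A. i z = n} \<le> maxfun R f x * ((2 * (real n + 1)) ^ D * V x ?r)" for n
  proof (cases "{z\<in>?A. i z = n} = {}")
    case True
    show ?thesis unfolding True using M V by simp
  next
    case False
    then obtain z where z: "d y z \<le> k" "i z = n" by auto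
    let ?\<rho> = "(real n + 1) * ?r"
    have "real n * ?r \<le> real (d x z)" using i(1)[of z] z(2) r by (simp add: field_simps)
    also have "\<dots> \<le> 2 * ?r + real k" using dist_triangle[of x z y] dist_sym[of x y] yx z(1) by linarith
    finally have "?\<rho> \<le> 3 * ?r + real k" by (simp add: algebra_simps)
    \<comment> \<open>Finite propagation keeps z within k of y, so every relevant shell has radius
      at most 3 (k + 1) + k; this dictates the truncation of the maximal function.\<close>
    also have "\<dots> \<le> real (4 * L + 3)" using r k by simp
    also have "\<dots> \<le> real R" using R by (simp only: of_nat_le_iff)
    finally have \<rho>R: "?\<rho> \<le> real R" .
    define N where "N = nat \<lfloor>?\<rho>\<rfloor>"
    have \<rho>: "0 \<le> ?\<rho>" using r by simp
    have N: "N \<le> R" using \<rho>R \<rho> unfolding N_def by linarith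
    \<comment> \<open>\<open>maxfun\<close> uses natural radii; distances are natural numbers, so
      rounding the radius down leaves the ball unchanged.\<close>
    have BN: "B x (real N) = B x ?\<rho>"
    proof -
      have "real t \<le> real N \<longleftrightarrow> real t \<le> ?\<rho>" for t :: nat
      proof -
        have 1: "real N \<le> ?\<rho>" "?\<rho> < real N + 1" using \<rho> unfolding N_def by linarith+
        show ?thesis
        proof
          assume "real t \<le> ?\<rho>"
          then have "real t < real (Suc N)" using 1(2) by simp
          then show "real t \<le> real N" by (simp only: of_nat_less_iff of_nat_le_iff)
        qed (use 1(1) in linarith)
      qed
      then show ?thesis by (auto simp: mem_ball)
    qed
    have "mass f {z\<in>?A. i z = n} \<le> mass f (B x (real N))"
      unfolding BN
    proof (rule sum_mono2)
      show "{z\<in>?A. i z = n} \<subseteq> B x ?\<rho>"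
      proof
        fix z assume "z \<in> {z\<in>?A. i z = n}"
        then show "z \<in> B x ?\<rho>" using i(2)[of z] r by (simp add: mem_ball field_simps)
      qed
    qed auto
    also have "\<dots> \<le> maxfun R f x * V x (real N)" by (rule ball_average_le_maxfun[OF N])
    also have "V x (real N) = V x ?\<rho>" by (simp add: volume_def BN)
    also have "\<dots> \<le> (2 * (?\<rho> / ?r)) ^ D * V x ?r"
      using r by (intro volume_growth) (auto simp: algebra_simps)
    also have "?\<rho> / ?r = real n + 1" using r by simp
    finally show ?thesis using M by (simp add: mult_left_mono)
  qed
  have "\<bar>(P ^^ k) f y\<bar> * V x ?r = \<bar>\<Sum>z\<in>{z. f z \<noteq> 0}. f z * m z * heat z k y\<bar> * V x ?r"
    using P_pow_eq_heat_sum[OF f, of f k y] by simp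
  also have "(\<Sum>z\<in>{z. f z \<noteq> 0}. f z * m z * heat z k y) = (\<Sum>z\<in>?A. f z * m z * heat z k y)"
    using heat_support f by (intro sum.mono_neutral_right) auto
  also have "\<bar>\<Sum>z\<in>?A. f z * m z * heat z k y\<bar> * V x ?r \<le> (\<Sum>z\<in>?A. \<bar>f z * m z * heat z k y\<bar>) * V x ?r"
    using V by (intro mult_right_mono sum_abs) auto
  also have "\<dots> = (\<Sum>z\<in>?A. \<bar>f z\<bar> * m z * (heat z k y * V x ?r))"
    by (simp add: sum_distrib_right abs_mult heat_nonneg mult.assoc)
  also have "\<dots> \<le> (\<Sum>z\<in>?A. \<bar>f z\<bar> * m z * (kernel_const * exp (- real (i z) / 4)))"
  proof (intro sum_mono mult_left_mono)
    fix z
    have "heat z k y * V x ?r \<le> kernel_const * exp (- real (d x z) / (4 * ?r))"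
      using yx dist_sym by (intro heat_near) auto
    also have "\<dots> \<le> kernel_const * exp (- real (i z) / 4)"
      using i(1)[of z] kernel_const_pos by (intro mult_left_mono) (auto simp: field_simps)
    finally show "heat z k y * V x ?r \<le> kernel_const * exp (- real (i z) / 4)" .
  qed auto
  also have "\<dots> = (\<Sum>n\<in>i ` ?A. \<Sum>z\<in>{z\<in>?A. i z = n}. \<bar>f z\<bar> * m z * (kernel_const * exp (- real (i z) / 4)))"
    using fin by (intro sum.group[symmetric]) auto
  also have "\<dots> = (\<Sum>n\<in>i ` ?A. kernel_const * exp (- real n / 4) * mass f {z\<in>?A. i z = n})"
    unfolding sum_distrib_left by (intro sum.cong refl) (auto simp: mult_ac)
  also have "\<dots> \<le> (\<Sum>n\<in>i ` ?A. ?c * ?q ^ n)"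
  proof (rule sum_mono)
    fix n
    \<comment> \<open>The share 1/8 leaves exp (-n / 8) of exp (-n / 4), the ratio in
      \<open>maxfun_const\<close>.\<close>
    have "(1 + real n) ^ D \<le> (real D / (1 / 8)) ^ D * exp (1 / 8 * real n)"
      using volume_exponent(1) by (intro one_plus_power_le_exp) auto
    then have "2 ^ D * (1 + real n) ^ D \<le> 2 ^ D * ((8 * real D) ^ D * exp (real n / 8))"
      by (intro mult_left_mono) (auto simp: mult.commute)
    also have "\<dots> = (16 * real D) ^ D * exp (real n / 8)"
      by (simp only: mult.assoc[symmetric] power_mult_distrib[symmetric]) simp
    also have "2 ^ D * (1 + real n) ^ D = (2 * (real n + 1)) ^ D"
      by (simp only: power_mult_distrib add.commute)
    finally have g: "(2 * (real n + 1)) ^ D \<le> (16 * real D) ^ D * exp (real n / 8)" .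
    have "kernel_const * exp (- real n / 4) * mass f {z\<in>?A. i z = n}
       \<le> kernel_const * exp (- real n / 4) * (maxfun R f x * ((2 * (real n + 1)) ^ D * V x ?r))"
      using kernel_const_pos by (intro mult_left_mono shell) auto
    also have "\<dots> \<le> kernel_const * exp (- real n / 4) * (maxfun R f x * (((16 * real D) ^ D * exp (real n / 8)) * V x ?r))"
      using kernel_const_pos M V g by (intro mult_left_mono mult_right_mono) auto
    also have "\<dots> = ?c * (exp (- real n / 4) * exp (real n / 8))"
      by (simp only: mult_ac)
    also have "exp (- real n / 4) * exp (real n / 8) = ?q ^ n"
      by (simp flip: exp_add exp_of_nat_mult)
    finally show "kernel_const * exp (- real n / 4) * mass f {z\<in>?A. i z = n}
       \<le> ?c * ?q ^ n" .
  qed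
  also have "\<dots> = ?c * (\<Sum>n\<in>i ` ?A. ?q ^ n)"
    by (simp only: sum_distrib_left)
  also have "\<dots> \<le> ?c * (1 / (1 - ?q))"
  proof (intro mult_left_mono)
    have "(\<Sum>n\<in>i ` ?A. ?q ^ n) \<le> (\<Sum>n. ?q ^ n)"
      using fin by (intro sum_le_suminf) (auto simp: summable_geometric)
    then show "(\<Sum>n\<in>i ` ?A. ?q ^ n) \<le> 1 / (1 - ?q)" by (simp add: suminf_geometric)
  qed (use kernel_const_pos M V in auto)
  also have "\<dots> = maxfun_const * maxfun R f x * V x ?r" by (simp add: maxfun_const_def)
  finally show "\<bar>(P ^^ k) f y\<bar> \<le> maxfun_const * maxfun R f x" using V by simp
qed

end

section \<open>Bounds for finite truncations\<close>

context weighted_graph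
begin

text \<open>The weight l + 1 dominates the weight l of g and matches the weighted energy inequality;
  no root is taken.\<close>

definition square_sum :: "('a \<Rightarrow> real) \<Rightarrow> nat \<Rightarrow> 'a \<Rightarrow> real" where
  "square_sum f L x = (\<Sum>l<L. real (Suc l) * (increment f l x)^2)"

lemma square_sum_nonneg: "0 \<le> square_sum f L x"
  unfolding square_sum_def by (intro sum_nonneg) auto

lemma sum_square_sum:
  "(\<Sum>x\<in>A. square_sum f L x * m x)
     = (\<Sum>l<L. real (Suc l) * (\<Sum>x\<in>A. (increment f l x)^2 * m x))"
proof -
  have "(\<Sum>x\<in>A. square_sum f L x * m x)
     = (\<Sum>x\<in>A. \<Sum>l<L. real (Suc l) * ((increment f l x)^2 * m x))"
    unfolding square_sum_def by (simp only: sum_distrib_right mult.assoc)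
  also have "\<dots> = (\<Sum>l<L. \<Sum>x\<in>A. real (Suc l) * ((increment f l x)^2 * m x))"
    by (rule sum.swap)
  finally show ?thesis by (simp only: sum_distrib_left)
qed

end

text \<open>Both 2 j and 2 j + 1 halve to j, and their weights add up to 4 j + 3.\<close>

lemma sum_halved_index_le:
  fixes S :: "nat \<Rightarrow> real"
  assumes "\<And>j. 0 \<le> S j"
  shows "(\<Sum>l<L. real (Suc l) * S (l div 2)) \<le> 4 * (\<Sum>j<L. real (Suc j) * S j)"
proof -
  have "(\<Sum>l<L. real (Suc l) * S (l div 2)) \<le> (\<Sum>l<2 * L. real (Suc l) * S (l div 2))"
    using assms by (intro sum_mono2) auto
  also have "\<dots> = (\<Sum>j<L. real (4 * j + 3) * S j)"
    by (induction L) (auto simp: algebra_simps)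
  also have "\<dots> \<le> (\<Sum>j<L. 4 * (real (Suc j) * S j))"
    unfolding mult.assoc[symmetric] using assms by (intro sum_mono mult_right_mono) auto
  finally show ?thesis by (simp only: sum_distrib_left)
qed

context lazy_graph
begin

text \<open>A constant cutoff has no transition layer, so the majorant may be 0.\<close>

lemma square_sum_L2:
  assumes Y: "\<And>l. l \<le> Suc L \<Longrightarrow> inside Y ((P ^^ l) f)"
  shows "(\<Sum>x\<in>Y. square_sum f L x * m x) \<le> local_const * (\<Sum>x\<in>Y. (f x)^2 * m x)"
  using localized_square_function[of L Y f "\<lambda>l x. 1" "\<lambda>x. 0"] Y
  unfolding sum_square_sum by simp

end

context heat_graph
begin

text \<open>For p < 2 the power H^(p - 2) is a sum of 2^((p - 2) k) over levels above H, so sublevel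
  sets of H appear, and these are the bases of sawtooth regions. At time 0 the bound by H controls f
  itself there.\<close>

lemma square_sum_Lp_below_2:
  assumes p: "1 < p" "p < 2"
  shows "\<exists>C>0. \<forall>f K L. finite {z. f z \<noteq> 0} \<longrightarrow> finite K \<longrightarrow>
    (\<Sum>x\<in>K. square_sum f L x powr (p / 2) * m x) \<le> C * (\<Sum>z | f z \<noteq> 0. \<bar>f z\<bar> powr p * m z)"
proof -
  obtain C\<^sub>M where CM: "C\<^sub>M > 0" "\<And>f R Y A. finite Y \<Longrightarrow> finite A \<Longrightarrow> {z. f z \<noteq> 0} \<subseteq> A \<Longrightarrow>
     (\<Sum>x\<in>Y. maxfun R f x powr p * m x) \<le> C\<^sub>M * (\<Sum>z\<in>A. \<bar>f z\<bar> powr p * m z)"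
    using maxfun_strong_type[OF p(1)] by blast
  define a where "a = 1 / (1 - 2 powr (- (2 - p)))"
  define b where "b = 1 / (1 - 2 powr (- p))"
  have ab: "a > 0" "b > 0" using p by (auto simp: a_def b_def powr_less_one)
  \<comment> \<open>a and b are the two geometric series below; the 1 belongs to the second term of
    \<open>pt\<close>.\<close>
  define C where "C = 2 powr (2 - p) * local_const * (a + b) + 1"
  have C: "C > 0" unfolding C_def using local_const_pos ab
    by (intro add_pos_pos mult_pos_pos) auto
  have "(\<Sum>x\<in>K. square_sum f L x powr (p / 2) * m x)
      \<le> C * maxfun_const powr p * C\<^sub>M * (\<Sum>z | f z \<noteq> 0. \<bar>f z\<bar> powr p * m z)"
    if f: "finite {z. f z \<noteq> 0}" and K: "finite K" for f K L
  proof -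
    define R where "R = 4 * Suc L + 3"
    define H where "H = (\<lambda>x. maxfun_const * maxfun R f x)"
    have H: "nontangential_bound (Suc L) f H"
      unfolding H_def R_def by (intro maxfun_nontangential_bound f) simp
    have H0: "0 \<le> H x" for x using maxfun_nonneg maxfun_const_pos by (simp add: H_def)
    obtain Y where Y: "finite Y" "K \<subseteq> Y" "\<And>l. l \<le> Suc L \<Longrightarrow> inside Y ((P ^^ l) f)"
      using exists_inside[OF f K, of "Suc L"] by blast
    \<comment> \<open>At H x = 0 the value 0 powr (p - 2) is 0, so \<open>pt\<close> holds there
      only because the square function vanishes as well.\<close>
    have zero: "square_sum f L x = 0" if "H x = 0" for x
    proof -
      have E: "(P ^^ l) f x = 0" if "l \<le> Suc L" for l
        using nontangential_boundD(1)[OF H that, of x x] \<open>H x = 0\<close> by simp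
      have "real (Suc l) * (increment f l x)^2 = 0" if "l < L" for l
        using E[of l] E[of "Suc l"] that by (simp del: funpow.simps)
      then show ?thesis unfolding square_sum_def by (intro sum.neutral) blast
    qed
    \<comment> \<open>If the square function exceeds H^2, its negative power p / 2 - 1 may be
      replaced by that of H^2; otherwise H^p is already a bound.\<close>
    have pt: "square_sum f L x powr (p / 2) \<le> square_sum f L x * H x powr (p - 2) + H x powr p" for x
    proof (cases "square_sum f L x \<le> (H x)^2")
      case True
      then have "square_sum f L x powr (p / 2) \<le> (H x)\<^sup>2 powr (p / 2)"
        using p square_sum_nonneg by (intro powr_mono2) auto
      also have "\<dots> = H x powr p"
        using H0[of x] by (cases "H x = 0") (auto simp: powr_powr simp flip: powr_numeral)
      finally show ?thesis using square_sum_nonneg[of f L x] by (simp add: add_increasing)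
    next
      case False
      then have g: "(H x)^2 < square_sum f L x" by simp
      then have "H x \<noteq> 0" using zero by fastforce
      then have h: "H x > 0" using H0[of x] by simp
      have g0: "square_sum f L x > 0" using g by (rule le_less_trans[rotated]) simp
      have "square_sum f L x powr (p / 2) = square_sum f L x * square_sum f L x powr (p / 2 - 1)"
        using g0 by (simp add: powr_mult_base)
      also have "square_sum f L x powr (p / 2 - 1) \<le> (H x)\<^sup>2 powr (p / 2 - 1)"
        using g h p by (intro powr_mono2') auto
      also have "(H x)\<^sup>2 powr (p / 2 - 1) = H x powr (p - 2)"
        using h by (simp add: powr_powr right_diff_distrib flip: powr_numeral)
      finally have "square_sum f L x powr (p / 2) \<le> square_sum f L x * H x powr (p - 2)"
        using g0 by simp
      then show ?thesis by (simp add: add_increasing2)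
    qed
    obtain K0 :: "int set" where K0: "finite K0"
      "\<And>x. x \<in> Y \<Longrightarrow> H x > 0 \<Longrightarrow> \<exists>k\<in>K0. pow2 k < H x \<and> H x \<le> 2 powr (real_of_int k + 1)"
      using dyadic_layers[OF Y(1), of H] by blast
    \<comment> \<open>Shifted by one: if H x lies between 2^k and 2^(k + 1), then x belongs to the
      sublevel set at k + 1.\<close>
    define K1 where "K1 = (\<lambda>k. k + 1) ` K0"
    have K1: "finite K1" using K0 by (simp add: K1_def)
    let ?F = "\<lambda>k::int. {x. H x \<le> pow2 k}"
    let ?A = "\<lambda>k x. if H x \<le> pow2 k then (H x)^2 * m x * 2 powr ((p - 2) * real_of_int k) else 0"
      and ?B = "\<lambda>k x. if H x \<le> pow2 k then 0 else m x * 2 powr (p * real_of_int k)"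
      and ?c = "\<lambda>k. 2 powr (2 - p) * 2 powr ((p - 2) * real_of_int k)"
      and ?E = "\<lambda>k. (\<Sum>x\<in>Y \<inter> ?F k. (H x)^2 * m x) + (\<Sum>x\<in>Y - ?F k. (pow2 k)^2 * m x)"
    have F: "?F k \<noteq> {}" for k
    proof -
      obtain x where "maxfun R f x = 0" using exists_maxfun_zero[OF f] by blast
      then have "x \<in> ?F k" by (simp add: H_def)
      then show ?thesis by blast
    qed
    have "(\<Sum>x\<in>Y. square_sum f L x * H x powr (p - 2) * m x)
       \<le> (\<Sum>x\<in>Y. \<Sum>k\<in>K1. if H x \<le> pow2 k
             then ?c k * (square_sum f L x * m x) else 0)"
    proof (rule sum_mono)
      fix x assume x: "x \<in> Y"
      let ?g = "\<lambda>k. if H x \<le> pow2 k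
             then ?c k * (square_sum f L x * m x) else 0"
      have g: "0 \<le> ?g k" for k using square_sum_nonneg by auto
      show "square_sum f L x * H x powr (p - 2) * m x \<le> (\<Sum>k\<in>K1. ?g k)"
      proof (cases "H x = 0")
        case True
        then show ?thesis using g by (simp add: sum_nonneg)
      next
        case False
        then have h: "H x > 0" using H0[of x] by simp
        then obtain k where k: "k \<in> K0" "pow2 k < H x" "H x \<le> 2 powr (real_of_int k + 1)"
          using K0(2)[OF x] by blast
        have "H x powr (p - 2) \<le> (pow2 k) powr (p - 2)"
          using k p by (intro powr_mono2') auto
        also have "\<dots> = 2 powr (2 - p) * 2 powr ((p - 2) * real_of_int (k + 1))"
          by (simp add: powr_powr algebra_simps flip: powr_add)
        finally have "square_sum f L x * m x * H x powr (p - 2) \<le> square_sum f L x * m x *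
            (2 powr (2 - p) * 2 powr ((p - 2) * real_of_int (k + 1)))"
          using square_sum_nonneg[of f L x] by (intro mult_left_mono) auto
        also have "\<dots> = ?g (k + 1)" using k by simp
        also have "\<dots> \<le> (\<Sum>k\<in>K1. ?g k)"
          using k(1) K1 g by (intro member_le_sum) (auto simp: K1_def)
        finally show ?thesis by (simp add: mult_ac)
      qed
    qed
    also have "\<dots> = (\<Sum>k\<in>K1. \<Sum>x\<in>Y. if H x \<le> pow2 k
             then ?c k * (square_sum f L x * m x) else 0)"
      by (rule sum.swap)
    also have "\<dots> = (\<Sum>k\<in>K1. ?c k * (\<Sum>x\<in>Y \<inter> ?F k. square_sum f L x * m x))"
      unfolding sum_distrib_left using Y(1)
      by (intro sum.cong refl sum.mono_neutral_cong_right) auto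
    also have "\<dots> \<le> (\<Sum>k\<in>K1. ?c k *
        (local_const * (?E k)))"
    proof (intro sum_mono mult_left_mono)
      fix k
      have "(\<Sum>x\<in>Y \<inter> ?F k. square_sum f L x * m x)
        \<le> local_const * ((\<Sum>x\<in>Y \<inter> ?F k. (f x)^2 * m x) + (\<Sum>x\<in>Y - ?F k. (pow2 k)^2 * m x))"
        unfolding sum_square_sum by (rule sawtooth_estimate[OF Y(3) F H]) auto
      also have "\<dots> \<le> local_const * (?E k)"
        using local_const_pos nontangential_boundD(2)[OF H, of 0]
        by (intro mult_left_mono add_mono sum_mono mult_right_mono) auto
      finally show "(\<Sum>x\<in>Y \<inter> ?F k. square_sum f L x * m x) \<le> \<dots>" .
    qed auto
    also have "\<dots> = 2 powr (2 - p) * local_const * (\<Sum>k\<in>K1. \<Sum>x\<in>Y.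
         ?A k x
         + ?B k x)"
    proof -
      have e: "2 powr ((p - 2) * real_of_int k) * (pow2 k)^2 = 2 powr (p * real_of_int k)" for k
        by (simp add: left_diff_distrib powr_power flip: powr_add)
      have "(\<Sum>x\<in>Y. ?A k x
         + ?B k x)
        = 2 powr ((p - 2) * real_of_int k) * (?E k)" for k
      proof -
        have "(\<Sum>x\<in>Y. ?A k x)
          = (\<Sum>x\<in>Y \<inter> ?F k. 2 powr ((p - 2) * real_of_int k) * ((H x)^2 * m x))"
          using Y(1) by (intro sum.mono_neutral_cong_right) auto
        moreover have "(\<Sum>x\<in>Y. ?B k x)
          = (\<Sum>x\<in>Y - ?F k. 2 powr ((p - 2) * real_of_int k) * ((pow2 k)^2 * m x))"
          unfolding mult.assoc[symmetric] e using Y(1) by (intro sum.mono_neutral_cong_right) auto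
        ultimately show ?thesis by (simp only: sum.distrib distrib_left sum_distrib_left)
      qed
      then show ?thesis by (simp only: sum_distrib_left mult_ac)
    qed
    also have "\<dots> = 2 powr (2 - p) * local_const * (\<Sum>x\<in>Y. \<Sum>k\<in>K1.
         ?A k x
         + ?B k x)"
      by (subst sum.swap) simp
    \<comment> \<open>At a fixed x the levels above H x carry 2^((p - 2) k), summable upwards as p <
      2, and those below carry 2^(p k), summable downwards.\<close>
    also have "\<dots> \<le> 2 powr (2 - p) * local_const * (\<Sum>x\<in>Y. (a + b) * (H x powr p * m x))"
    proof (intro mult_left_mono sum_mono)
      fix x
      show "(\<Sum>k\<in>K1. ?A k x
         + ?B k x)
        \<le> (a + b) * (H x powr p * m x)"
      proof (cases "H x = 0")
        case False
        then have h: "H x > 0" using H0[of x] by simp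
        have "(\<Sum>k\<in>K1. ?A k x)
          = (H x)^2 * m x * (\<Sum>k\<in>{k\<in>K1. H x \<le> pow2 k}. 2 powr (- (2 - p) * real_of_int k))"
          unfolding sum_distrib_left using K1 by (intro sum.mono_neutral_cong_right) auto
        also have "\<dots> \<le> (H x)^2 * m x * (H x powr (- (2 - p)) / (1 - 2 powr (- (2 - p))))"
          using K1 h p by (intro mult_left_mono sum_dyadic_ge) auto
        also have "\<dots> = a * (((H x)^2 * H x powr (p - 2)) * m x)" by (simp add: a_def)
        also have "(H x)^2 * H x powr (p - 2) = H x powr p"
          using h by (simp flip: powr_add powr_numeral)
        finally have 1: "(\<Sum>k\<in>K1. ?A k x)
          \<le> a * (H x powr p * m x)" .
        have "(\<Sum>k\<in>K1. ?B k x)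
          \<le> (\<Sum>k\<in>{k\<in>K1. pow2 k \<le> H x}. m x * 2 powr (p * real_of_int k))"
        proof -
          have "(\<Sum>k\<in>K1. ?B k x)
            = (\<Sum>k\<in>{k\<in>K1. pow2 k < H x}. m x * 2 powr (p * real_of_int k))"
            using K1 by (intro sum.mono_neutral_cong_right) auto
          also have "\<dots> \<le> (\<Sum>k\<in>{k\<in>K1. pow2 k \<le> H x}. m x * 2 powr (p * real_of_int k))"
            using K1 by (intro sum_mono2) auto
          finally show ?thesis .
        qed
        also have "\<dots> \<le> m x * (H x powr p / (1 - 2 powr (- p)))"
          unfolding sum_distrib_left[symmetric] using K1 h p by (intro mult_left_mono sum_dyadic_le) auto
        also have "\<dots> = b * (H x powr p * m x)" by (simp add: b_def)
        finally show ?thesis using 1 by (simp add: sum.distrib distrib_right)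
      qed (auto intro!: sum_nonpos)
    qed (use local_const_pos in auto)
    finally have A: "(\<Sum>x\<in>Y. square_sum f L x * H x powr (p - 2) * m x)
      \<le> 2 powr (2 - p) * local_const * (a + b) * (\<Sum>x\<in>Y. H x powr p * m x)"
      by (simp add: sum_distrib_left mult_ac)
    have "(\<Sum>x\<in>K. square_sum f L x powr (p / 2) * m x) \<le> (\<Sum>x\<in>Y. square_sum f L x powr (p / 2) * m x)"
      using Y by (intro sum_mono2) auto
    also have "\<dots> \<le> (\<Sum>x\<in>Y. (square_sum f L x * H x powr (p - 2) + H x powr p) * m x)"
      by (intro sum_mono mult_right_mono pt) auto
    also have "\<dots> \<le> C * (\<Sum>x\<in>Y. H x powr p * m x)"
      using A unfolding C_def distrib_right sum.distrib by simp
    also have "(\<Sum>x\<in>Y. H x powr p * m x) = maxfun_const powr p * (\<Sum>x\<in>Y. maxfun R f x powr p * m x)"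
      unfolding H_def sum_distrib_left using maxfun_const_pos maxfun_nonneg
      by (intro sum.cong refl) (simp add: powr_mult)
    also have "(\<Sum>x\<in>Y. maxfun R f x powr p * m x) \<le> C\<^sub>M * (\<Sum>z | f z \<noteq> 0. \<bar>f z\<bar> powr p * m z)"
      using Y f by (intro CM) auto
    finally show ?thesis using C maxfun_const_pos by (simp add: mult.assoc mult_left_mono)
  qed
  then show ?thesis using C CM(1) maxfun_const_pos by (intro exI[of _ "C * maxfun_const powr p * C\<^sub>M"]) auto
qed

lemma square_sum_Lp_2:
  assumes "finite {z. f z \<noteq> 0}" "finite K"
  shows "(\<Sum>x\<in>K. square_sum f L x powr (2 / 2) * m x)
    \<le> local_const * (\<Sum>z | f z \<noteq> 0. \<bar>f z\<bar> powr 2 * m z)"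
proof -
  obtain Y where Y: "finite Y" "K \<subseteq> Y" "\<And>l. l \<le> Suc L \<Longrightarrow> inside Y ((P ^^ l) f)"
    using exists_inside[OF assms, of "Suc L"] by blast
  have "(\<Sum>x\<in>K. square_sum f L x powr (2 / 2) * m x) \<le> (\<Sum>x\<in>Y. square_sum f L x * m x)"
    using Y square_sum_nonneg by (simp, intro sum_mono2) auto
  also have "\<dots> \<le> local_const * (\<Sum>x\<in>Y. (f x)^2 * m x)" by (rule square_sum_L2[OF Y(3)])
  also have "(\<Sum>x\<in>Y. (f x)^2 * m x) = (\<Sum>z | f z \<noteq> 0. \<bar>f z\<bar> powr 2 * m z)"
    using Y(1) Y(3)[of 0] by (intro sum.mono_neutral_cong_right) (auto simp: inside_def)
  finally show ?thesis .
qed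

end

section \<open>Exponents above 2: duality with a weight\<close>

context heat_graph
begin

text \<open>If the averaged weight exceeds 2^k at x, the nontangential bound for w keeps x far from
  the set where its majorant is at most 2^k. So x lies in a tent at that level, and summing the tent
  estimates over k rebuilds the majorant of w.\<close>

lemma square_sum_weighted:
  assumes f: "finite {z. f z \<noteq> 0}" and w: "finite {z. w z \<noteq> 0}" "\<And>z. 0 \<le> w z"
    and Y: "finite Y" "\<And>l. l \<le> Suc L \<Longrightarrow> inside Y ((P ^^ l) f)" "\<And>l. l \<le> Suc L \<Longrightarrow> inside Y ((P ^^ l) w)"
    and R: "4 * Suc L + 3 \<le> R"
  shows "(\<Sum>x\<in>Y. square_sum f L x * w x * m x)
    \<le> 32 * local_const * (\<Sum>x\<in>Y. (maxfun_const * maxfun R f x)^2 * (maxfun_const * maxfun R w x) * m x)"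
proof -
  let ?v = "\<lambda>j x. (P ^^ j) f x - (P ^^ Suc j) f x"
  define Hf where "Hf = (\<lambda>x. maxfun_const * maxfun R f x)"
  define Hw where "Hw = (\<lambda>x. maxfun_const * maxfun R w x)"
  have Hf: "nontangential_bound (Suc L) f Hf"
    unfolding Hf_def by (intro maxfun_nontangential_bound f R)
  have Hw: "nontangential_bound (Suc L) w Hw"
    unfolding Hw_def by (intro maxfun_nontangential_bound w R)
  have Hw0: "0 \<le> Hw x" for x using maxfun_nonneg maxfun_const_pos by (simp add: Hw_def)
  \<comment> \<open>The larger half of l goes to the weight, so the scale of its average is at least
    that of the tent at time l div 2.\<close>
  define W where "W = (\<lambda>l. (P ^^ (l - l div 2)) w)"
  have W0: "0 \<le> W l x" for l x unfolding W_def by (rule P_pow_nonneg) (rule w)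
  obtain K :: "int set" where K: "finite K"
    "\<And>z. z \<in> {..<L} \<times> Y \<Longrightarrow> W (fst z) (snd z) > 0 \<Longrightarrow>
      \<exists>k\<in>K. pow2 k < W (fst z) (snd z) \<and> W (fst z) (snd z) \<le> 2 powr (real_of_int k + 1)"
    using dyadic_layers[of "{..<L} \<times> Y" "\<lambda>z. W (fst z) (snd z)"] Y(1) by auto
  let ?F = "\<lambda>k::int. {x. Hw x \<le> pow2 k}"
  let ?S = "\<lambda>k j. \<Sum>x\<in>{x\<in>Y. sqrt (real (Suc j)) \<le> real (dist_set (?F k) x)}. (?v j x)^2 * m x"
  have S0: "0 \<le> ?S k j" for k j by (intro sum_nonneg) auto
  let ?A = "\<lambda>k x. if pow2 k < Hw x then (Hf x)^2 * m x * 2 powr (1 * real_of_int k) else 0"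
  have F: "?F k \<noteq> {}" for k
  proof -
    obtain x where "maxfun R w x = 0" using exists_maxfun_zero[OF w(1)] by blast
    then have "x \<in> ?F k" by (simp add: Hw_def)
    then show ?thesis by blast
  qed
  text \<open>Jensen and symmetry move half of the semigroup onto the weight, which is thereby
    averaged at scale \<open>sqrt l\<close>.\<close>
  have move: "(\<Sum>x\<in>Y. (?v l x)^2 * w x * m x) \<le> (\<Sum>x\<in>Y. W l x * (?v (l div 2) x)^2 * m x)" if l: "l < L" for l
  proof -
    let ?i = "l - l div 2" and ?j = "l div 2"
    have "?v l = (P ^^ ?i) (?v ?j)"
    proof -
      have 1: "(P ^^ n) f = (P ^^ ?i) ((P ^^ (n - ?i)) f)" if "?i \<le> n" for n
        using that by (metis comp_apply funpow_add le_add_diff_inverse)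
      have 2: "l - ?i = ?j" "Suc l - ?i = Suc ?j" by linarith+
      have "(P ^^ ?i) (?v ?j) = (\<lambda>x. (P ^^ ?i) ((P ^^ ?j) f) x - (P ^^ ?i) ((P ^^ Suc ?j) f) x)"
        by (rule P_pow_diff)
      then show ?thesis using 1[of l] 1[of "Suc l"] unfolding 2 by simp
    qed
    then have "(?v l x)^2 \<le> (P ^^ ?i) (\<lambda>y. (?v ?j y)^2) x" for x
      using P_pow_square_le[of ?i "?v ?j" x] by (simp add: fun_eq_iff)
    then have "(\<Sum>x\<in>Y. (?v l x)^2 * w x * m x) \<le> (\<Sum>x\<in>Y. (P ^^ ?i) (\<lambda>y. (?v ?j y)^2) x * w x * m x)"
      using w(2) by (intro sum_mono mult_right_mono) auto
    also have "\<dots> = (\<Sum>x\<in>Y. w x * (P ^^ ?i) (\<lambda>y. (?v ?j y)^2) x * m x)"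
      by (simp only: mult.commute[of "w _"])
    also have "\<dots> = (\<Sum>x\<in>Y. (P ^^ ?i) w x * (?v ?j x)^2 * m x)"
      using Y(3) l by (intro P_pow_symmetric[symmetric]) auto
    finally show ?thesis by (simp add: W_def)
  qed
  have level: "(\<Sum>x\<in>Y. W l x * (?v (l div 2) x)^2 * m x) \<le> (\<Sum>k\<in>K. 2 * pow2 k * ?S k (l div 2))"
    if l: "l < L" for l
  proof -
    let ?j = "l div 2"
    let ?T = "\<lambda>k. {x\<in>Y. sqrt (real (Suc ?j)) \<le> real (dist_set (?F k) x)}"
    have "(\<Sum>x\<in>Y. W l x * (?v ?j x)^2 * m x)
       \<le> (\<Sum>x\<in>Y. \<Sum>k\<in>K. if x \<in> ?T k then 2 * pow2 k * ((?v ?j x)^2 * m x) else 0)"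
    proof (rule sum_mono)
      fix x assume x: "x \<in> Y"
      let ?g = "\<lambda>k. if x \<in> ?T k then 2 * pow2 k * ((?v ?j x)^2 * m x) else 0"
      have g: "0 \<le> ?g k" for k by auto
      show "W l x * (?v ?j x)^2 * m x \<le> (\<Sum>k\<in>K. ?g k)"
      proof (cases "W l x = 0")
        case True
        then show ?thesis using g by (simp add: sum_nonneg)
      next
        case False
        then have "W l x > 0" using W0[of l x] by simp
        then obtain k where k: "k \<in> K" "pow2 k < W l x" "W l x \<le> 2 powr (real_of_int k + 1)"
          using K(2)[of "(l, x)"] x l by auto
        \<comment> \<open>Otherwise a point z of the sublevel set lies in the cone of x, and
          \<open>Hw z\<close> would bound \<open>W l x\<close> by 2^k.\<close>
        have "x \<in> ?T k"
        proof (rule ccontr)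
          assume "x \<notin> ?T k"
          then have near: "real (dist_set (?F k) x) < sqrt (real (Suc ?j))" using x by simp
          obtain z where z: "z \<in> ?F k" "d x z = dist_set (?F k) x"
            using dist_set_attained[OF F] by blast
          have "sqrt (real (Suc ?j)) \<le> sqrt (real (Suc (l - ?j)))" by simp
          then have "real (d x z) \<le> 2 * sqrt (real (Suc (l - ?j)))"
            using near unfolding z(2) by linarith
          then have "\<bar>(P ^^ (l - ?j)) w x\<bar> \<le> Hw z"
            using l by (intro nontangential_boundD(1)[OF Hw]) auto
          then have "W l x \<le> Hw z" by (simp add: W_def)
          then show False using z(1) k(2) by simp
        qed
        moreover have "W l x \<le> 2 * pow2 k" using k(3) by (simp add: powr_add)
        then have "W l x * ((?v ?j x)^2 * m x) \<le> 2 * pow2 k * ((?v ?j x)^2 * m x)"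
          by (intro mult_right_mono) auto
        ultimately have "W l x * (?v ?j x)^2 * m x \<le> ?g k" by (simp add: mult.assoc)
        also have "\<dots> \<le> (\<Sum>k\<in>K. ?g k)" using k(1) K(1) g by (intro member_le_sum) auto
        finally show ?thesis .
      qed
    qed
    also have "\<dots> = (\<Sum>k\<in>K. \<Sum>x\<in>Y. if x \<in> ?T k then 2 * pow2 k * ((?v ?j x)^2 * m x) else 0)"
      by (rule sum.swap)
    also have "\<dots> = (\<Sum>k\<in>K. 2 * pow2 k * ?S k ?j)"
      unfolding sum_distrib_left using Y(1)
      by (intro sum.cong refl sum.mono_neutral_cong_right) auto
    finally show ?thesis .
  qed
  have "(\<Sum>x\<in>Y. square_sum f L x * w x * m x) = (\<Sum>x\<in>Y. \<Sum>l<L. real (Suc l) * ((?v l x)^2 * w x * m x))"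
    unfolding square_sum_def by (simp only: sum_distrib_right mult.assoc)
  also have "\<dots> = (\<Sum>l<L. \<Sum>x\<in>Y. real (Suc l) * ((?v l x)^2 * w x * m x))" by (rule sum.swap)
  also have "\<dots> = (\<Sum>l<L. real (Suc l) * (\<Sum>x\<in>Y. (?v l x)^2 * w x * m x))"
    by (simp only: sum_distrib_left)
  also have "\<dots> \<le> (\<Sum>l<L. real (Suc l) * (\<Sum>k\<in>K. 2 * pow2 k * ?S k (l div 2)))"
  proof (intro sum_mono mult_left_mono)
    fix l assume "l \<in> {..<L}"
    then have l: "l < L" by simp
    from order_trans[OF move[OF l] level[OF l]]
    show "(\<Sum>x\<in>Y. (?v l x)^2 * w x * m x) \<le> (\<Sum>k\<in>K. 2 * pow2 k * ?S k (l div 2))" .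
  qed auto
  also have "\<dots> = (\<Sum>l<L. \<Sum>k\<in>K. 2 * pow2 k * (real (Suc l) * ?S k (l div 2)))"
    by (rule sum.cong[OF refl], subst sum_distrib_left, rule sum.cong[OF refl], rule mult.left_commute)
  also have "\<dots> = (\<Sum>k\<in>K. \<Sum>l<L. 2 * pow2 k * (real (Suc l) * ?S k (l div 2)))"
    by (rule sum.swap)
  also have "\<dots> = (\<Sum>k\<in>K. 2 * pow2 k * (\<Sum>l<L. real (Suc l) * ?S k (l div 2)))"
    by (simp only: sum_distrib_left)
  also have "\<dots> \<le> (\<Sum>k\<in>K. 2 * pow2 k * (4 * (2 * local_const * (\<Sum>x\<in>Y - ?F k. (Hf x)^2 * m x))))"
  proof (intro sum_mono mult_left_mono)
    fix k
    have "(\<Sum>l<L. real (Suc l) * ?S k (l div 2)) \<le> 4 * (\<Sum>j<L. real (Suc j) * ?S k j)"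
      by (rule sum_halved_index_le) (rule S0)
    also have "(\<Sum>j<L. real (Suc j) * ?S k j) \<le> 2 * local_const * (\<Sum>x\<in>Y - ?F k. (Hf x)^2 * m x)"
      by (rule tent_estimate[OF Y(2) F Hf])
    finally show "(\<Sum>l<L. real (Suc l) * ?S k (l div 2))
      \<le> 4 * (2 * local_const * (\<Sum>x\<in>Y - ?F k. (Hf x)^2 * m x))" by simp
  qed auto
  \<comment> \<open>2 from rounding the weight up to a dyadic level, 4 from the halved time index, 2
    from the tent estimate; the geometric series over levels doubles this to 32.\<close>
  also have "\<dots> = 16 * local_const * (\<Sum>k\<in>K. pow2 k * (\<Sum>x\<in>Y - ?F k. (Hf x)^2 * m x))"
    by (subst sum_distrib_left, rule sum.cong[OF refl]) simp
  also have "(\<Sum>k\<in>K. pow2 k * (\<Sum>x\<in>Y - ?F k. (Hf x)^2 * m x))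
     = (\<Sum>k\<in>K. \<Sum>x\<in>Y. ?A k x)"
    unfolding sum_distrib_left using Y(1)
    by (intro sum.cong[OF refl] sum.mono_neutral_cong_left) auto
  also have "\<dots> = (\<Sum>x\<in>Y. \<Sum>k\<in>K. ?A k x)"
    by (rule sum.swap)
  also have "16 * local_const * \<dots> \<le> 16 * local_const * (\<Sum>x\<in>Y. 2 * ((Hf x)^2 * Hw x * m x))"
  proof (intro mult_left_mono sum_mono)
    fix x
    show "(\<Sum>k\<in>K. ?A k x)
      \<le> 2 * ((Hf x)^2 * Hw x * m x)"
    proof (cases "Hw x = 0")
      case False
      then have h: "Hw x > 0" using Hw0[of x] by simp
      have "(\<Sum>k\<in>{k\<in>K. pow2 k < Hw x}. 2 powr (1 * real_of_int k))
         \<le> (\<Sum>k\<in>{k\<in>K. pow2 k \<le> Hw x}. 2 powr (1 * real_of_int k))"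
        using K(1) by (intro sum_mono2) auto
      also have "\<dots> \<le> Hw x powr 1 / (1 - 2 powr (- 1))"
        using K(1) h by (intro sum_dyadic_le) auto
      also have "\<dots> = 2 * Hw x" using h by (simp add: powr_minus)
      finally have "(Hf x)^2 * m x * (\<Sum>k\<in>{k\<in>K. pow2 k < Hw x}. 2 powr (1 * real_of_int k))
        \<le> (Hf x)^2 * m x * (2 * Hw x)" by (intro mult_left_mono) auto
      moreover have "(\<Sum>k\<in>K. ?A k x)
        = (Hf x)^2 * m x * (\<Sum>k\<in>{k\<in>K. pow2 k < Hw x}. 2 powr (1 * real_of_int k))"
        unfolding sum_distrib_left using K(1) by (intro sum.mono_neutral_cong_right) auto
      ultimately show ?thesis by (simp only: mult_ac)
    qed (auto intro!: sum_nonpos)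
  qed (use local_const_pos in auto)
  also have "\<dots> = 32 * local_const * (\<Sum>x\<in>Y. (Hf x)^2 * Hw x * m x)"
    unfolding sum_distrib_left by (intro sum.cong refl) simp
  finally show ?thesis by (simp add: Hf_def Hw_def)
qed

text \<open>Duality with the explicit weight \<open>w = square_sum f L powr (p / 2 - 1)\<close> on \<open>K\<close>: its \<open>q\<close>-th power is the
  integrand on the left, so after Young's inequality that term is absorbed.\<close>

lemma square_sum_Lp_above_2:
  assumes p: "2 < p"
  shows "\<exists>C>0. \<forall>f K L. finite {z. f z \<noteq> 0} \<longrightarrow> finite K \<longrightarrow>
    (\<Sum>x\<in>K. square_sum f L x powr (p / 2) * m x) \<le> C * (\<Sum>z | f z \<noteq> 0. \<bar>f z\<bar> powr p * m z)"
proof -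
  \<comment> \<open>The exponent conjugate to p / 2.\<close>
  define q where "q = p / (p - 2)"
  have q: "1 < q" "1 / (p / 2) + 1 / q = 1" using p by (auto simp: q_def field_simps)
  obtain C\<^sub>p where Cp: "C\<^sub>p > 0" "\<And>f R Y A. finite Y \<Longrightarrow> finite A \<Longrightarrow> {z. f z \<noteq> 0} \<subseteq> A \<Longrightarrow>
     (\<Sum>x\<in>Y. maxfun R f x powr p * m x) \<le> C\<^sub>p * (\<Sum>z\<in>A. \<bar>f z\<bar> powr p * m z)"
    using maxfun_strong_type[of p] p by auto
  obtain C\<^sub>q where Cq: "C\<^sub>q > 0" "\<And>f R Y A. finite Y \<Longrightarrow> finite A \<Longrightarrow> {z. f z \<noteq> 0} \<subseteq> A \<Longrightarrow>
     (\<Sum>x\<in>Y. maxfun R f x powr q * m x) \<le> C\<^sub>q * (\<Sum>z\<in>A. \<bar>f z\<bar> powr q * m z)"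
    using maxfun_strong_type[OF q(1)] by blast
  define B where "B = 32 * local_const"
  have B: "B > 0" using local_const_pos by (simp add: B_def)
  \<comment> \<open>Chosen to give \<open>?T\<close> the coefficient 1/2 on the right;
    \<open>?T\<close> is a finite sum, so that half can be subtracted.\<close>
  define \<epsilon> where "\<epsilon> = (1 / (2 * B * (maxfun_const powr q * C\<^sub>q))) powr (1 / q)"
  have e: "\<epsilon> > 0" using B maxfun_const_pos Cq(1) by (simp add: \<epsilon>_def)
  have eq: "B * (\<epsilon> powr q * (maxfun_const powr q * C\<^sub>q)) = 1 / 2"
    using B maxfun_const_pos Cq(1) q(1) by (simp add: \<epsilon>_def powr_powr field_simps)
  define C where "C = 2 * B * ((1 / \<epsilon>) powr (p / 2) * (maxfun_const powr p * C\<^sub>p))"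
  have C: "C > 0" using B e maxfun_const_pos Cp(1) by (simp add: C_def)
  have "(\<Sum>x\<in>K. square_sum f L x powr (p / 2) * m x) \<le> C * (\<Sum>z | f z \<noteq> 0. \<bar>f z\<bar> powr p * m z)"
    if f: "finite {z. f z \<noteq> 0}" and K: "finite K" for f K L
  proof -
    let ?T = "\<Sum>x\<in>K. square_sum f L x powr (p / 2) * m x"
    let ?N = "\<Sum>z | f z \<noteq> 0. \<bar>f z\<bar> powr p * m z"
    define w where "w = (\<lambda>x. if x \<in> K then square_sum f L x powr (p / 2 - 1) else 0)"
    have w: "{z. w z \<noteq> 0} \<subseteq> K" by (auto simp: w_def)
    have finw: "finite {z. w z \<noteq> 0}" by (rule finite_subset[OF w K])
    define R where "R = 4 * Suc L + 3"
    obtain Y1 where Y1: "finite Y1" "K \<subseteq> Y1" "\<And>l. l \<le> Suc L \<Longrightarrow> inside Y1 ((P ^^ l) f)"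
      using exists_inside[OF f K, of "Suc L"] by blast
    obtain Y where Y: "finite Y" "Y1 \<subseteq> Y" "\<And>l. l \<le> Suc L \<Longrightarrow> inside Y ((P ^^ l) w)"
      using exists_inside[OF finw Y1(1), of "Suc L"] by blast
    let ?Hf = "\<lambda>x. maxfun_const * maxfun R f x" and ?Hw = "\<lambda>x. maxfun_const * maxfun R w x"
    have H0: "0 \<le> ?Hf x" "0 \<le> ?Hw x" for x using maxfun_nonneg maxfun_const_pos by auto
    have sumHf: "(\<Sum>x\<in>Y. ?Hf x powr p * m x) \<le> maxfun_const powr p * C\<^sub>p * ?N"
    proof -
      have "(\<Sum>x\<in>Y. ?Hf x powr p * m x) = maxfun_const powr p * (\<Sum>x\<in>Y. maxfun R f x powr p * m x)"
        unfolding sum_distrib_left using maxfun_const_pos maxfun_nonneg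
        by (intro sum.cong refl) (simp add: powr_mult)
      also have "\<dots> \<le> maxfun_const powr p * (C\<^sub>p * ?N)" using Y f by (intro mult_left_mono Cp) auto
      finally show ?thesis by (simp add: mult.assoc)
    qed
    have sumHw: "(\<Sum>x\<in>Y. ?Hw x powr q * m x) \<le> maxfun_const powr q * C\<^sub>q * ?T"
    proof -
      have "(\<Sum>x\<in>Y. ?Hw x powr q * m x) = maxfun_const powr q * (\<Sum>x\<in>Y. maxfun R w x powr q * m x)"
        unfolding sum_distrib_left using maxfun_const_pos maxfun_nonneg
        by (intro sum.cong refl) (simp add: powr_mult)
      also have "\<dots> \<le> maxfun_const powr q * (C\<^sub>q * (\<Sum>z\<in>K. \<bar>w z\<bar> powr q * m z))"
        using Y K w by (intro mult_left_mono Cq) auto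
      also have "(\<Sum>z\<in>K. \<bar>w z\<bar> powr q * m z) = ?T"
      proof (rule sum.cong[OF refl])
        fix z assume "z \<in> K"
        have "(p / 2 - 1) * q = p / 2" using p by (simp add: q_def field_simps)
        moreover have "\<bar>w z\<bar> powr q = square_sum f L z powr ((p / 2 - 1) * q)"
          using \<open>z \<in> K\<close> by (simp add: w_def powr_powr)
        ultimately show "\<bar>w z\<bar> powr q * m z = square_sum f L z powr (p / 2) * m z" by (simp only:)
      qed
      finally show ?thesis by (simp add: mult.assoc)
    qed
    have young: "(?Hf x)^2 * ?Hw x \<le> (1 / \<epsilon>) powr (p / 2) * ?Hf x powr p + \<epsilon> powr q * ?Hw x powr q" for x
    proof -
      have "(?Hf x)^2 * ?Hw x = ((?Hf x)^2 / \<epsilon>) * (\<epsilon> * ?Hw x)" using e by simp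
      also have "\<dots> \<le> ((?Hf x)^2 / \<epsilon>) powr (p / 2) / (p / 2) + (\<epsilon> * ?Hw x) powr q / q"
        using p q H0[of x] e by (intro Youngs_inequality) auto
      \<comment> \<open>Both denominators p / 2 and q exceed 1 and are dropped.\<close>
      also have "\<dots> \<le> ((?Hf x)^2 / \<epsilon>) powr (p / 2) / 1 + (\<epsilon> * ?Hw x) powr q / 1"
        using p q by (intro add_mono divide_left_mono) auto
      also have "((?Hf x)^2 / \<epsilon>) powr (p / 2) = (1 / \<epsilon>) powr (p / 2) * ?Hf x powr p"
      proof -
        have "((?Hf x)^2) powr (p / 2) = ?Hf x powr p"
          using H0(1)[of x] by (cases "?Hf x = 0") (auto simp: powr_powr simp flip: powr_numeral)
        then show ?thesis using e by (simp add: powr_divide)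
      qed
      also have "(\<epsilon> * ?Hw x) powr q = \<epsilon> powr q * ?Hw x powr q" using e H0(2)[of x] by (simp add: powr_mult)
      finally show ?thesis by simp
    qed
    have "?T = (\<Sum>x\<in>K. square_sum f L x * w x * m x)"
    proof (rule sum.cong[OF refl])
      fix x assume "x \<in> K"
      have "square_sum f L x powr (p / 2) = square_sum f L x * square_sum f L x powr (p / 2 - 1)"
        using square_sum_nonneg[of f L x] p by (cases "square_sum f L x = 0") (auto simp: powr_mult_base)
      then show "square_sum f L x powr (p / 2) * m x = square_sum f L x * w x * m x"
        using \<open>x \<in> K\<close> by (simp add: w_def)
    qed
    also have "\<dots> \<le> (\<Sum>x\<in>Y. square_sum f L x * w x * m x)"
      using Y(1,2) Y1(2) square_sum_nonneg by (intro sum_mono2) (auto simp: w_def)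
    also have "\<dots> \<le> B * (\<Sum>x\<in>Y. (?Hf x)^2 * ?Hw x * m x)"
      unfolding B_def
      by (rule square_sum_weighted[OF f finw _ Y(1) _ Y(3)])
        (use Y Y1 in \<open>auto simp: w_def R_def intro: inside_mono[OF Y1(3)]\<close>)
    also have "\<dots> \<le> B * (\<Sum>x\<in>Y. ((1 / \<epsilon>) powr (p / 2) * ?Hf x powr p + \<epsilon> powr q * ?Hw x powr q) * m x)"
      using B by (intro mult_left_mono sum_mono mult_right_mono young) auto
    also have "\<dots> = B * ((1 / \<epsilon>) powr (p / 2) * (\<Sum>x\<in>Y. ?Hf x powr p * m x)
        + \<epsilon> powr q * (\<Sum>x\<in>Y. ?Hw x powr q * m x))"
      by (simp add: distrib_right sum.distrib sum_distrib_left mult.assoc)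
    also have "\<dots> \<le> B * ((1 / \<epsilon>) powr (p / 2) * (maxfun_const powr p * C\<^sub>p * ?N) + \<epsilon> powr q * (maxfun_const powr q * C\<^sub>q * ?T))"
      using B sumHf sumHw by (intro mult_left_mono add_mono) auto
    also have "\<dots> = C / 2 * ?N + (B * (\<epsilon> powr q * (maxfun_const powr q * C\<^sub>q))) * ?T"
      by (simp add: C_def distrib_left)
    finally show ?thesis unfolding eq by simp
  qed
  then show ?thesis using C by blast
qed

theorem square_sum_Lp:
  assumes p: "1 < p"
  shows "\<exists>C>0. \<forall>f K L. finite {z. f z \<noteq> 0} \<longrightarrow> finite K \<longrightarrow>
    (\<Sum>x\<in>K. square_sum f L x powr (p / 2) * m x) \<le> C * (\<Sum>z | f z \<noteq> 0. \<bar>f z\<bar> powr p * m z)"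
proof -
  consider "p < 2" | "p = 2" | "2 < p" by linarith
  then show ?thesis
  proof cases
    case 1 then show ?thesis using square_sum_Lp_below_2 p by blast
  next
    case 2 then show ?thesis using square_sum_Lp_2 local_const_pos by blast
  next
    case 3 then show ?thesis by (rule square_sum_Lp_above_2)
  qed
qed

end

section \<open>The square function of a complex function\<close>

context weighted_graph
begin

lemma markov_op_eq: "markov_op \<mu> f x = (\<Sum>y | adj \<mu> x y. of_real (transition \<mu> x y) * f y)"
proof -
  have "markov_op \<mu> f x = (\<Sum>\<^sub>\<infinity>y\<in>{y. adj \<mu> x y}. of_real (transition \<mu> x y) * f y)"
    unfolding markov_op_def by (rule infsum_cong_neutral) (auto simp: transition_def weight_zero)
  then show ?thesis by (simp add: infsum_finite)
qed

lemma Re_markov_op: "Re (markov_op \<mu> f x) = P (\<lambda>y. Re (f y)) x"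
  by (simp add: markov_op_eq P_def transition_def sum_divide_distrib)

lemma Im_markov_op: "Im (markov_op \<mu> f x) = P (\<lambda>y. Im (f y)) x"
  by (simp add: markov_op_eq P_def transition_def sum_divide_distrib)

lemma Re_markov_op_pow: "(\<lambda>x. Re ((markov_op \<mu> ^^ l) f x)) = (P ^^ l) (\<lambda>y. Re (f y))"
  by (induction l) (auto simp: Re_markov_op)

lemma Im_markov_op_pow: "(\<lambda>x. Im ((markov_op \<mu> ^^ l) f x)) = (P ^^ l) (\<lambda>y. Im (f y))"
  by (induction l) (auto simp: Im_markov_op)

lemma g_term_eq:
  "g_term \<mu> f x l = real l * (((P ^^ l) (\<lambda>y. Re (f y)) x - (P ^^ Suc l) (\<lambda>y. Re (f y)) x)^2
      + ((P ^^ l) (\<lambda>y. Im (f y)) x - (P ^^ Suc l) (\<lambda>y. Im (f y)) x)^2)"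
  using fun_cong[OF Re_markov_op_pow[of l f], of x] fun_cong[OF Im_markov_op_pow[of l f], of x]
  by (simp add: g_term_def cmod_power2 Re_markov_op Im_markov_op Re_markov_op_pow Im_markov_op_pow)

lemma g_term_nonneg: "0 \<le> g_term \<mu> f x l"
  by (simp add: g_term_def)

text \<open>Finite propagation: this is what reduces a general f in L^p to finitely supported
  functions without a density argument.\<close>

lemma square_sum_local:
  assumes "\<And>y. d x y \<le> L \<Longrightarrow> u y = v y"
  shows "square_sum u L x = square_sum v L x"
proof -
  have "(P ^^ l) u x = (P ^^ l) v x" if "l \<le> L" for l
    using that assms by (intro P_pow_local) auto
  then show ?thesis unfolding square_sum_def
    by (intro sum.cong refl) (simp del: funpow.simps)
qed

abbreviation g_sum :: "('a \<Rightarrow> complex) \<Rightarrow> nat \<Rightarrow> 'a \<Rightarrow> real" where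
  "g_sum f L x \<equiv> \<Sum>l<L. g_term \<mu> f x l"

lemma sum_g_term_le:
  "g_sum f L x \<le> square_sum (\<lambda>y. Re (f y)) L x + square_sum (\<lambda>y. Im (f y)) L x"
  unfolding square_sum_def sum.distrib[symmetric] distrib_left[symmetric] g_term_eq
  by (intro sum_mono mult_right_mono) auto

end

lemma powr_add_le:
  fixes a b r :: real
  assumes "0 \<le> a" "0 \<le> b" "0 \<le> r"
  shows "(a + b) powr r \<le> 2 powr r * (a powr r + b powr r)"
proof -
  have "(a + b) powr r \<le> (2 * max a b) powr r" using assms by (intro powr_mono2) auto
  also have "\<dots> = 2 powr r * max a b powr r" using assms by (simp add: powr_mult)
  also have "max a b powr r \<le> a powr r + b powr r" by (auto simp: max_def)
  finally show ?thesis by simp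
qed

section \<open>Passage from finite truncations to the full square function\<close>

context heat_graph
begin

lemma finite_g_sum_Lp:
  assumes p: "1 < p"
  shows "\<exists>C>0. \<forall>f K L. in_Lp \<mu> p f \<longrightarrow> finite K \<longrightarrow>
    (\<Sum>x\<in>K. g_sum f L x powr (p / 2) * m x)
      \<le> C * (\<Sum>\<^sub>\<infinity>x. norm (f x) powr p * m x)"
proof -
  obtain C where C: "C > 0" "\<And>f K L. finite {z. f z \<noteq> 0} \<Longrightarrow> finite K \<Longrightarrow>
    (\<Sum>x\<in>K. square_sum f L x powr (p / 2) * m x) \<le> C * (\<Sum>z | f z \<noteq> 0. \<bar>f z\<bar> powr p * m z)"
    using square_sum_Lp[OF p] by blast
  have "(\<Sum>x\<in>K. g_sum f L x powr (p / 2) * m x)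
      \<le> 2 powr (p / 2) * (2 * C) * (\<Sum>\<^sub>\<infinity>x. norm (f x) powr p * m x)"
    if f: "in_Lp \<mu> p f" and K: "finite K" for f K L
  proof -
    let ?I = "\<Sum>\<^sub>\<infinity>x. norm (f x) powr p * m x"
    \<comment> \<open>The part of the graph on which the truncated sums over \<open>K\<close>
      depend; cutting f off outside it changes nothing on \<open>K\<close> and does not increase the
      L^p norm.\<close>
    define A where "A = (\<Union>x\<in>K. B x (real L))"
    have A: "finite A" using K by (simp add: A_def)
    have part: "(\<Sum>x\<in>K. square_sum (\<lambda>y. \<phi> (f y)) L x powr (p / 2) * m x) \<le> C * ?I"
      if \<phi>: "\<And>z. \<bar>\<phi> z\<bar> \<le> norm z" for \<phi> :: "complex \<Rightarrow> real"
    proof -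
      let ?h = "\<lambda>y. if y \<in> A then \<phi> (f y) else 0"
      have fin: "finite {z. ?h z \<noteq> 0}" by (rule finite_subset[OF _ A]) auto
      have "square_sum (\<lambda>y. \<phi> (f y)) L x = square_sum ?h L x" if "x \<in> K" for x
        using that by (intro square_sum_local) (auto simp: A_def mem_ball)
      then have "(\<Sum>x\<in>K. square_sum (\<lambda>y. \<phi> (f y)) L x powr (p / 2) * m x)
        = (\<Sum>x\<in>K. square_sum ?h L x powr (p / 2) * m x)" by simp
      also have "\<dots> \<le> C * (\<Sum>z | ?h z \<noteq> 0. \<bar>?h z\<bar> powr p * m z)" by (rule C(2)[OF fin K])
      also have "(\<Sum>z | ?h z \<noteq> 0. \<bar>?h z\<bar> powr p * m z) \<le> (\<Sum>z | ?h z \<noteq> 0. norm (f z) powr p * m z)"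
        using p \<phi> by (intro sum_mono mult_right_mono powr_mono2) auto
      also have "\<dots> \<le> ?I"
        using f fin unfolding in_Lp_def by (intro finite_sum_le_infsum) auto
      finally show ?thesis using C(1) by (simp add: mult_left_mono)
    qed
    have "(\<Sum>x\<in>K. g_sum f L x powr (p / 2) * m x)
      \<le> (\<Sum>x\<in>K. 2 powr (p / 2) * (square_sum (\<lambda>y. Re (f y)) L x powr (p / 2)
           + square_sum (\<lambda>y. Im (f y)) L x powr (p / 2)) * m x)"
    proof (intro sum_mono mult_right_mono)
      fix x
      have "g_sum f L x powr (p / 2)
        \<le> (square_sum (\<lambda>y. Re (f y)) L x + square_sum (\<lambda>y. Im (f y)) L x) powr (p / 2)"
        using p by (intro powr_mono2 sum_g_term_le sum_nonneg g_term_nonneg) auto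
      also have "\<dots> \<le> 2 powr (p / 2) * (square_sum (\<lambda>y. Re (f y)) L x powr (p / 2)
           + square_sum (\<lambda>y. Im (f y)) L x powr (p / 2))"
        using p by (intro powr_add_le square_sum_nonneg) auto
      finally show "g_sum f L x powr (p / 2) \<le> \<dots>" .
    qed auto
    also have "\<dots> = 2 powr (p / 2) * ((\<Sum>x\<in>K. square_sum (\<lambda>y. Re (f y)) L x powr (p / 2) * m x)
        + (\<Sum>x\<in>K. square_sum (\<lambda>y. Im (f y)) L x powr (p / 2) * m x))"
      by (simp add: distrib_left distrib_right sum.distrib sum_distrib_left mult.assoc)
    also have "\<dots> \<le> 2 powr (p / 2) * (C * ?I + C * ?I)"
      by (intro mult_left_mono add_mono part abs_Re_le_cmod abs_Im_le_cmod) auto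
    finally show ?thesis by simp
  qed
  then show ?thesis using C(1) by (intro exI[of _ "2 powr (p / 2) * (2 * C)"]) auto
qed

lemma g_term_summable:
  assumes "\<And>L. g_sum f L x \<le> M"
  shows "g_term \<mu> f x summable_on {1..}"
proof (rule nonneg_bdd_above_summable_on)
  have "(\<Sum>l\<in>F. g_term \<mu> f x l) \<le> M" if F: "finite F" for F
  proof -
    obtain L where "F \<subseteq> {..<L}" using finite_nat_bounded[OF F] by blast
    then have "(\<Sum>l\<in>F. g_term \<mu> f x l) \<le> g_sum f L x"
      using g_term_nonneg by (intro sum_mono2) auto
    then show ?thesis using assms[of L] by linarith
  qed
  then show "bdd_above (sum (g_term \<mu> f x) ` {F. F \<subseteq> {1..} \<and> finite F})"
    by (intro bdd_aboveI[of _ M]) auto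
qed (rule g_term_nonneg)

lemma g_term_sums:
  assumes "g_term \<mu> f x summable_on {1..}"
  shows "(\<lambda>L. \<Sum>l<L. g_term \<mu> f x l) \<longlonglongrightarrow> (\<Sum>\<^sub>\<infinity>l\<in>{1..}. g_term \<mu> f x l)"
proof -
  have "(g_term \<mu> f x has_sum (\<Sum>\<^sub>\<infinity>l\<in>{1..}. g_term \<mu> f x l)) {1..}"
    using assms by (rule has_sum_infsum)
  \<comment> \<open>The index 0 can be added because its term carries the factor l = 0.\<close>
  also have "?this \<longleftrightarrow> (g_term \<mu> f x has_sum (\<Sum>\<^sub>\<infinity>l\<in>{1..}. g_term \<mu> f x l)) UNIV"
    by (rule has_sum_cong_neutral) (auto simp: g_term_def not_le)
  finally show ?thesis using has_sum_imp_sums sums_def by blast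
qed

text \<open>The truncated bound is uniform in \<open>K\<close> and \<open>L\<close>. Taken at a
  single vertex it gives convergence of the series, as m x > 0; then \<open>L\<close> tends to
  infinity for fixed \<open>K\<close>, and finally the finite sets \<open>K\<close> exhaust the
  graph.\<close>

theorem g_function_Lp_bounded:
  assumes p: "1 < p"
  shows "\<exists>C>0. \<forall>f. in_Lp \<mu> p f \<longrightarrow>
     (\<forall>x. g_term \<mu> f x summable_on {1..}) \<and> in_Lp \<mu> p (g_function \<mu> f) \<and>
     Lp_norm \<mu> p (g_function \<mu> f) \<le> C * Lp_norm \<mu> p f"
proof -
  obtain C where C: "C > 0" "\<And>f K L. in_Lp \<mu> p f \<Longrightarrow> finite K \<Longrightarrow>
    (\<Sum>x\<in>K. g_sum f L x powr (p / 2) * m x)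
      \<le> C * (\<Sum>\<^sub>\<infinity>x. norm (f x) powr p * m x)"
    using finite_g_sum_Lp[OF p] by blast
  have "(\<forall>x. g_term \<mu> f x summable_on {1..}) \<and> in_Lp \<mu> p (g_function \<mu> f) \<and>
     Lp_norm \<mu> p (g_function \<mu> f) \<le> C powr (1 / p) * Lp_norm \<mu> p f"
    if f: "in_Lp \<mu> p f" for f
  proof -
    let ?I = "\<Sum>\<^sub>\<infinity>x. norm (f x) powr p * m x"
    let ?G = "\<lambda>x. \<Sum>\<^sub>\<infinity>l\<in>{1..}. g_term \<mu> f x l"
    have I: "0 \<le> ?I" by (intro infsum_nonneg) auto
    have sm: "g_term \<mu> f x summable_on {1..}" for x
    proof (rule g_term_summable)
      fix L
      have s: "0 \<le> g_sum f L x" by (intro sum_nonneg g_term_nonneg)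
      have "g_sum f L x powr (p / 2) * m x \<le> C * ?I"
        using C(2)[OF f, of "{x}" L] by simp
      then have "g_sum f L x powr (p / 2) \<le> C * ?I / m x"
        using vertex_measure_pos[of x] by (simp add: field_simps)
      then have "(g_sum f L x powr (p / 2)) powr (2 / p) \<le> (C * ?I / m x) powr (2 / p)"
        using p by (intro powr_mono2) auto
      then show "g_sum f L x \<le> (C * ?I / m x) powr (2 / p)"
        using p s by (simp add: powr_powr)
    qed
    have G: "norm (g_function \<mu> f x) powr p = ?G x powr (p / 2)" for x
    proof -
      have "0 \<le> ?G x" by (intro infsum_nonneg g_term_nonneg)
      then show ?thesis by (simp add: g_function_def powr_powr flip: powr_half_sqrt)
    qed
    have fin: "(\<Sum>x\<in>K. norm (g_function \<mu> f x) powr p * m x) \<le> C * ?I" if K: "finite K" for K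
    proof (rule LIMSEQ_le_const2)
      show "(\<lambda>L. \<Sum>x\<in>K. g_sum f L x powr (p / 2) * m x)
        \<longlonglongrightarrow> (\<Sum>x\<in>K. norm (g_function \<mu> f x) powr p * m x)"
        unfolding G
      proof (intro tendsto_sum tendsto_mult tendsto_const)
        fix x
        show "(\<lambda>L. g_sum f L x powr (p / 2)) \<longlonglongrightarrow> ?G x powr (p / 2)"
          using p by (intro tendsto_powr' g_term_sums sm tendsto_const)
            (auto intro!: always_eventually sum_nonneg g_term_nonneg)
      qed
      show "\<exists>N. \<forall>L\<ge>N. (\<Sum>x\<in>K. g_sum f L x powr (p / 2) * m x) \<le> C * ?I"
        using C(2)[OF f K] by blast
    qed
    have inLp: "in_Lp \<mu> p (g_function \<mu> f)"
      unfolding in_Lp_def using fin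
      by (intro nonneg_bdd_above_summable_on bdd_aboveI[of _ "C * ?I"]) auto
    moreover have "Lp_norm \<mu> p (g_function \<mu> f) \<le> (C * ?I) powr (1 / p)"
      unfolding Lp_norm_def
      using p inLp fin unfolding in_Lp_def
      by (intro powr_mono2 infsum_nonneg infsum_le_finite_sums) auto
    moreover have "(C * ?I) powr (1 / p) = C powr (1 / p) * Lp_norm \<mu> p f"
      using C(1) I by (simp add: powr_mult Lp_norm_def)
    ultimately show ?thesis using sm by simp
  qed
  then show ?thesis using C(1) by (intro exI[of _ "C powr (1 / p)"]) auto
qed

end

theorem theorem1p15:
  fixes \<mu> :: "'a \<Rightarrow> 'a \<Rightarrow> real" and \<alpha> p :: real
  assumes "weighted_graph \<mu>"
    and "doubling \<mu>"
    and "DUE \<mu>"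
    and "\<alpha> > 0"
    and "Delta_cond \<mu> \<alpha>"
    and "1 < p"
  shows "\<exists>C>0. \<forall>f :: 'a \<Rightarrow> complex. in_Lp \<mu> p f \<longrightarrow>
           (\<forall>x. g_term \<mu> f x summable_on {1..}) \<and>
           in_Lp \<mu> p (g_function \<mu> f) \<and>
           Lp_norm \<mu> p (g_function \<mu> f) \<le> C * Lp_norm \<mu> p f"
proof -
  interpret weighted_graph \<mu> by fact
  obtain C where C: "\<And>x r. r > 0 \<Longrightarrow> volume \<mu> x (2 * r) \<le> C * volume \<mu> x r"
    using assms(2) unfolding doubling_def by blast
  obtain C' where C': "C' > 0" "\<And>x k. k \<ge> 1 \<Longrightarrow>
      transition_iter \<mu> k x x \<le> C' * vertex_measure \<mu> x / volume \<mu> x (sqrt (real k))"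
    using assms(3) unfolding DUE_def by blast
  \<comment> \<open>The maximum with 1 normalises the doubling constant as the locale asks.\<close>
  interpret heat_graph \<mu> \<alpha> "max C 1" C'
  proof unfold_locales
    fix x :: 'a and r :: real assume r: "r > 0"
    then have "C * V x r \<le> max C 1 * V x r"
      using volume_pos[of r x] by (intro mult_right_mono) auto
    then show "V x (2 * r) \<le> max C 1 * V x r" using C[OF r, of x] by linarith
  qed (use assms C' in auto)
  show ?thesis by (rule g_function_Lp_bounded) fact
qed

end
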